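(* Let $n$ be a positive integer and $q=3^{2n+1}$. Suppose $\Pi$ is a projective plane such that for every embedding $\varphi:\mathcal{R}(3)\to\Pi$, the image $\varphi(\mathcal{R}(3))$ is contained in a pappian subplane of $\Pi$. Then the Ree unital $\mathcal{R}(q)$ has no embedding in $\Pi$. In particular, $\mathcal{R}(q)$ has no embedding in a projective plane $\mathsf{PG}(2,F)$ over a field $F$. *)

theory Defs
  imports
    "HOL-Analysis.Cartesian_Space"
    "HOL-Algebra.Bij"
    "HOL-Algebra.Generated_Groups"
begin

section \<open>Incidence structures and projective planes\<close>

record ('p, 'l) incidence_structure =
  points :: "'p set"
  lines :: "'l set"
  incident :: "'p \<Rightarrow> 'l \<Rightarrow> bool"

definition collinear_in :: "('p, 'l) incidence_structure \<Rightarrow> 'p set \<Rightarrow> bool" where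
  "collinear_in S A \<longleftrightarrow> A \<subseteq> points S \<and> (\<exists>l\<in>lines S. \<forall>p\<in>A. incident S p l)"

definition projective_plane :: "('p, 'l) incidence_structure \<Rightarrow> bool" where
  "projective_plane S \<longleftrightarrow>
     (\<forall>p\<in>points S. \<forall>p'\<in>points S. p \<noteq> p' \<longrightarrow>
        (\<exists>!l. l \<in> lines S \<and> incident S p l \<and> incident S p' l)) \<and>
     (\<forall>l\<in>lines S. \<forall>l'\<in>lines S. l \<noteq> l' \<longrightarrow>
        (\<exists>!p. p \<in> points S \<and> incident S p l \<and> incident S p l')) \<and>
     (\<exists>Q. Q \<subseteq> points S \<and> card Q = 4 \<and>
        (\<forall>A. A \<subseteq> Q \<and> card A = 3 \<longrightarrow> \<not> collinear_in S A))"

definition subplane :: "('p, 'l) incidence_structure \<Rightarrow> ('p, 'l) incidence_structure \<Rightarrow> bool" where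
  "subplane S T \<longleftrightarrow>
     projective_plane S \<and> points S \<subseteq> points T \<and> lines S \<subseteq> lines T \<and>
     (\<forall>p\<in>points S. \<forall>l\<in>lines S. incident S p l \<longleftrightarrow> incident T p l)"

text \<open>
  Pappus' theorem for the hexagon \<open>a b' c a' b c'\<close> with vertices alternating between
  \<open>l\<close> and \<open>m\<close>.  No vertex is on both lines, so the lines \<open>ab'\<close> and \<open>a'b\<close> are distinct and
  the collinearity conditions say exactly that \<open>x\<close> is their intersection;
  likewise for \<open>y\<close> and \<open>z\<close>.
\<close>

definition pappian :: "('p, 'l) incidence_structure \<Rightarrow> bool" where
  "pappian S \<longleftrightarrow>
     (\<forall>l\<in>lines S. \<forall>m\<in>lines S.
      \<forall>a\<in>points S. \<forall>b\<in>points S. \<forall>c\<in>points S.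
      \<forall>a'\<in>points S. \<forall>b'\<in>points S. \<forall>c'\<in>points S.
      \<forall>x\<in>points S. \<forall>y\<in>points S. \<forall>z\<in>points S.
        l \<noteq> m \<and>
        distinct [a, b, c] \<and> (\<forall>p\<in>{a, b, c}. incident S p l \<and> \<not> incident S p m) \<and>
        distinct [a', b', c'] \<and> (\<forall>p\<in>{a', b', c'}. incident S p m \<and> \<not> incident S p l) \<and>
        collinear_in S {a, b', x} \<and> collinear_in S {a', b, x} \<and>
        collinear_in S {a, c', y} \<and> collinear_in S {a', c, y} \<and>
        collinear_in S {b, c', z} \<and> collinear_in S {b', c, z}
        \<longrightarrow> collinear_in S {x, y, z})"

definition PG2 :: "(('f::field ^ 3) set, ('f ^ 3) set) incidence_structure" where
  "PG2 = \<lparr>points = {V. vec.subspace V \<and> vec.dim V = 1},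
          lines = {W. vec.subspace W \<and> vec.dim W = 2},
          incident = (\<subseteq>)\<rparr>"

text \<open>
  Injectivity on lines is part of the notion of embedding: distinct blocks must not be
  squeezed into a common line of the target.
\<close>

definition is_embedding ::
  "('p, 'b) incidence_structure \<Rightarrow> ('q, 'l) incidence_structure \<Rightarrow> ('p \<Rightarrow> 'q) \<Rightarrow> ('b \<Rightarrow> 'l) \<Rightarrow> bool"
where
  "is_embedding U S \<phi> \<psi> \<longleftrightarrow>
     inj_on \<phi> (points U) \<and> \<phi> ` points U \<subseteq> points S \<and>
     inj_on \<psi> (lines U) \<and> \<psi> ` lines U \<subseteq> lines S \<and>
     (\<forall>p\<in>points U. \<forall>b\<in>lines U. incident U p b \<longleftrightarrow> incident S (\<phi> p) (\<psi> b))"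

definition embeddable :: "('p, 'b) incidence_structure \<Rightarrow> ('q, 'l) incidence_structure \<Rightarrow> bool" where
  "embeddable U S \<longleftrightarrow> (\<exists>\<phi> \<psi>. is_embedding U S \<phi> \<psi>)"


section \<open>The Ree group and the Ree unital\<close>

text \<open>
  Everything below is meant for a field with \<open>q = 3 ^ (2 * n + 1)\<close> elements.  On such a field
  \<open>\<theta> n\<close> is the Tits endomorphism: \<open>\<theta> (\<theta> x) = x ^ 3\<close>.

  The Ree group is given in Tits' form, as a permutation group on \<open>q ^ 3 + 1\<close> points:
  \<open>\<infinity>\<close> (here \<open>None\<close>) and the triples over the field.  The triples form a group of order
  \<open>q ^ 3\<close> under \<open>ree_mult\<close>, the root group of \<open>\<infinity>\<close> acting by right translations; \<open>ree_omega\<close> is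
  an involution interchanging \<open>\<infinity>\<close> and \<open>(0, 0, 0)\<close>.  The root group and \<open>ree_omega\<close> generate the
  Ree group, which acts 2-transitively and has order \<open>q ^ 3 * (q ^ 3 + 1) * (q - 1)\<close>;
  the root groups are its Sylow 3-subgroups, so points may be read as Sylow 3-subgroups.
\<close>

type_synonym 'k ree_point = "('k \<times> 'k \<times> 'k) option"

definition \<theta> :: "nat \<Rightarrow> 'k::field \<Rightarrow> 'k" where
  "\<theta> n x = x ^ (3 ^ (n + 1))"

definition ree_mult :: "nat \<Rightarrow> 'k::field \<times> 'k \<times> 'k \<Rightarrow> 'k \<times> 'k \<times> 'k \<Rightarrow> 'k \<times> 'k \<times> 'k" where
  "ree_mult n = (\<lambda>(x, y, z) (a, b, c).
     (x + a, y + b + x * \<theta> n a, z + c + x * b - y * a - x * (\<theta> n a * a)))"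

definition ree_translation :: "nat \<Rightarrow> 'k::field \<times> 'k \<times> 'k \<Rightarrow> 'k ree_point \<Rightarrow> 'k ree_point" where
  "ree_translation n t = map_option (\<lambda>p. ree_mult n p t)"

definition ree_u :: "nat \<Rightarrow> 'k::field \<Rightarrow> 'k \<Rightarrow> 'k \<Rightarrow> 'k" where
  "ree_u n x y z = x ^ 2 * y - x * z + \<theta> n y - \<theta> n x * x ^ 3"

definition ree_v :: "nat \<Rightarrow> 'k::field \<Rightarrow> 'k \<Rightarrow> 'k \<Rightarrow> 'k" where
  "ree_v n x y z = \<theta> n x * \<theta> n y - \<theta> n z + x * y ^ 2 + y * z - (\<theta> n x) ^ 2 * x ^ 3"

text \<open>The norm of the Ree group; it vanishes only at \<open>(0, 0, 0)\<close>.\<close>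

definition ree_w :: "nat \<Rightarrow> 'k::field \<Rightarrow> 'k \<Rightarrow> 'k \<Rightarrow> 'k" where
  "ree_w n x y z =
     - (x * \<theta> n z) + \<theta> n x * x * \<theta> n y - \<theta> n x * x ^ 3 * y - x ^ 2 * y ^ 2
     + \<theta> n y * y + z ^ 2 - (\<theta> n x) ^ 2 * x ^ 4"

definition ree_omega :: "nat \<Rightarrow> 'k::field ree_point \<Rightarrow> 'k ree_point" where
  "ree_omega n p =
     (case p of
        None \<Rightarrow> Some (0, 0, 0)
      | Some (x, y, z) \<Rightarrow>
          if (x, y, z) = (0, 0, 0) then None
          else Some (- ree_v n x y z / ree_w n x y z,
                     - ree_u n x y z / ree_w n x y z,
                     - z / ree_w n x y z))"

definition ree_group :: "nat \<Rightarrow> ('k::field ree_point \<Rightarrow> 'k ree_point) set" where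
  "ree_group n = generate (BijGroup UNIV) (insert (ree_omega n) (range (ree_translation n)))"

text \<open>The blocks are the sets of fixed points of the involutions of the Ree group.\<close>

definition ree_unital :: "nat \<Rightarrow> ('k::field ree_point, 'k ree_point set) incidence_structure" where
  "ree_unital n =
     \<lparr>points = UNIV,
      lines = {{p. g p = p} | g. g \<in> ree_group n \<and> g \<noteq> id \<and> g \<circ> g = id},
      incident = (\<in>)\<rparr>"

text \<open>The field with three elements is the type \<open>Enum.finite_3\<close>.\<close>

abbreviation ree_unital_3 ::
  "(Enum.finite_3 ree_point, Enum.finite_3 ree_point set) incidence_structure" where
  "ree_unital_3 \<equiv> ree_unital 0"

end

theory Submission
  imports Defs
begin

text \<open>
  The Ree group acts linearly on the coordinates \<open>(1, x, y, z, u, v, w)\<close> of the Ree-Tits ovoid.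
  Hence \<open>R(3)\<close> is a subunital of \<open>R(q)\<close>, and so are its images under the Ree group.

  Let \<open>i\<close> be the involution \<open>(x, y, z) \<mapsto> (-x, y, -z)\<close>, and let \<open>\<omega>\<close> be the involution \<open>ree_omega\<close>
  of the Ree group; they generate a fours group inside a Sylow 2-subgroup \<open>E\<close> of order 8 of the
  Ree group over the field with three elements.  Applying Pappus' theorem to configurations inside
  \<open>R(3)\<close> shows that, for every embedding into a pappian plane, the lines of several blocks belonging
  to involutions in \<open>E\<close> pass through one point, the meet of the lines of \<open>i\<close> and \<open>\<omega>\<close>.  This meeting
  point does not change if the embedding is composed with an element of the normalizer of \<open>E\<close>
  in the small group or with an element of \<open>R(q)\<close> centralizing both \<open>i\<close> and \<open>\<omega>\<close>.  For \<open>q > 3\<close> these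
  elements generate a group which contains all translations \<open>(0, b, 0)\<close>, and it moves one block
  to a second block sharing a point with the first.  The two lines then meet only in the image
  of that point, which contradicts the fact that it lies on the line of \<open>i\<close> too.
\<close>

section \<open>Fields of order an odd power of three\<close>

text \<open>The Ree group acts on the unital, but nothing extends this action to the plane. The
  meeting point is therefore a function of the group element composed with the embedding, and the
  group preserving it is defined through all these embeddings at once. It is large because \<omega>
  lies in a subgroup PSL(2, q) centralizing i, as the matrix with rows (0, -1) and (1, 0), so the
  rotations with x^2 + y^2 = 1 commute with both involutions. Since q = 3 mod 4, -1 is not a square
  and every element is a square or minus a square; a count of squares then turns the rotations and
  one translation into all translations (0, b, 0). The contradiction needs a point (0, b, z) on two
  distinct blocks of the orbit of the block of \<omega>. One comes from PSL(2, q), the other from an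
  element permuting i, \<omega> and i \<omega> cyclically. The second exists if \<theta>(z) - b z =
  b + \<theta>(b), which is solvable for every nonsquare b, and coincidence of the two blocks makes
  1 - b^2 a square. For q = 3 the only nonsquare is b = -1, with 1 - b^2 = 0 a square; this is where
  q > 3 enters.\<close>

lemma finite_field_power_card:
  fixes x :: "'k::{field, finite}"
  shows "x ^ CARD('k) = x"
proof (cases "x = 0")
  case False
  let ?S = "UNIV - {0 :: 'k}"
  have bij: "bij_betw ((*) x) ?S ?S"
    by (rule bij_betw_byWitness[where f' = "\<lambda>y. y / x"]) (use False in auto)
  \<comment> \<open>Multiplication by \<open>x\<close> permutes the nonzero elements, so their
    product absorbs a factor \<open>x ^ card ?S\<close>.\<close>
  have "\<Prod>?S = (\<Prod>y\<in>?S. x * y)"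
    by (rule prod.reindex_bij_betw[OF bij, symmetric])
  also have "\<dots> = x ^ card ?S * \<Prod>?S"
    by (simp only: prod.distrib prod_constant)
  finally have "1 * \<Prod>?S = x ^ card ?S * \<Prod>?S" by (simp only: mult_1)
  moreover have "\<Prod>?S \<noteq> 0" by (simp add: prod_zero_iff)
  ultimately have "x ^ card ?S = 1" using mult_right_cancel by metis
  moreover have "CARD('k) = Suc (card ?S)"
    by (rule card.remove) simp_all
  ultimately show ?thesis by (simp only: power_Suc mult_1_right)
qed (simp add: zero_power)

text \<open>Adding 1 permutes the field, so the sum of all elements equals itself plus the number of
  elements.\<close>

lemma of_nat_card_eq_0: "of_nat CARD('k) = (0 :: 'k::{field, finite})"
proof -
  have bij: "bij_betw (\<lambda>y :: 'k. y + 1) UNIV UNIV"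
    by (rule bij_betw_byWitness[where f' = "\<lambda>y. y - 1"]) auto
  have "\<Sum>(UNIV :: 'k set) = (\<Sum>y\<in>UNIV. y + 1)"
    by (rule sum.reindex_bij_betw[OF bij, symmetric])
  also have "\<dots> = \<Sum>(UNIV :: 'k set) + of_nat CARD('k)"
    by (simp only: sum.distrib sum_constant mult_1_right)
  finally show ?thesis using add_cancel_left_right by metis
qed

lemma char3_numerals:
  assumes "(3 :: 'a::field) = 0"
  shows "(2 :: 'a) = -1" "(4 :: 'a) = 1" "(5 :: 'a) = -1" "(6 :: 'a) = 0" "(7 :: 'a) = 1"
    "(8 :: 'a) = -1" "(9 :: 'a) = 0" "(10 :: 'a) = 1" "(11 :: 'a) = -1" "(12 :: 'a) = 0"
    "(13 :: 'a) = 1" "(14 :: 'a) = -1" "(15 :: 'a) = 0"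
proof -
  have "(2 :: 'a) + 1 = 0" using assms by simp
  then show two: "(2 :: 'a) = -1" by (rule add_eq_0_iff2[THEN iffD1])
  have "(4 :: 'a) = 3 + 1" "(5 :: 'a) = 3 + 2" "(6 :: 'a) = 3 * 2" "(7 :: 'a) = 3 * 2 + 1"
    "(8 :: 'a) = 3 * 2 + 2" "(9 :: 'a) = 3 * 3" "(10 :: 'a) = 3 * 3 + 1" "(11 :: 'a) = 3 * 3 + 2"
    "(12 :: 'a) = 3 * 4" "(13 :: 'a) = 3 * 4 + 1" "(14 :: 'a) = 3 * 4 + 2" "(15 :: 'a) = 3 * 5"
    by simp_all
  then show "(4 :: 'a) = 1" "(5 :: 'a) = -1" "(6 :: 'a) = 0" "(7 :: 'a) = 1"
    "(8 :: 'a) = -1" "(9 :: 'a) = 0" "(10 :: 'a) = 1" "(11 :: 'a) = -1" "(12 :: 'a) = 0"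
    "(13 :: 'a) = 1" "(14 :: 'a) = -1" "(15 :: 'a) = 0"
    using assms two by simp_all
qed

lemma cube_add_char3:
  assumes "(3 :: 'a::field) = 0"
  shows "(x + y :: 'a) ^ 3 = x ^ 3 + y ^ 3"
  using assms by (simp add: power3_eq_cube algebra_simps char3_numerals[OF assms])

lemma power_3_power_add_char3:
  assumes "(3 :: 'a::field) = 0"
  shows "(x + y :: 'a) ^ (3 ^ k) = x ^ (3 ^ k) + y ^ (3 ^ k)"
proof (induction k arbitrary: x y)
  case (Suc k)
  have "(x + y) ^ (3 ^ Suc k) = ((x + y) ^ 3) ^ (3 ^ k)" by (simp only: power_mult power_Suc)
  also have "\<dots> = (x ^ 3) ^ (3 ^ k) + (y ^ 3) ^ (3 ^ k)"
    by (simp only: cube_add_char3[OF assms] Suc)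
  finally show ?case by (simp only: power_mult power_Suc)
qed simp

locale ree_field =
  fixes n :: nat and K :: "'k::{field, finite} itself"
  assumes card: "CARD('k) = 3 ^ (2 * n + 1)"
begin

abbreviation tw :: "'k \<Rightarrow> 'k" where "tw \<equiv> \<theta> n"

lemma three: "(3 :: 'k) = 0"
proof -
  have "of_nat (3 ^ (2 * n + 1)) = (0 :: 'k)"
    using of_nat_card_eq_0[where 'k = 'k] by (simp only: card)
  then have "(3 :: 'k) ^ (2 * n + 1) = 0" by (simp only: of_nat_power of_nat_numeral)
  then show ?thesis by (simp only: power_eq_0_iff)
qed

lemmas ch3 = char3_numerals[OF three]

lemma one_neq_minus_one: "(1 :: 'k) \<noteq> -1"
proof
  assume "(1 :: 'k) = -1"
  then have "(2 :: 'k) = 1" using ch3(1) by simp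
  then have "(1 :: 'k) + 1 = 1" by (simp only: one_add_one)
  then show False by (simp only: add_cancel_left_left one_neq_zero)
qed

lemma tw_add: "tw (x + y) = tw x + tw y"
  unfolding \<theta>_def by (rule power_3_power_add_char3[OF three])

lemma tw_mult: "tw (x * y) = tw x * tw y"
  unfolding \<theta>_def by (rule power_mult_distrib)

lemma tw_0 [simp]: "tw 0 = 0" and tw_1 [simp]: "tw 1 = 1"
  unfolding \<theta>_def by (simp_all add: power_0_left)

lemma tw_uminus: "tw (- x) = - tw x"
  using tw_add[of x "- x"] by (simp add: add_eq_0_iff)

lemma tw_diff: "tw (x - y) = tw x - tw y"
  using tw_add[of x "- y"] by (simp add: tw_uminus)

lemma tw_power: "tw (x ^ m) = tw x ^ m"
  unfolding \<theta>_def by (metis power_mult mult.commute)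

lemma tw_inverse: "tw (inverse x) = inverse (tw x)"
  unfolding \<theta>_def by (rule power_inverse)

lemma tw_divide: "tw (x / y) = tw x / tw y"
  by (simp add: divide_inverse tw_mult tw_inverse)

lemma tw_eq_0_iff [simp]: "tw x = 0 \<longleftrightarrow> x = 0"
  unfolding \<theta>_def by simp

text \<open>The total exponent is \<open>3 ^ (2 * n + 2)\<close>, that is 3 q, and
  \<open>x ^ q = x\<close>.\<close>

lemma tw_tw: "tw (tw x) = x ^ 3"
proof -
  have "tw (tw x) = x ^ (3 ^ (n + 1) * 3 ^ (n + 1))"
    unfolding \<theta>_def by (rule power_mult[symmetric])
  also have "3 ^ (n + 1) * 3 ^ (n + 1) = CARD('k) * (3::nat)"
    unfolding card by (simp only: power_add[symmetric] power_Suc2[symmetric]) (simp add: mult_2)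
  finally show ?thesis by (simp only: power_mult finite_field_power_card)
qed

lemmas tw_simps = tw_add tw_mult tw_uminus tw_diff tw_power tw_inverse tw_divide tw_tw

lemma card_mod_4: "CARD('k) mod 4 = 3"
proof -
  have "(3::nat) ^ (2 * n + 1) mod 4 = 3"
  proof (induction n)
    case (Suc m)
    have "(3::nat) ^ (2 * Suc m + 1) mod 4 = (3 ^ (2 * m + 1) mod 4) * 9 mod 4"
      by (simp add: power_add mod_simps)
    then show ?case by (simp only: Suc) simp
  qed simp
  then show ?thesis by (simp add: card)
qed

text \<open>A square root of -1 satisfies \<open>x ^ 4 = 1\<close>; as q = 3 mod 4 this gives
  \<open>x = x ^ q = x ^ 3 = - x\<close>.\<close>

lemma square_neq_minus_one: "(x :: 'k) ^ 2 \<noteq> -1"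
proof
  assume x: "x ^ 2 = -1"
  obtain m where m: "CARD('k) = 4 * m + 3"
    using card_mod_4 by (metis mod_mult_div_eq add.commute)
  have "x ^ 4 = (x ^ 2) ^ 2" by (simp flip: power_mult)
  then have "x ^ 4 = 1" using x by simp
  have "x = x ^ (4 * m + 3)" using finite_field_power_card[of x] m by simp
  also have "\<dots> = x ^ 3" using \<open>x ^ 4 = 1\<close> by (simp add: power_add power_mult)
  also have "\<dots> = x ^ 2 * x" by (simp add: power2_eq_square power3_eq_cube)
  also have "\<dots> = - x" using x by simp
  finally have "x = - x" .
  then have "x * (1 - (-1)) = 0" by (simp add: algebra_simps)
  moreover have "x \<noteq> 0" using x by auto
  ultimately show False using one_neq_minus_one by simp
qed

lemma sum_squares_eq_0_iff: "(x :: 'k) ^ 2 + y ^ 2 = 0 \<longleftrightarrow> x = 0 \<and> y = 0"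
proof
  assume eq: "x ^ 2 + y ^ 2 = 0"
  have "y = 0"
  proof (rule ccontr)
    assume y: "y \<noteq> 0"
    from eq have "x ^ 2 = - (y ^ 2)" by (rule eq_neg_iff_add_eq_0[THEN iffD2])
    with y have "(x / y) ^ 2 = -1" by (simp only: power_divide) (simp add: divide_eq_minus_1_iff)
    then show False using square_neq_minus_one by blast
  qed
  with eq show "x = 0 \<and> y = 0" by simp
qed simp

lemma square_or_minus_square:
  fixes x :: 'k
  obtains s where "x = s ^ 2 \<or> x = - (s ^ 2)"
proof -
  obtain m where m: "CARD('k) = 4 * m + 3"
    using card_mod_4 by (metis mod_mult_div_eq add.commute)
  \<comment> \<open>Since \<open>4 * (m + 1) = q + 1\<close>, the fourth power of \<open>s\<close>
    is \<open>x ^ (q + 1) = x ^ 2\<close>.\<close>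
  define s where "s = x ^ (m + 1)"
  have "s ^ 4 = x ^ (CARD('k) + 1)"
  proof -
    have "(m + 1) * 4 = 4 * m + 3 + 1" by simp
    then show ?thesis unfolding s_def m by (metis power_mult)
  qed
  also have "\<dots> = x ^ CARD('k) * x" by simp
  finally have "s ^ 4 = x ^ 2" by (simp only: finite_field_power_card power2_eq_square)
  then have "(s ^ 2 - x) * (s ^ 2 + x) = 0" by algebra
  then have "x = s ^ 2 \<or> x = - (s ^ 2)"
    by (auto simp: add_eq_0_iff2)
  then show ?thesis by (rule that)
qed

text \<open>Applying \<theta> twice shows \<open>x ^ 3 = x\<close>, so \<open>x\<close> lies in the
  prime field, where \<theta> is the identity.\<close>

lemma tw_eq_minus_self: "tw x = - x \<Longrightarrow> x = 0"
proof -
  assume h: "tw x = - x"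
  then have "x ^ 3 = x" using tw_tw[of x] by (simp add: tw_uminus)
  have "tw x = x ^ 3 ^ (n + 1)" by (simp add: \<theta>_def)
  also have "x ^ 3 ^ m = x" for m
  proof (induction m)
    case (Suc m)
    then show ?case using \<open>x ^ 3 = x\<close> by (simp only: power_Suc power_mult)
  qed simp
  finally have "x * (1 - (-1)) = 0" using h by (simp add: algebra_simps)
  then show "x = 0" using one_neq_minus_one by simp
qed

text \<open>The quotient of \<open>tw x\<close> by \<open>x\<close> is a square because the exponent
  of \<theta> is odd. Hence \<open>tw z = b * z\<close> has only the zero solution when
  \<open>b\<close> is not a square.\<close>

lemma tw_eq_self_times_square:
  obtains s where "tw x = x * s ^ 2"
proof -
  have "odd ((3::nat) ^ (n + 1))" by simp
  then obtain m where "(3::nat) ^ (n + 1) = 2 * m + 1" by (rule oddE)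
  then have "tw x = x * (x ^ m) ^ 2"
    by (simp add: \<theta>_def mult.commute flip: power_mult)
  then show ?thesis by (rule that)
qed

end

section \<open>The seven-dimensional representation of the Ree group\<close>

type_synonym 'k vec7 = "'k \<times> 'k \<times> 'k \<times> 'k \<times> 'k \<times> 'k \<times> 'k"

fun ree_vec :: "nat \<Rightarrow> 'k::field ree_point \<Rightarrow> 'k vec7" where
  "ree_vec n None = (0, 0, 0, 0, 0, 0, 1)"
| "ree_vec n (Some (x, y, z)) = (1, x, y, z, ree_u n x y z, ree_v n x y z, ree_w n x y z)"

fun scale7 :: "'k::field \<Rightarrow> 'k vec7 \<Rightarrow> 'k vec7" where
  "scale7 c (f, x, y, z, u, v, w) = (c * f, c * x, c * y, c * z, c * u, c * v, c * w)"

definition linear7 :: "('k::field vec7 \<Rightarrow> 'k vec7) \<Rightarrow> bool" where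
  "linear7 L \<longleftrightarrow> (\<forall>p q. L (p + q) = L p + L q) \<and> (\<forall>c p. L (scale7 c p) = scale7 c (L p))"

text \<open>The scalar may vary with the point: \<open>L\<close> induces \<open>g\<close> on the
  projective points of the Ree-Tits ovoid.\<close>

definition represents :: "nat \<Rightarrow> ('k::field vec7 \<Rightarrow> 'k vec7) \<Rightarrow> ('k ree_point \<Rightarrow> 'k ree_point) \<Rightarrow> bool"
where
  "represents n L g \<longleftrightarrow>
     linear7 L \<and> (\<forall>p. \<exists>c. c \<noteq> 0 \<and> L (ree_vec n p) = scale7 c (ree_vec n (g p)))"

lemma scale7_scale7: "scale7 a (scale7 b p) = scale7 (a * b) p"
  by (cases p) (simp add: mult.assoc)

lemma scale7_1 [simp]: "scale7 1 p = p"
  by (cases p) simp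

lemma scale7_add: "scale7 a (p + q) = scale7 a p + scale7 a q"
  by (cases p; cases q) (simp add: algebra_simps)

lemma linear7_add: "linear7 L \<Longrightarrow> L (p + q) = L p + L q"
  and linear7_scale7: "linear7 L \<Longrightarrow> L (scale7 c p) = scale7 c (L p)"
  unfolding linear7_def by blast+

text \<open>The first coordinate is 1 on the triples and 0 at infinity, where the last one is 1, so
  distinct points have non-proportional vectors. This is what makes a linear map determine the
  permutation it represents.\<close>

lemma ree_vec_eqD:
  assumes "scale7 c (ree_vec n p) = ree_vec n q"
  shows "p = q"
proof (cases p)
  case None
  with assms show ?thesis by (cases q) auto
next
  case (Some a)
  with assms show ?thesis by (cases q; cases a) auto
qed

lemma representsI:
  assumes "linear7 L" "\<And>p. \<exists>c. c \<noteq> 0 \<and> L (ree_vec n p) = scale7 c (ree_vec n (g p))"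
  shows "represents n L g"
  using assms by (simp add: represents_def)

lemma represents_comp:
  assumes "represents n L g" "represents n M h"
  shows "represents n (L \<circ> M) (g \<circ> h)"
proof (rule representsI)
  show "linear7 (L \<circ> M)"
    using assms unfolding represents_def linear7_def comp_def by metis
next
  fix p
  from assms(2) obtain c where c: "c \<noteq> 0" "M (ree_vec n p) = scale7 c (ree_vec n (h p))"
    unfolding represents_def by blast
  from assms(1) obtain d where d: "d \<noteq> 0" "L (ree_vec n (h p)) = scale7 d (ree_vec n (g (h p)))"
    unfolding represents_def by blast
  have "linear7 L" using assms(1) by (simp add: represents_def)
  then have "(L \<circ> M) (ree_vec n p) = scale7 (c * d) (ree_vec n ((g \<circ> h) p))"
    by (simp add: c(2) d(2) linear7_scale7 scale7_scale7)
  with c(1) d(1) show "\<exists>e. e \<noteq> 0 \<and> (L \<circ> M) (ree_vec n p) = scale7 e (ree_vec n ((g \<circ> h) p))"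
    by (metis mult_eq_0_iff)
qed

lemma represents_eqI:
  assumes "L (ree_vec n p) = scale7 c (ree_vec n q)" "represents n L g"
  shows "g p = q"
proof -
  from assms(2) obtain d where d: "d \<noteq> 0" "L (ree_vec n p) = scale7 d (ree_vec n (g p))"
    unfolding represents_def by blast
  then have "scale7 (inverse d) (scale7 c (ree_vec n q)) = scale7 (inverse d) (scale7 d (ree_vec n (g p)))"
    using assms(1) by simp
  then have "scale7 (inverse d * c) (ree_vec n q) = ree_vec n (g p)"
    using d(1) by (simp add: scale7_scale7)
  then show ?thesis using ree_vec_eqD by metis
qed

lemma represents_unique:
  assumes "represents n L g" "represents n L h"
  shows "g = h"
proof
  fix p
  from assms(2) obtain d where "L (ree_vec n p) = scale7 d (ree_vec n (h p))"
    unfolding represents_def by blast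
  then show "g p = h p" using assms(1) by (rule represents_eqI)
qed

lemma represents_id: "represents n id id"
  by (rule representsI) (auto simp: linear7_def intro: exI[of _ 1])

fun omega_lin :: "'k::field vec7 \<Rightarrow> 'k vec7" where
  "omega_lin (f, x, y, z, u, v, w) = (w, - v, - u, - z, - y, - x, f)"

lemma linear7_omega_lin: "linear7 omega_lin"
  unfolding linear7_def by auto

text \<open>The unitriangular matrix obtained by expanding \<open>u\<close>, \<open>v\<close> and
  \<open>w\<close> at the product of \<open>(x, y, z)\<close> and \<open>(a, b, c)\<close> and
  collecting the result in terms of the seven coordinates.\<close>

fun translation_lin :: "nat \<Rightarrow> 'k::field \<times> 'k \<times> 'k \<Rightarrow> 'k vec7 \<Rightarrow> 'k vec7" where
  "translation_lin n (a, b, c) (f, x, y, z, u, v, w) =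
     (let A = \<theta> n a; B = \<theta> n b; C = \<theta> n c in
     (f,
      x + a * f,
      y + A * x + b * f,
      z - a * y + (b - A * a) * x + c * f,
      u - a * z - a ^ 2 * y + (a * b - c - a ^ 2 * A) * x + (B - a * c + a ^ 2 * b - a ^ 3 * A) * f,
      v - A * u + b * z + (c + a * b) * y + (c * A - b ^ 2 + a * b * A) * x
        + (A * B - C + b * c + a * b ^ 2 - a ^ 3 * A ^ 2) * f,
      w + a * v + (b - a * A) * u - c * z + (B + a * c + a ^ 2 * b - a ^ 3 * A) * y
        + (a * c * A - C - A * B - b * c + a * b ^ 2 + a ^ 2 * b * A + a ^ 3 * A ^ 2) * x
        + (c ^ 2 + b * B - a * C + a * A * B - a ^ 2 * b ^ 2 - a ^ 3 * b * A - a ^ 4 * A ^ 2) * f))"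

lemma linear7_translation_lin: "linear7 (translation_lin n t)"
  unfolding linear7_def by (cases t) (auto simp: Let_def algebra_simps)

text \<open>Here capital letters stand for the images of the small ones under the Tits endomorphism.
  The identities hold because \<open>u\<close>, \<open>v\<close> and \<open>w\<close> are coordinates of the Ree-Tits ovoid; taking
  \<open>u\<close> and \<open>v\<close> as variables in place of \<open>Y\<close> and \<open>Z\<close> keeps the expansions small.\<close>

lemma ree_polynomial_identities:
  fixes x y z u v w X Y Z U V W :: "'a::field"
  assumes three: "(3::'a) = 0"
    and u: "u = x ^ 2 * y - x * z + Y - X * x ^ 3"
    and v: "v = X * Y - Z + x * y ^ 2 + y * z - X ^ 2 * x ^ 3"
    and w: "w = x * v + y * u + z ^ 2"
    and U: "U = X ^ 2 * Y - X * Z + y ^ 3 - x ^ 3 * X ^ 3"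
    and V: "V = x ^ 3 * y ^ 3 - z ^ 3 + X * Y ^ 2 + Y * Z - (x ^ 3) ^ 2 * X ^ 3"
    and W: "W = X * V + Y * U + Z ^ 2"
  shows "w ^ 3 * U + v ^ 3 * V + u * v ^ 2 * W - y * w ^ 2 * W + z * v * w * W = 0" (is ?A)
    and "w ^ 3 * Z - u * v ^ 2 * V + y * w ^ 2 * V - z * v * w * V + x * w ^ 2 * W
           - u ^ 2 * v * W + z * u * w * W = 0" (is ?B)
    and "z * u * w - x * w ^ 2 - u * v * Y - x * y * w * Y + u ^ 2 * Z - x ^ 2 * w * Z
           + u * V - x * z * V = 0" (is ?C)
proof -
  note expand = algebra_simps power2_eq_square power3_eq_cube char3_numerals[OF three]
  have Y: "Y = u - x ^ 2 * y + x * z + X * x ^ 3"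
    unfolding u by simp
  have Z: "Z = X * (u - x ^ 2 * y + x * z + X * x ^ 3) + x * y ^ 2 + y * z - X ^ 2 * x ^ 3 - v"
    unfolding v Y[symmetric] by simp
  have U': "U = y ^ 3 - x * y ^ 2 * X + v * X - y * z * X"
    unfolding U v using three by (simp add: expand)
  have V': "V = - (z ^ 3 + x * y ^ 2 * Y - v * Y + y * z * Y - x ^ 2 * y * Z + u * Z + x * z * Z - x ^ 3 * U)"
    unfolding V U v u using three by (simp add: expand)
  show ?A ?B ?C
    unfolding W V' U' w Z Y using three by (simp_all add: expand)
qed

lemmas finite_3_arith = plus_finite_3_def uminus_finite_3_def minus_finite_3_def
  times_finite_3_def inverse_finite_3_def divide_finite_3_def

context ree_field
begin

text \<open>In homogeneous form this says that the ovoid lies on the quadric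
  \<open>f * w = x * v + y * u + z ^ 2\<close>. It replaces the long definition of the norm in all
  later computations.\<close>

lemma ree_w_eq: "ree_w n x y z = x * ree_v n x y z + y * ree_u n x y z + z ^ 2" for x :: 'k
  unfolding ree_w_def ree_v_def ree_u_def using three
  by (simp add: algebra_simps power2_eq_square power3_eq_cube power4_eq_xxxx ch3)

lemma tw_ree_u: "tw (ree_u n x y z) = tw x ^ 2 * tw y - tw x * tw z + y ^ 3 - x ^ 3 * tw x ^ 3"
  and tw_ree_v: "tw (ree_v n x y z) =
    x ^ 3 * y ^ 3 - z ^ 3 + tw x * tw y ^ 2 + tw y * tw z - (x ^ 3) ^ 2 * tw x ^ 3"
  and tw_ree_w: "tw (ree_w n x y z) =
    tw x * tw (ree_v n x y z) + tw y * tw (ree_u n x y z) + tw z ^ 2"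
  by (simp_all add: ree_w_eq) (simp_all add: ree_u_def ree_v_def tw_simps)

lemmas ree_identities =
  ree_polynomial_identities[OF three ree_u_def ree_v_def ree_w_eq tw_ree_u tw_ree_v tw_ree_w]

text \<open>If the norm vanishes, the first polynomial identity reduces to
  \<open>v ^ 3 * tw v = 0\<close>, and the third then to \<open>u ^ 2 * tw z = 0\<close>. With the
  quadric equation this gives \<open>z = 0\<close>, and the definitions of \<open>u\<close> and
  \<open>v\<close> leave only the zero triple.\<close>

lemma ree_w_eq_0_iff: "ree_w n x y z = 0 \<longleftrightarrow> x = 0 \<and> y = 0 \<and> z = (0 :: 'k)"
proof
  define u v w where "u = ree_u n x y z" and "v = ree_v n x y z" and "w = ree_w n x y z"
  assume "ree_w n x y z = 0"
  then have w: "w = 0" "tw w = 0" by (simp_all add: w_def)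
  note ids = ree_identities[where x = x and y = y and z = z, folded u_def v_def w_def, unfolded w]
  have v: "v = 0" using ids(1) by auto
  have "u = 0 \<or> z = 0" using ids(3) v by auto
  moreover have yu: "y * u + z ^ 2 = 0"
    using ree_w_eq[of x y z] w v by (simp add: u_def v_def w_def)
  ultimately have z: "z = 0" by auto
  have u: "u = x ^ 2 * y + tw y - tw x * x ^ 3" and v': "tw x * tw y + x * y ^ 2 - tw x ^ 2 * x ^ 3 = 0"
    using v by (simp_all add: u_def v_def ree_u_def ree_v_def z)
  have tv: "tw x * x ^ 3 * 0 = x ^ 3 * y ^ 3 + tw x * tw y ^ 2 - (x ^ 3) ^ 2 * tw x ^ 3"
    using tw_ree_v[of x y z] v by (simp add: v_def z)
  have "y = 0"
  proof (rule ccontr)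
    assume "y \<noteq> 0"
    then have "u = 0" using yu z by simp
    then have Y: "tw y = tw x * x ^ 3 - x ^ 2 * y" using u by (simp add: algebra_simps)
    have "x * y * (y - tw x * x) = 0"
      using v' unfolding Y by (simp add: algebra_simps power2_eq_square power3_eq_cube)
    moreover have "x \<noteq> 0" using Y \<open>y \<noteq> 0\<close> by auto
    ultimately have "y = tw x * x" using \<open>y \<noteq> 0\<close> by simp
    with Y have "tw y = 0" by (simp add: power2_eq_square power3_eq_cube)
    with \<open>y \<noteq> 0\<close> show False by simp
  qed
  with v' z show "x = 0 \<and> y = 0 \<and> z = 0" by auto
qed (auto simp: ree_w_def)

text \<open>After clearing denominators, the equations for \<open>u\<close> and \<open>v\<close>
  become the first two polynomial identities, and the one for \<open>w\<close> follows from the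
  quadric. Together they say that \<omega> acts by reversing the seven coordinates up to
  signs.\<close>

lemma ree_omega_coordinates:
  fixes x y z :: 'k
  assumes w: "ree_w n x y z \<noteq> 0"
  defines "x' \<equiv> - ree_v n x y z / ree_w n x y z"
    and "y' \<equiv> - ree_u n x y z / ree_w n x y z"
    and "z' \<equiv> - z / ree_w n x y z"
  shows "ree_u n x' y' z' = - y / ree_w n x y z"
    and "ree_v n x' y' z' = - x / ree_w n x y z"
    and "ree_w n x' y' z' = 1 / ree_w n x y z"
proof -
  define u v w where "u = ree_u n x y z" and "v = ree_v n x y z" and "w = ree_w n x y z"
  define U V W where "U = tw u" and "V = tw v" and "W = tw w"
  note ids = ree_identities[where x = x and y = y and z = z, folded u_def v_def w_def, folded U_def V_def W_def]
  have nz: "w \<noteq> 0" "W \<noteq> 0" using assms(1) by (simp_all add: w_def W_def)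
  have eqs: "x' = - v / w" "y' = - u / w" "z' = - z / w"
    by (simp_all add: x'_def y'_def z'_def u_def v_def w_def)
  have teqs: "tw x' = - V / W" "tw y' = - U / W" "tw z' = - tw z / W"
    by (simp_all add: eqs tw_simps U_def V_def W_def)
  have "ree_u n x' y' z' + y / w =
      - (w ^ 3 * U + v ^ 3 * V + u * v ^ 2 * W - y * w ^ 2 * W + z * v * w * W) / (w ^ 3 * W)"
    unfolding ree_u_def teqs unfolding eqs using nz
    by (simp add: field_simps power2_eq_square power3_eq_cube)
  then show u': "ree_u n x' y' z' = - y / ree_w n x y z"
    unfolding ids(1) by (simp add: w_def add_eq_0_iff2)
  have "ree_v n x' y' z' + x / w =
      ((w ^ 3 * Z - u * v ^ 2 * V + y * w ^ 2 * V - z * v * w * V + x * w ^ 2 * W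
           - u ^ 2 * v * W + z * u * w * W) * W
       + (w ^ 3 * U + v ^ 3 * V + u * v ^ 2 * W - y * w ^ 2 * W + z * v * w * W) * V) / (w ^ 3 * W ^ 2)"
    if "Z = tw z" for Z
    unfolding ree_v_def teqs that[symmetric] unfolding eqs using nz
    by (simp add: field_simps power2_eq_square power3_eq_cube)
  from this[OF refl] show v': "ree_v n x' y' z' = - x / ree_w n x y z"
    unfolding ids(1,2) by (simp add: w_def add_eq_0_iff2)
  have "ree_w n x' y' z' = (x * v + y * u + z ^ 2) / w ^ 2"
    unfolding ree_w_eq[of x'] u' v' unfolding eqs w_def[symmetric]
    by (simp add: divide_simps power2_eq_square algebra_simps)
  also have "x * v + y * u + z ^ 2 = w"
    by (simp add: ree_w_eq u_def v_def w_def)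
  finally show "ree_w n x' y' z' = 1 / ree_w n x y z"
    using nz by (simp add: power2_eq_square w_def)
qed

lemma represents_omega: "represents n omega_lin (ree_omega n :: 'k ree_point \<Rightarrow> _)"
proof (rule representsI[OF linear7_omega_lin])
  fix p :: "'k ree_point"
  show "\<exists>c. c \<noteq> 0 \<and> omega_lin (ree_vec n p) = scale7 c (ree_vec n (ree_omega n p))"
  proof (cases p)
    case None
    then show ?thesis
      by (intro exI[of _ 1]) (simp add: ree_omega_def ree_u_def ree_v_def ree_w_def)
  next
    case (Some a)
    obtain x y z where a: "a = (x, y, z)" by (cases a)
    show ?thesis
    proof (cases "(x, y, z) = (0, 0, 0)")
      case True
      then show ?thesis
        by (intro exI[of _ 1]) (simp add: Some a ree_omega_def ree_u_def ree_v_def ree_w_def)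
    next
      case False
      then have w: "ree_w n x y z \<noteq> 0" by (auto simp: ree_w_eq_0_iff)
      have "ree_omega n (Some (x, y, z)) =
        Some (- ree_v n x y z / ree_w n x y z, - ree_u n x y z / ree_w n x y z, - z / ree_w n x y z)"
        using False by (auto simp: ree_omega_def)
      then show ?thesis
        using w ree_omega_coordinates[OF w]
        by (intro exI[of _ "ree_w n x y z"]) (simp add: Some a)
    qed
  qed
qed

lemma represents_translation: "represents n (translation_lin n t) (ree_translation n t)"
  for t :: "'k \<times> 'k \<times> 'k"
proof (rule representsI[OF linear7_translation_lin])
  fix p :: "'k ree_point"
  obtain a b c where t: "t = (a, b, c)" by (cases t)
  show "\<exists>d. d \<noteq> 0 \<and> translation_lin n t (ree_vec n p) = scale7 d (ree_vec n (ree_translation n t p))"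
  proof (cases p)
    case None
    then show ?thesis
      by (intro exI[of _ 1]) (simp add: t ree_translation_def Let_def)
  next
    case (Some q)
    obtain x y z where q: "q = (x, y, z)" by (cases q)
    note expand = algebra_simps power2_eq_square power3_eq_cube power4_eq_xxxx ch3
    show ?thesis
      unfolding Some q t using three
      by (intro exI[of _ 1])
        (simp add: ree_translation_def ree_mult_def Let_def tw_simps ree_w_eq,
         simp add: ree_u_def ree_v_def tw_simps expand)
  qed
qed

text \<open>The seven-dimensional module restricted to SL(2, q): on the coordinates
  \<open>w\<close>, \<open>y\<close>, \<open>u\<close>, \<open>f\<close> it is the tensor product of
  the natural module with its twist by \<theta>, on \<open>x\<close>, \<open>z\<close>,
  \<open>v\<close> a symmetric square. The two summands are the eigenspaces of the sign change
  representing i, so the group centralizes i.\<close>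

fun sl2_lin :: "'k \<times> 'k \<times> 'k \<times> 'k \<Rightarrow> 'k vec7 \<Rightarrow> 'k vec7" where
  "sl2_lin (a, b, c, d) (f, x, y, z, u, v, w) =
     (c * tw c * w + c * tw d * y + d * tw c * u + d * tw d * f,
      d ^ 2 * x - c * d * z - c ^ 2 * v,
      a * tw c * w + a * tw d * y + b * tw c * u + b * tw d * f,
      b * d * x + (a * d + b * c) * z - a * c * v,
      c * tw a * w + c * tw b * y + d * tw a * u + d * tw b * f,
      - (b ^ 2) * x + a * b * z + a ^ 2 * v,
      a * tw a * w + a * tw b * y + b * tw a * u + b * tw b * f)"

lemma sl2_lin_comp:
  "sl2_lin (a, b, c, d) \<circ> sl2_lin (a', b', c', d') =
   sl2_lin (a * a' + b * c', a * b' + b * d', c * a' + d * c', c * b' + d * d')"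
proof
  fix p :: "'k vec7"
  show "(sl2_lin (a, b, c, d) \<circ> sl2_lin (a', b', c', d')) p =
    sl2_lin (a * a' + b * c', a * b' + b * d', c * a' + d * c', c * b' + d * d') p"
    using three
    by (cases p) (simp add: tw_simps algebra_simps power2_eq_square ch3)
qed

lemma sl2_lin_uminus: "sl2_lin (- a, - b, - c, - d) = sl2_lin (a, b, c, d)"
  by (rule ext) (auto simp: tw_uminus)

lemma sl2_lin_translation: "sl2_lin (1, b, 0, 1) = translation_lin n (0, b, 0)"
  by (rule ext) (auto simp: Let_def algebra_simps)

lemma sl2_lin_omega: "sl2_lin (0, -1, 1, 0) = omega_lin"
  by (rule ext) (auto simp: tw_uminus)

section \<open>The Ree group as a group of permutations\<close>

lemma omega_omega: "ree_omega n \<circ> ree_omega n = (id :: 'k ree_point \<Rightarrow> _)"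
proof (rule represents_unique[OF represents_comp[OF represents_omega represents_omega]])
  have "omega_lin \<circ> omega_lin = (id :: 'k vec7 \<Rightarrow> _)" by (rule ext) auto
  then show "represents n (omega_lin \<circ> omega_lin) (id :: 'k ree_point \<Rightarrow> _)"
    by (simp add: represents_id)
qed

fun ree_inverse :: "'k \<times> 'k \<times> 'k \<Rightarrow> 'k \<times> 'k \<times> 'k" where
  "ree_inverse (a, b, c) = (- a, a * tw a - b, - c)"

lemma ree_mult_inverse: "ree_mult n (ree_mult n p t) (ree_inverse t) = p"
  "ree_mult n (ree_mult n p (ree_inverse t)) t = p"
  by (cases p; cases t; simp add: ree_mult_def tw_simps algebra_simps)+

lemma translation_inverse:
  "ree_translation n (ree_inverse t) \<circ> ree_translation n t = id"
  "ree_translation n t \<circ> ree_translation n (ree_inverse t) = id"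
  unfolding ree_translation_def
  by (auto simp: fun_eq_iff option.map_comp comp_def ree_mult_inverse option.map_ident)

lemma bij_omega: "bij (ree_omega n :: 'k ree_point \<Rightarrow> _)"
  using omega_omega by (rule o_bij) (rule omega_omega)

lemma bij_translation: "bij (ree_translation n t)" for t :: "'k \<times> 'k \<times> 'k"
  by (rule o_bij) (rule translation_inverse)+

lemma Bij_UNIV: "Bij UNIV = {g. bij g}"
  by (auto simp: Bij_def extensional_def)

lemma BijGroup_mult: "bij g \<Longrightarrow> bij h \<Longrightarrow> g \<otimes>\<^bsub>BijGroup UNIV\<^esub> h = g \<circ> h"
  by (simp add: BijGroup_def Bij_UNIV compose_def comp_def restrict_def)

lemma BijGroup_inv:
  assumes "g \<circ> h = id" "h \<circ> g = id"
  shows "inv\<^bsub>BijGroup UNIV\<^esub> g = h"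
proof -
  interpret group "BijGroup UNIV" by (rule group_BijGroup)
  have "bij g" "bij h" using assms o_bij by metis+
  then show ?thesis
    using assms BijGroup_mult[of h g] by (intro inv_equality) (auto simp: BijGroup_def Bij_UNIV restrict_def id_def)
qed

abbreviation G :: "('k ree_point \<Rightarrow> 'k ree_point) set" where "G \<equiv> ree_group n"

lemma G_bij: "g \<in> G \<Longrightarrow> bij g"
proof -
  assume "g \<in> G"
  moreover have "G \<subseteq> carrier (BijGroup UNIV)"
    unfolding ree_group_def
    by (rule group.generate_incl[OF group_BijGroup])
      (auto simp: BijGroup_def Bij_UNIV bij_omega bij_translation)
  ultimately show "bij g" by (auto simp: BijGroup_def Bij_UNIV)
qed

lemma G_omega: "ree_omega n \<in> G" and G_translation: "ree_translation n t \<in> G"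
  unfolding ree_group_def by (auto intro: generate.incl)

lemma G_id: "id \<in> G"
proof -
  have "\<one>\<^bsub>BijGroup (UNIV :: 'k ree_point set)\<^esub> \<in> G"
    unfolding ree_group_def by (rule generate.one)
  then show ?thesis by (simp add: BijGroup_def restrict_def id_def)
qed

lemma G_comp: "g \<in> G \<Longrightarrow> h \<in> G \<Longrightarrow> g \<circ> h \<in> G"
  using generate.eng[of g "BijGroup UNIV" _ h] BijGroup_mult[OF G_bij G_bij]
  unfolding ree_group_def by metis

lemma G_induct [consumes 1, case_names id omega translation comp]:
  assumes "g \<in> G"
    and id: "P id"
    and omega: "P (ree_omega n)"
    and translation: "\<And>t. P (ree_translation n t)"
    and comp: "\<And>g h. g \<in> G \<Longrightarrow> h \<in> G \<Longrightarrow> P g \<Longrightarrow> P h \<Longrightarrow> P (g \<circ> h)"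
  shows "P g"
  using assms(1) unfolding ree_group_def
proof (induction g rule: generate.induct)
  case one
  then show ?case using id by (simp add: BijGroup_def restrict_def id_def)
next
  case (incl h)
  then show ?case using omega translation by auto
next
  case (inv h)
  then consider "h = ree_omega n" | t where "h = ree_translation n t" by blast
  then show ?case
  proof cases
    case 1
    then show ?thesis using omega by (simp add: BijGroup_inv[OF omega_omega omega_omega])
  next
    case 2
    then show ?thesis
      using translation BijGroup_inv[OF translation_inverse(2,1)] by simp
  qed
next
  case (eng g h)
  then show ?case
    using comp[of g h] BijGroup_mult[OF G_bij G_bij] unfolding ree_group_def by metis
qed

lemma G_inverse:
  assumes "g \<in> G"
  obtains h where "h \<in> G" "g \<circ> h = id" "h \<circ> g = id"
proof -
  from assms have "\<exists>h\<in>G. g \<circ> h = id \<and> h \<circ> g = id"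
  proof (induction rule: G_induct)
    case id
    show ?case by (rule bexI[OF _ G_id]) simp
  next
    case omega
    show ?case using G_omega omega_omega by blast
  next
    case (translation t)
    show ?case using G_translation translation_inverse by blast
  next
    case (comp g h)
    then obtain g' h' where "g' \<in> G" "h' \<in> G" "g \<circ> g' = id" "g' \<circ> g = id" "h \<circ> h' = id" "h' \<circ> h = id"
      by blast
    then show ?case using G_comp[of h' g']
      by (intro bexI[of _ "h' \<circ> g'"]) (simp_all add: fun_eq_iff)
  qed
  then show ?thesis using that by blast
qed

lemma G_represented:
  assumes "g \<in> G"
  obtains L where "represents n L g"
proof -
  from assms have "\<exists>L. represents n L g"
  proof (induction rule: G_induct)
    case (comp g h)
    then show ?case using represents_comp by blast
  qed (rule exI, rule represents_id represents_omega represents_translation)+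
  then show ?thesis using that by blast
qed

text \<open>Only the translations \<open>(0, b, 0)\<close> and \<omega> are needed: they correspond
  to the upper unitriangular matrices and to the Weyl element, which generate SL(2, q).\<close>

lemma sl2_in_G:
  assumes "a * d - b * c = 1"
  obtains g where "g \<in> G" "represents n (sl2_lin (a, b, c, d)) g"
proof -
  define S where "S M \<longleftrightarrow> (\<exists>g\<in>G. represents n (sl2_lin M) g)" for M
  have comp: "S (a * a' + b * c', a * b' + b * d', c * a' + d * c', c * b' + d * d')"
    if "S (a, b, c, d)" "S (a', b', c', d')" for a b c d a' b' c' d'
    using that represents_comp G_comp unfolding S_def sl2_lin_comp[symmetric] by blast
  have trans: "S (1, t, 0, 1)" for t
    using G_translation represents_translation unfolding S_def sl2_lin_translation by blast
  have omega: "S (0, -1, 1, 0)"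
    using G_omega represents_omega unfolding S_def sl2_lin_omega by blast
  have neg: "S (- a, - b, - c, - d) \<longleftrightarrow> S (a, b, c, d)" for a b c d
    by (simp add: S_def sl2_lin_uminus)
  \<comment> \<open>A matrix with \<open>c \<noteq> 0\<close> is a lower unitriangular matrix
    between two upper ones. The lower one is a conjugate of an upper one by \<omega>, up to a sign
    that acts trivially.\<close>
  have big: "S (a, b, c, d)" if det: "a * d - b * c = 1" and c: "c \<noteq> 0" for a b c d
  proof -
    have "S (-1, 0, - c, -1)"
      using comp[OF comp[OF omega trans[of "- c"]] omega] by simp
    then have "S (1, 0, c, 1)" using neg[of 1 0 c 1] by simp
    from comp[OF comp[OF trans[of "(a - 1) / c"] this] trans[of "(d - 1) / c"]]
    have "S (a, (a * (d - 1) + a - 1) / c, c, d)"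
      using c by (simp add: diff_divide_distrib add_divide_distrib algebra_simps)
    moreover have "(a * (d - 1) + a - 1) / c = b"
      using c det by (simp add: field_simps)
    ultimately show ?thesis by simp
  qed
  have "S (a, b, c, d)"
  proof (cases "c = 0")
    case False
    then show ?thesis using big assms by blast
  next
    case True
    then have "a \<noteq> 0" using assms by auto
    then have "S (c, d, - a, - b)" using assms by (intro big) (simp_all add: algebra_simps)
    from comp[OF omega this] show ?thesis by simp
  qed
  then show ?thesis using that unfolding S_def by blast
qed

section \<open>The points of R(3) inside R(q)\<close>

definition f3_embed :: "Enum.finite_3 \<Rightarrow> 'k" where
  "f3_embed x = (case x of Enum.finite_3.a\<^sub>1 \<Rightarrow> 0 | Enum.finite_3.a\<^sub>2 \<Rightarrow> 1 | Enum.finite_3.a\<^sub>3 \<Rightarrow> -1)"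

fun point_embed :: "Enum.finite_3 ree_point \<Rightarrow> 'k ree_point" where
  "point_embed None = None"
| "point_embed (Some (x, y, z)) = Some (f3_embed x, f3_embed y, f3_embed z)"

lemma f3_embed_simps [simp]:
  "f3_embed Enum.finite_3.a\<^sub>1 = 0" "f3_embed Enum.finite_3.a\<^sub>2 = 1"
  "f3_embed Enum.finite_3.a\<^sub>3 = -1"
  by (simp_all add: f3_embed_def)

lemma f3_embed_0_1: "f3_embed 0 = 0" "f3_embed 1 = 1"
  by simp_all

lemma f3_embed_uminus: "f3_embed (- x) = - f3_embed x"
  by (cases x) (simp_all add: finite_3_arith)

lemma f3_embed_add: "f3_embed (x + y) = f3_embed x + f3_embed y"
  by (cases x; cases y) (simp_all add: finite_3_arith ch3)

lemma f3_embed_mult: "f3_embed (x * y) = f3_embed x * f3_embed y"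
  by (cases x; cases y) (simp_all add: finite_3_arith)

lemma f3_embed_diff: "f3_embed (x - y) = f3_embed x - f3_embed y"
  using f3_embed_add[of x "- y"] by (simp add: f3_embed_uminus)

lemma f3_embed_power: "f3_embed (x ^ m) = f3_embed x ^ m"
  by (induction m) (simp_all only: power_0 power_Suc f3_embed_mult f3_embed_0_1)

lemma f3_embed_inverse: "f3_embed (inverse x) = inverse (f3_embed x)"
  by (cases x) (simp_all add: finite_3_arith)

lemma f3_embed_divide: "f3_embed (x / y) = f3_embed x / f3_embed y"
  by (simp only: divide_inverse f3_embed_mult f3_embed_inverse)

lemma f3_embed_eq_iff [simp]: "f3_embed x = f3_embed y \<longleftrightarrow> x = y"
  by (cases x; cases y) (simp_all add: ch3)

lemma tw_f3_embed: "tw (f3_embed x) = f3_embed (\<theta> 0 x)"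
  unfolding \<theta>_def f3_embed_power by (cases x) (simp_all add: power_0_left)

lemmas f3_simps = f3_embed_add f3_embed_mult f3_embed_uminus f3_embed_diff f3_embed_power
  f3_embed_divide tw_f3_embed

lemma point_embed_eq_iff [simp]: "point_embed p = point_embed q \<longleftrightarrow> p = q"
  by (cases p rule: point_embed.cases; cases q rule: point_embed.cases) auto

lemma omega_point_embed: "ree_omega n (point_embed p) = point_embed (ree_omega 0 p)"
proof (cases p rule: point_embed.cases)
  case (2 x y z)
  have "f3_embed (ree_u 0 x y z) = ree_u n (f3_embed x) (f3_embed y) (f3_embed z)"
    "f3_embed (ree_v 0 x y z) = ree_v n (f3_embed x) (f3_embed y) (f3_embed z)"
    "f3_embed (ree_w 0 x y z) = ree_w n (f3_embed x) (f3_embed y) (f3_embed z)"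
    unfolding ree_u_def ree_v_def ree_w_def by (simp_all only: f3_simps)
  then show ?thesis
    using f3_embed_eq_iff[of x 0] f3_embed_eq_iff[of y 0] f3_embed_eq_iff[of z 0]
    by (simp only: 2 ree_omega_def option.case prod.case point_embed.simps prod.inject
        f3_embed_divide f3_embed_uminus f3_embed_0_1 split: if_split) simp
qed (simp add: ree_omega_def)

lemma translation_point_embed:
  "ree_translation n (f3_embed a, f3_embed b, f3_embed c) (point_embed p) =
   point_embed (ree_translation 0 (a, b, c) p)"
  by (cases p rule: point_embed.cases)
    (simp_all add: ree_translation_def ree_mult_def f3_simps)

text \<open>The vectors of the points of R(3) span the space, and enough linear relations among them
  force all their eigenvalues to agree, so \<open>L\<close> is a scalar. Identities in the large
  group can thus be checked on R(3).\<close>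

lemma fixes_f3_points_imp_id:
  assumes g: "represents n L g" and fix_f3: "\<And>p. g (point_embed p) = point_embed p"
  shows "g = id"
proof -
  have lin: "linear7 L" using g by (simp add: represents_def)
  let ?V = "ree_vec n :: 'k ree_point \<Rightarrow> _"
  have ex: "\<exists>c. L (?V (point_embed p)) = scale7 c (?V (point_embed p))" for p
    using g fix_f3 unfolding represents_def by metis
  obtain c where c: "L (?V None) = scale7 c (?V None)"
    using ex[of None] by auto
  \<comment> \<open>These three vectors and that of infinity satisfy one linear relation up to
    scalars, with no zero coefficient. Their eigenvalues therefore coincide, and infinity occurs in
    every such relation.\<close>
  have line: "?V (Some (x, y, z)) + ?V (Some (x, y + 1, z - x)) + ?V (Some (x, y - 1, z + x)) =
      scale7 (-1) (?V None)" for x y z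
    using three
    by (simp add: ree_w_eq) (simp add: ree_u_def ree_v_def tw_simps algebra_simps power2_eq_square
        power3_eq_cube ch3)
  have scalar: "L (?V (Some (x, y, z))) = scale7 c (?V (Some (x, y, z)))"
    if f3: "x \<in> range f3_embed" "y \<in> range f3_embed" "z \<in> range f3_embed" for x y z
  proof -
    let ?p = "Some (x, y, z)" and ?q = "Some (x, y + 1, z - x)" and ?r = "Some (x, y - 1, z + x)"
    from f3 obtain x' y' z' where "x = f3_embed x'" "y = f3_embed y'" "z = f3_embed z'"
      by blast
    then have "?p = point_embed (Some (x', y', z'))" "?q = point_embed (Some (x', y' + 1, z' - x'))"
      "?r = point_embed (Some (x', y' - 1, z' + x'))"
      by (simp_all add: f3_simps)
    then obtain a b d where L: "L (?V ?p) = scale7 a (?V ?p)" "L (?V ?q) = scale7 b (?V ?q)"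
      "L (?V ?r) = scale7 d (?V ?r)"
      using ex by metis
    have "scale7 a (?V ?p) + scale7 b (?V ?q) + scale7 d (?V ?r) = L (?V ?p + ?V ?q + ?V ?r)"
      by (simp only: linear7_add[OF lin] L)
    also have "\<dots> = scale7 (- c) (?V None)"
      unfolding line linear7_scale7[OF lin] c scale7_scale7 by simp
    finally have sum: "scale7 a (?V ?p) + scale7 b (?V ?q) + scale7 d (?V ?r) = scale7 (- c) (?V None)" .
    then have "a + b + d = 0" and eq: "a * y + b * (y + 1) + d * (y - 1) = 0" by auto
    have "a * y + b * (y + 1) + d * (y - 1) = (a + b + d) * y + b - d"
      by (simp add: algebra_simps)
    with eq have "(a + b + d) * y + b - d = 0" by metis
    then have "b = d" unfolding \<open>a + b + d = 0\<close> by simp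
    then have "a = d" using \<open>a + b + d = 0\<close> by (simp add: add.assoc flip: mult_2) (simp add: ch3)
    have "scale7 a (?V ?p + ?V ?q + ?V ?r) = scale7 (- c) (?V None)"
      using sum \<open>b = d\<close> \<open>a = d\<close> by (simp only: scale7_add)
    then have "scale7 (- a) (?V None) = scale7 (- c) (?V None)"
      unfolding line scale7_scale7 by simp
    then have "a = c" by simp
    with L(1) show ?thesis by simp
  qed
  \<comment> \<open>The eigenspace contains the seven unit vectors, obtained from infinity and the
    triples (0,0,0), (0,1,0), (0,0,1), (1,0,0), (-1,0,0), (1,1,0).\<close>
  define S where "S = {p. L p = scale7 c p}"
  have S_add: "p + q \<in> S" if "p \<in> S" "q \<in> S" for p q
    using that lin by (simp only: S_def mem_Collect_eq linear7_add scale7_add)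
  have S_scale: "scale7 a p \<in> S" if "p \<in> S" for a p
    using that lin unfolding S_def mem_Collect_eq by (simp only: linear7_scale7 scale7_scale7 mult.commute)
  have range: "0 \<in> range f3_embed" "1 \<in> range f3_embed" "-1 \<in> range f3_embed"
    using f3_embed_simps by (metis rangeI)+
  have V: "?V (Some (x, y, z)) \<in> S"
    if "x \<in> range f3_embed" "y \<in> range f3_embed" "z \<in> range f3_embed" for x y z
    using scalar that by (simp add: S_def)
  have comb: "scale7 a p + scale7 b q \<in> S" if "p \<in> S" "q \<in> S" for a b p q
    using that by (intro S_add S_scale)
  note expand = ree_w_eq ree_u_def ree_v_def tw_uminus ch3
  have w: "(0, 0, 0, 0, 0, 0, 1) \<in> S" using c by (simp add: S_def)
  have f: "(1, 0, 0, 0, 0, 0, 0) \<in> S"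
    using V[OF range(1,1,1)] by (simp add: expand)
  have sub: "(0, x, y, z, u, v, 0) \<in> S" if "(1, x, y, z, u, v, t) \<in> S" for x y z u v t
    using comb[OF that comb[OF f w, of 1 t], of 1 "-1"] by simp
  have yu: "(0, 0, 1, 0, 1, 0, 0) \<in> S"
    using V[OF range(1,2,1)] by (intro sub) (simp add: expand)
  have zv: "(0, 0, 0, 1, 0, -1, 0) \<in> S"
    using V[OF range(1,1,2)] by (intro sub) (simp add: expand)
  have x1: "(0, 1, 0, 0, -1, -1, 0) \<in> S"
    using V[OF range(2,1,1)] by (intro sub) (simp add: expand)
  have x2: "(0, -1, 0, 0, -1, 1, 0) \<in> S"
    using V[OF range(3,1,1)] by (intro sub) (simp add: expand)
  have x3: "(0, 1, 1, 0, 1, 1, 0) \<in> S"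
    using V[OF range(2,2,1)] by (intro sub) (simp add: expand)
  have u: "(0, 0, 0, 0, 1, 0, 0) \<in> S" using S_add[OF x1 x2] by (simp add: ch3)
  have y: "(0, 0, 1, 0, 0, 0, 0) \<in> S" using comb[OF yu u, of 1 "-1"] by simp
  have xv: "(0, 1, 0, 0, 0, 1, 0) \<in> S" using comb[OF x3 yu, of 1 "-1"] by simp
  have xv': "(0, 1, 0, 0, 0, -1, 0) \<in> S" using comb[OF x1 u, of 1 1] by simp
  have x: "(0, 1, 0, 0, 0, 0, 0) \<in> S" using comb[OF xv xv', of "-1" "-1"] by (simp add: ch3)
  have v: "(0, 0, 0, 0, 0, 1, 0) \<in> S" using comb[OF xv x, of 1 "-1"] by simp
  have z: "(0, 0, 0, 1, 0, 0, 0) \<in> S" using comb[OF zv v, of 1 1] by simp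
  have all: "p \<in> S" for p
  proof -
    obtain f' x' y' z' u' v' w' where p: "p = (f', x', y', z', u', v', w')"
      by (cases p)
    show ?thesis
      using S_add[OF comb[OF f x, of f' x'] S_add[OF comb[OF y z, of y' z']
            S_add[OF comb[OF u v, of u' v'] S_scale[OF w, of w']]]]
      by (simp add: p)
  qed
  show ?thesis
  proof
    fix p
    show "g p = id p"
      using all[of "ree_vec n p"] by (intro represents_eqI[OF _ g]) (simp add: S_def)
  qed
qed

text \<open>Each generator of the small group is the restriction of a generator of the large one, so
  a word can be lifted letter by letter.\<close>

lemma G_lift:
  assumes "g \<in> ree_group 0"
  obtains g' where "g' \<in> G" "\<And>p. g' (point_embed p) = point_embed (g p)"
proof -
  interpret f3: ree_field 0 "TYPE(Enum.finite_3)"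
    by unfold_locales (simp add: UNIV_finite_3)
  from assms have "\<exists>g'\<in>G. \<forall>p. g' (point_embed p) = point_embed (g p)"
  proof (induction rule: f3.G_induct)
    case id
    show ?case by (rule bexI[OF _ G_id]) simp
  next
    case omega
    show ?case by (rule bexI[OF _ G_omega]) (simp add: omega_point_embed)
  next
    case (translation t)
    show ?case by (cases t) (use G_translation translation_point_embed in blast)
  next
    case (comp g h)
    then obtain g' h' where "g' \<in> G" "h' \<in> G" "\<forall>p. g' (point_embed p) = point_embed (g p)"
      "\<forall>p. h' (point_embed p) = point_embed (h p)" by blast
    then show ?case by (intro bexI[OF _ G_comp[of g' h']]) simp_all
  qed
  then show ?thesis using that by blast
qed

section \<open>Blocks of R(3) as parts of blocks of R(q)\<close>

lemma lines_ree_unital: "lines (ree_unital n) = {{p. g p = p} | g. g \<in> G \<and> g \<noteq> id \<and> g \<circ> g = id}"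
  and incident_ree_unital [simp]: "incident (ree_unital n) = (\<in>)"
  and points_ree_unital [simp]: "points (ree_unital n) = UNIV"
  by (simp_all add: ree_unital_def)

text \<open>The lift of an involution is again an involution: its square fixes every point of R(3),
  hence is the identity.\<close>

lemma line_lift:
  assumes "b \<in> lines ree_unital_3"
  obtains B where "B \<in> lines (ree_unital n :: ('k ree_point, _) incidence_structure)"
    "\<And>p. point_embed p \<in> B \<longleftrightarrow> p \<in> b"
proof -
  from assms obtain g where g: "b = {p. g p = p}" "g \<in> ree_group 0" "g \<noteq> id" "g \<circ> g = id"
    by (auto simp: ree_unital_def)
  obtain g' where g': "g' \<in> G" "\<And>p. g' (point_embed p) = point_embed (g p)"
    using G_lift[OF g(2)] by blast
  obtain L where L: "represents n L g'" using G_represented[OF g'(1)] by blast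
  have "g (g p) = p" for p using fun_cong[OF g(4), of p] by simp
  then have "g' \<circ> g' = id"
    by (intro fixes_f3_points_imp_id[OF represents_comp[OF L L]]) (simp add: g'(2))
  moreover have "g' \<noteq> id"
  proof
    assume "g' = id"
    then have "g p = p" for p using g'(2)[of p] by simp
    with g(3) show False by (auto simp: fun_eq_iff)
  qed
  ultimately have "{p. g' p = p} \<in> lines (ree_unital n)"
    using g'(1) unfolding lines_ree_unital by blast
  then show ?thesis
    by (rule that) (simp add: g'(2) g(1))
qed

text \<open>The image of a fixed point set under \<open>g\<close> is the fixed point set of the
  conjugate by \<open>g\<close>.\<close>

lemma line_image:
  assumes "g \<in> G" "B \<in> lines (ree_unital n)"
  shows "g ` B \<in> lines (ree_unital n)"
proof -
  from assms(2) obtain h where h: "B = {p. h p = p}" "h \<in> G" "h \<noteq> id" "h \<circ> h = id"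
    unfolding lines_ree_unital by blast
  obtain g' where g': "g' \<in> G" "g \<circ> g' = id" "g' \<circ> g = id"
    using G_inverse[OF assms(1)] by blast
  then have inv: "g (g' p) = p" "g' (g p) = p" for p
    by (simp_all add: fun_eq_iff)
  have hh: "h (h p) = p" for p using fun_cong[OF h(4), of p] by simp
  let ?k = "g \<circ> h \<circ> g'"
  have "g ` B = {p. ?k p = p}"
    unfolding h(1) by (auto simp: inv image_iff) (metis inv)+
  moreover have "?k \<circ> ?k = id" by (simp add: fun_eq_iff inv hh)
  moreover have "?k \<noteq> id"
  proof
    assume "?k = id"
    have "h p = p" for p
    proof -
      have "g (h p) = g p" using fun_cong[OF \<open>?k = id\<close>, of "g p"] by (simp add: inv)
      then have "g' (g (h p)) = g' (g p)" by (rule arg_cong)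
      then show ?thesis by (simp only: inv)
    qed
    with h(3) show False by (auto simp: fun_eq_iff)
  qed
  moreover have "?k \<in> G" using assms(1) h(2) g'(1) by (intro G_comp)
  ultimately show ?thesis unfolding lines_ree_unital by blast
qed

end

section \<open>Pappus configurations in the smallest Ree unital\<close>

lemma embeddingD:
  assumes "is_embedding U S \<phi> \<psi>" "incident U = (\<in>)" "points U = UNIV"
  shows "B \<in> lines U \<Longrightarrow> incident S (\<phi> p) (\<psi> B) \<longleftrightarrow> p \<in> B"
    and "\<phi> p \<in> points S"
    and "B \<in> lines U \<Longrightarrow> \<psi> B \<in> lines S"
    and "\<phi> p = \<phi> q \<longleftrightarrow> p = q"
    and "B \<in> lines U \<Longrightarrow> B' \<in> lines U \<Longrightarrow> \<psi> B = \<psi> B' \<longleftrightarrow> B = B'"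
proof -
  from assms have "inj \<phi>" "inj_on \<psi> (lines U)" by (simp_all add: is_embedding_def)
  then show "\<phi> p = \<phi> q \<longleftrightarrow> p = q"
    "B \<in> lines U \<Longrightarrow> B' \<in> lines U \<Longrightarrow> \<psi> B = \<psi> B' \<longleftrightarrow> B = B'"
    by (simp_all only: inj_eq inj_on_eq_iff)
  show "B \<in> lines U \<Longrightarrow> incident S (\<phi> p) (\<psi> B) \<longleftrightarrow> p \<in> B" "\<phi> p \<in> points S"
    "B \<in> lines U \<Longrightarrow> \<psi> B \<in> lines S"
    using assms by (simp_all add: is_embedding_def image_subset_iff)
qed

lemma projective_plane_point_unique:
  assumes "projective_plane S" "l \<in> lines S" "m \<in> lines S" "l \<noteq> m"
    "p \<in> points S" "incident S p l" "incident S p m" "q \<in> points S" "incident S q l" "incident S q m"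
  shows "p = q"
  using assms unfolding projective_plane_def by metis

lemma projective_plane_line_unique:
  assumes "projective_plane S" "p \<in> points S" "q \<in> points S" "p \<noteq> q"
    "l \<in> lines S" "incident S p l" "incident S q l" "m \<in> lines S" "incident S p m" "incident S q m"
  shows "l = m"
  using assms unfolding projective_plane_def by metis

lemma projective_plane_meet:
  assumes "projective_plane S" "l \<in> lines S" "m \<in> lines S" "l \<noteq> m"
  obtains p where "p \<in> points S" "incident S p l" "incident S p m"
  using assms unfolding projective_plane_def by metis

text \<open>The diagonal points of the hexagon are \<open>Q\<close>, \<open>\<phi> y\<close> and the
  meet \<open>z\<close> of the lines of \<open>L1\<close> and \<open>L2\<close>. Since
  \<open>Q\<close> and \<open>\<phi> y\<close> already span the line of \<open>L3\<close>, Pappus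
  puts \<open>z\<close> on it. Neither \<open>Q\<close> nor \<open>z\<close> has to be the image of
  a point of the unital; this allows one application to feed another.\<close>

lemma unital_pappus:
  assumes emb: "is_embedding U S \<phi> \<psi>" and plane: "projective_plane S" and pap: "pappian S"
    and U: "incident U = (\<in>)" "points U = UNIV"
    and lines: "{l, m, j1, j2, j3, j4, L1, L2, L3} \<subseteq> lines U"
    and hexagon: "{a, b, c} \<subseteq> l - m" "{a', b', c'} \<subseteq> m - l" "distinct [a, b, c]" "distinct [a', b', c']"
    and joins: "{a, b'} \<subseteq> j1" "{a', b} \<subseteq> j2" "{a, c', y} \<subseteq> j3" "{a', c, y} \<subseteq> j4"
      "{b, c'} \<subseteq> L1" "{b', c} \<subseteq> L2" "y \<in> L3" "\<not> L1 \<subseteq> L2"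
    and Q: "Q \<in> points S" "incident S Q (\<psi> j1)" "incident S Q (\<psi> j2)" "incident S Q (\<psi> L3)" "Q \<noteq> \<phi> y"
  shows "\<exists>z\<in>points S. incident S z (\<psi> L1) \<and> incident S z (\<psi> L2) \<and> incident S z (\<psi> L3)"
proof -
  note E = embeddingD[OF emb U]
  have "\<psi> L1 \<in> lines S" "\<psi> L2 \<in> lines S" "\<psi> L1 \<noteq> \<psi> L2"
    using lines joins(8) by (auto simp: E(3,5))
  then obtain z where z: "z \<in> points S" "incident S z (\<psi> L1)" "incident S z (\<psi> L2)"
    by (rule projective_plane_meet[OF plane])
  have col: "collinear_in S A" if "A \<subseteq> points S" "B \<in> lines U" "\<forall>p\<in>A. incident S p (\<psi> B)" for A B
    using that E(3) unfolding collinear_in_def by blast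
  have cond: "\<psi> l \<noteq> \<psi> m \<and>
      distinct [\<phi> a, \<phi> b, \<phi> c] \<and>
      (\<forall>p\<in>{\<phi> a, \<phi> b, \<phi> c}. incident S p (\<psi> l) \<and> \<not> incident S p (\<psi> m)) \<and>
      distinct [\<phi> a', \<phi> b', \<phi> c'] \<and>
      (\<forall>p\<in>{\<phi> a', \<phi> b', \<phi> c'}. incident S p (\<psi> m) \<and> \<not> incident S p (\<psi> l)) \<and>
      collinear_in S {\<phi> a, \<phi> b', Q} \<and> collinear_in S {\<phi> a', \<phi> b, Q} \<and>
      collinear_in S {\<phi> a, \<phi> c', \<phi> y} \<and> collinear_in S {\<phi> a', \<phi> c, \<phi> y} \<and>
      collinear_in S {\<phi> b, \<phi> c', z} \<and> collinear_in S {\<phi> b', \<phi> c, z}"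
  proof (intro conjI)
    show "\<psi> l \<noteq> \<psi> m"
      using lines hexagon by (auto simp: E(5))
    show "distinct [\<phi> a, \<phi> b, \<phi> c]" "distinct [\<phi> a', \<phi> b', \<phi> c']"
      using hexagon by (simp_all add: E(4))
    show "\<forall>p\<in>{\<phi> a, \<phi> b, \<phi> c}. incident S p (\<psi> l) \<and> \<not> incident S p (\<psi> m)"
      "\<forall>p\<in>{\<phi> a', \<phi> b', \<phi> c'}. incident S p (\<psi> m) \<and> \<not> incident S p (\<psi> l)"
      using hexagon lines by (auto simp: E(1))
    show "collinear_in S {\<phi> a, \<phi> b', Q}"
      using lines joins Q by (intro col[of _ j1]) (auto simp: E(1,2))
    show "collinear_in S {\<phi> a', \<phi> b, Q}"
      using lines joins Q by (intro col[of _ j2]) (auto simp: E(1,2))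
    show "collinear_in S {\<phi> a, \<phi> c', \<phi> y}"
      using lines joins by (intro col[of _ j3]) (auto simp: E(1,2))
    show "collinear_in S {\<phi> a', \<phi> c, \<phi> y}"
      using lines joins by (intro col[of _ j4]) (auto simp: E(1,2))
    show "collinear_in S {\<phi> b, \<phi> c', z}"
      using lines joins z by (intro col[of _ L1]) (auto simp: E(1,2))
    show "collinear_in S {\<phi> b', \<phi> c, z}"
      using lines joins z by (intro col[of _ L2]) (auto simp: E(1,2))
  qed
  have "\<psi> l \<in> lines S" "\<psi> m \<in> lines S" using lines by (simp_all add: E(3))
  from pap[unfolded pappian_def, THEN bspec, OF this(1), THEN bspec, OF this(2),
      THEN bspec, OF E(2), THEN bspec, OF E(2), THEN bspec, OF E(2), THEN bspec, OF E(2),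
      THEN bspec, OF E(2), THEN bspec, OF E(2), THEN bspec, OF Q(1), THEN bspec, OF E(2),
      THEN bspec, OF z(1), THEN mp, OF cond]
  obtain k where k: "k \<in> lines S" "incident S Q k" "incident S (\<phi> y) k" "incident S z k"
    unfolding collinear_in_def by auto
  have "\<psi> L3 \<in> lines S" "incident S (\<phi> y) (\<psi> L3)"
    using lines joins by (auto simp: E(1,3))
  with k Q E(2) have "k = \<psi> L3"
    by (intro projective_plane_line_unique[OF plane])
  with k(4) z show ?thesis by blast
qed

section \<open>Explicit blocks of R(3)\<close>

lemma finite_3_ree_field: "ree_field TYPE(Enum.finite_3) 0"
  by unfold_locales (simp add: UNIV_finite_3)

lemma incident_points_ree_unital_3: "incident ree_unital_3 = (\<in>)" "points ree_unital_3 = UNIV"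
  by (simp_all add: ree_unital_def)

lemma \<theta>_finite_3: "\<theta> 0 x = (x :: Enum.finite_3)"
  by (cases x) (simp_all add: \<theta>_def power3_eq_cube finite_3_arith)

lemmas r3_eval = ree_omega_def ree_u_def ree_v_def ree_w_def ree_translation_def ree_mult_def
  \<theta>_finite_3 finite_3_arith power2_eq_square power3_eq_cube power4_eq_xxxx

text \<open>Below, \<open>r3_i\<close>, \<open>r3_w\<close>, \<open>r3_iw\<close> and \<open>r3_is\<close> are the blocks of the involutions \<open>i\<close>, \<open>\<omega>\<close>,
  \<open>i \<omega>\<close> and \<open>i \<omega>'\<close>, where \<open>\<omega>'\<close> is the conjugate of \<open>\<omega>\<close> by the translation \<open>(0, 1, 0)\<close>.  The other
  blocks serve as sides of the Pappus hexagons, which were found by computer search, or as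
  intermediate steps in showing that these sides are blocks.\<close>

definition r3_w :: "Enum.finite_3 ree_point set" where
  "r3_w = {Some (0, 1, 1), Some (0, 1, 2), Some (1, 1, 0), Some (2, 1, 0)}"

definition r3_block_1 :: "Enum.finite_3 ree_point set" where
  "r3_block_1 = {Some (0, 1, 0), Some (0, 1, 1), Some (1, 1, 2), Some (2, 1, 2)}"

definition r3_block_2 :: "Enum.finite_3 ree_point set" where
  "r3_block_2 = {Some (0, 1, 2), Some (0, 1, 0), Some (1, 1, 1), Some (2, 1, 1)}"

definition r3_block_3 :: "Enum.finite_3 ree_point set" where
  "r3_block_3 = {Some (2, 2, 2), Some (2, 2, 0), Some (0, 1, 1), Some (1, 0, 1)}"

definition r3_block_4 :: "Enum.finite_3 ree_point set" where
  "r3_block_4 = {Some (1, 1, 0), Some (1, 1, 1), Some (2, 2, 1), Some (0, 0, 0)}"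

definition r3_block_5 :: "Enum.finite_3 ree_point set" where
  "r3_block_5 = {Some (2, 2, 0), Some (2, 2, 1), Some (0, 1, 2), Some (1, 0, 2)}"

definition r3_block_6 :: "Enum.finite_3 ree_point set" where
  "r3_block_6 = {Some (1, 0, 0), Some (1, 2, 2), Some (0, 1, 2), Some (0, 0, 1)}"

definition r3_block_7 :: "Enum.finite_3 ree_point set" where
  "r3_block_7 = {Some (1, 1, 2), Some (1, 1, 0), Some (2, 2, 0), Some (0, 0, 2)}"

definition r3_block_8 :: "Enum.finite_3 ree_point set" where
  "r3_block_8 = {Some (2, 1, 1), Some (1, 1, 0), Some (1, 0, 0), Some (2, 0, 1)}"

definition r3_block_9 :: "Enum.finite_3 ree_point set" where
  "r3_block_9 = {Some (0, 2, 0), Some (0, 1, 1), Some (2, 1, 1), Some (2, 0, 2)}"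

definition r3_block_10 :: "Enum.finite_3 ree_point set" where
  "r3_block_10 = {Some (0, 1, 2), Some (0, 2, 0), Some (1, 0, 1), Some (1, 1, 2)}"

definition r3_block_11 :: "Enum.finite_3 ree_point set" where
  "r3_block_11 = {Some (0, 2, 2), Some (1, 0, 0), Some (0, 1, 1), Some (1, 1, 1)}"

definition r3_block_12 :: "Enum.finite_3 ree_point set" where
  "r3_block_12 = {Some (2, 0, 2), Some (2, 0, 0), Some (0, 2, 2), Some (1, 1, 0)}"

definition r3_block_13 :: "Enum.finite_3 ree_point set" where
  "r3_block_13 = {Some (0, 2, 2), Some (0, 2, 0), Some (1, 2, 2), Some (2, 2, 0)}"

definition r3_block_14 :: "Enum.finite_3 ree_point set" where
  "r3_block_14 = {Some (0, 2, 0), Some (0, 0, 1), Some (1, 1, 0), Some (1, 2, 1)}"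

definition r3_block_15 :: "Enum.finite_3 ree_point set" where
  "r3_block_15 = {Some (2, 0, 0), Some (2, 0, 1), Some (0, 2, 0), Some (1, 1, 1)}"

definition r3_block_16 :: "Enum.finite_3 ree_point set" where
  "r3_block_16 = {Some (0, 0, 2), Some (0, 0, 0), Some (1, 0, 0), Some (2, 0, 2)}"

definition r3_is :: "Enum.finite_3 ree_point set" where
  "r3_is = {Some (1, 2, 0), Some (1, 0, 0), Some (2, 2, 0), Some (2, 0, 0)}"

definition r3_iw :: "Enum.finite_3 ree_point set" where
  "r3_iw = {Some (1, 1, 2), Some (1, 2, 2), Some (2, 1, 1), Some (2, 2, 1)}"

definition r3_block_17 :: "Enum.finite_3 ree_point set" where
  "r3_block_17 = {Some (2, 0, 1), None, Some (2, 2, 0), Some (2, 1, 2)}"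

definition r3_block_18 :: "Enum.finite_3 ree_point set" where
  "r3_block_18 = {Some (0, 2, 1), None, Some (0, 1, 1), Some (0, 0, 1)}"

definition r3_block_19 :: "Enum.finite_3 ree_point set" where
  "r3_block_19 = {Some (0, 2, 2), None, Some (0, 1, 2), Some (0, 0, 2)}"

definition r3_i :: "Enum.finite_3 ree_point set" where
  "r3_i = {Some (0, 2, 0), None, Some (0, 1, 0), Some (0, 0, 0)}"

lemmas r3_blocks = r3_w_def r3_block_1_def r3_block_2_def r3_block_3_def r3_block_4_def
  r3_block_5_def r3_block_6_def r3_block_7_def r3_block_8_def r3_block_9_def r3_block_10_def
  r3_block_11_def r3_block_12_def r3_block_13_def r3_block_14_def r3_block_15_def
  r3_block_16_def r3_is_def r3_iw_def r3_block_17_def r3_block_18_def r3_block_19_def r3_i_def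

lemma r3_line_omega: "A \<in> lines ree_unital_3 \<Longrightarrow> ree_omega 0 ` A \<in> lines ree_unital_3"
  and r3_line_translation: "A \<in> lines ree_unital_3 \<Longrightarrow> ree_translation 0 t ` A \<in> lines ree_unital_3"
proof -
  interpret ree_field 0 "TYPE(Enum.finite_3)" by (rule finite_3_ree_field)
  show "A \<in> lines ree_unital_3 \<Longrightarrow> ree_omega 0 ` A \<in> lines ree_unital_3"
    by (rule line_image[OF G_omega])
  show "A \<in> lines ree_unital_3 \<Longrightarrow> ree_translation 0 t ` A \<in> lines ree_unital_3"
    by (rule line_image[OF G_translation])
qed

lemma fixed_points_omega_3: "{p. ree_omega 0 p = p} = r3_w"
proof (rule Set.set_eqI)
  fix p :: "Enum.finite_3 ree_point"
  show "p \<in> {p. ree_omega 0 p = p} \<longleftrightarrow> p \<in> r3_w"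
  proof (cases p)
    case (Some t)
    obtain x y z where "t = (x, y, z)" by (cases t)
    with Some show ?thesis
      by (cases x; cases y; cases z) (simp_all add: r3_w_def r3_eval)
  qed (simp add: r3_w_def r3_eval)
qed

lemma r3_w_line: "r3_w \<in> lines ree_unital_3"
proof -
  interpret ree_field 0 "TYPE(Enum.finite_3)" by (rule finite_3_ree_field)
  have "ree_omega 0 \<noteq> (id :: Enum.finite_3 ree_point \<Rightarrow> _)"
    by (auto simp: fun_eq_iff ree_omega_def intro: exI[of _ None])
  then show ?thesis
    unfolding lines_ree_unital fixed_points_omega_3[symmetric] using G_omega omega_omega by blast
qed

lemma r3_block_1_line: "r3_block_1 \<in> lines ree_unital_3"
  using r3_line_translation[OF r3_w_line, of "(0, 0, 2)"]
  by (simp add: r3_block_1_def r3_w_def r3_eval)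

lemma r3_block_2_line: "r3_block_2 \<in> lines ree_unital_3"
  using r3_line_translation[OF r3_w_line, of "(0, 0, 1)"]
  by (simp add: r3_block_2_def r3_w_def r3_eval)

lemma r3_block_3_line: "r3_block_3 \<in> lines ree_unital_3"
  using r3_line_translation[OF r3_w_line, of "(2, 1, 0)"]
  by (simp add: r3_block_3_def r3_w_def r3_eval)

lemma r3_block_4_line: "r3_block_4 \<in> lines ree_unital_3"
  using r3_line_translation[OF r3_w_line, of "(1, 0, 0)"]
  by (simp add: r3_block_4_def r3_w_def r3_eval)

lemma r3_block_5_line: "r3_block_5 \<in> lines ree_unital_3"
  using r3_line_translation[OF r3_w_line, of "(2, 1, 1)"]
  by (simp add: r3_block_5_def r3_w_def r3_eval)

lemma r3_block_6_line: "r3_block_6 \<in> lines ree_unital_3"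
  using r3_line_omega[OF r3_block_5_line] by (simp add: r3_block_6_def r3_block_5_def r3_eval)

lemma r3_block_7_line: "r3_block_7 \<in> lines ree_unital_3"
  using r3_line_translation[OF r3_w_line, of "(1, 0, 2)"]
  by (simp add: r3_block_7_def r3_w_def r3_eval)

lemma r3_block_8_line: "r3_block_8 \<in> lines ree_unital_3"
  using r3_line_omega[OF r3_block_7_line] by (simp add: r3_block_8_def r3_block_7_def r3_eval)

lemma r3_block_9_line: "r3_block_9 \<in> lines ree_unital_3"
  using r3_line_omega[OF r3_block_1_line] by (simp add: r3_block_9_def r3_block_1_def r3_eval)

lemma r3_block_10_line: "r3_block_10 \<in> lines ree_unital_3"
  using r3_line_omega[OF r3_block_2_line] by (simp add: r3_block_10_def r3_block_2_def r3_eval)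

lemma r3_block_11_line: "r3_block_11 \<in> lines ree_unital_3"
  using r3_line_omega[OF r3_block_3_line] by (simp add: r3_block_11_def r3_block_3_def r3_eval)

lemma r3_block_12_line: "r3_block_12 \<in> lines ree_unital_3"
  using r3_line_translation[OF r3_w_line, of "(2, 2, 0)"]
  by (simp add: r3_block_12_def r3_w_def r3_eval)

lemma r3_block_13_line: "r3_block_13 \<in> lines ree_unital_3"
  using r3_line_translation[OF r3_w_line, of "(0, 1, 1)"]
  by (simp add: r3_block_13_def r3_w_def r3_eval)

lemma r3_block_14_line: "r3_block_14 \<in> lines ree_unital_3"
  using r3_line_translation[OF r3_block_10_line, of "(0, 1, 1)"]
  by (simp add: r3_block_14_def r3_block_10_def r3_eval)

lemma r3_block_15_line: "r3_block_15 \<in> lines ree_unital_3"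
  using r3_line_translation[OF r3_w_line, of "(2, 2, 1)"]
  by (simp add: r3_block_15_def r3_w_def r3_eval)

lemma r3_block_16_line: "r3_block_16 \<in> lines ree_unital_3"
  using r3_line_translation[OF r3_w_line, of "(0, 2, 1)"]
  by (simp add: r3_block_16_def r3_w_def r3_eval)

lemma r3_is_line: "r3_is \<in> lines ree_unital_3"
  using r3_line_translation[OF r3_block_10_line, of "(1, 1, 2)"]
  by (simp add: r3_is_def r3_block_10_def r3_eval)

lemma r3_iw_line: "r3_iw \<in> lines ree_unital_3"
  using r3_line_translation[OF r3_block_10_line, of "(1, 0, 1)"]
  by (simp add: r3_iw_def r3_block_10_def r3_eval)

lemma r3_block_17_line: "r3_block_17 \<in> lines ree_unital_3"
  using r3_line_omega[OF r3_block_16_line] by (simp add: r3_block_17_def r3_block_16_def r3_eval)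

lemma r3_block_18_line: "r3_block_18 \<in> lines ree_unital_3"
  using r3_line_translation[OF r3_block_17_line, of "(1, 0, 2)"]
  by (simp add: r3_block_18_def r3_block_17_def r3_eval)

lemma r3_block_19_line: "r3_block_19 \<in> lines ree_unital_3"
  using r3_line_translation[OF r3_block_17_line, of "(1, 0, 0)"]
  by (simp add: r3_block_19_def r3_block_17_def r3_eval)

lemma r3_i_line: "r3_i \<in> lines ree_unital_3"
  using r3_line_translation[OF r3_block_17_line, of "(1, 0, 1)"]
  by (simp add: r3_i_def r3_block_17_def r3_eval)

lemmas r3_lines = r3_w_line r3_block_1_line r3_block_2_line r3_block_3_line r3_block_4_line
  r3_block_5_line r3_block_6_line r3_block_7_line r3_block_8_line r3_block_9_line
  r3_block_10_line r3_block_11_line r3_block_12_line r3_block_13_line r3_block_14_line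
  r3_block_15_line r3_block_16_line r3_is_line r3_iw_line r3_block_17_line r3_block_18_line
  r3_block_19_line r3_i_line

text \<open>Two diagonal points of the hexagon, (1,0,0) and (2,0,0), lie on \<open>r3_is\<close>, so
  this block carries the Pappus line; the third diagonal point is the meet of the lines of
  \<open>r3_i\<close> and \<open>r3_w\<close>.\<close>

lemma r3_special_concurrent:
  assumes emb: "is_embedding ree_unital_3 S \<phi> \<psi>" and "projective_plane S" "pappian S"
  shows "\<exists>z\<in>points S. incident S z (\<psi> r3_i) \<and> incident S z (\<psi> r3_w) \<and> incident S z (\<psi> r3_is)"
proof -
  note E = embeddingD[OF emb incident_points_ree_unital_3]
  show ?thesis
    by (rule unital_pappus[OF assms,
        where l = r3_block_4 and m = r3_block_9 and ?j1.0 = r3_block_11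
        and ?j2.0 = r3_block_16 and ?j3.0 = r3_block_15 and ?j4.0 = r3_block_12
        and ?L1.0 = r3_i and ?L2.0 = r3_w and ?L3.0 = r3_is
        and a = "Some (1, 1, 1)" and b = "Some (0, 0, 0)" and c = "Some (1, 1, 0)"
        and a' = "Some (2, 0, 2)" and b' = "Some (0, 1, 1)" and c' = "Some (0, 2, 0)"
        and y = "Some (2, 0, 0)" and Q = "\<phi> (Some (1, 0, 0))"])
      (simp_all only: incident_points_ree_unital_3 E(2,4), simp_all add: r3_lines E(1), simp_all add: r3_blocks)
qed

text \<open>The diagonal points (1,2,2) and (2,1,1) lie on \<open>r3_iw\<close>. The three blocks
  are pairwise disjoint, so the point of concurrency is a new point of the plane, which serves as a
  diagonal point of a further hexagon.\<close>

lemma r3_auxiliary_concurrent: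
  assumes emb: "is_embedding ree_unital_3 S \<phi> \<psi>" and "projective_plane S" "pappian S"
  shows "\<exists>z\<in>points S. incident S z (\<psi> r3_block_12) \<and> incident S z (\<psi> r3_block_18) \<and> incident S z (\<psi> r3_iw)"
proof -
  note E = embeddingD[OF emb incident_points_ree_unital_3]
  show ?thesis
    by (rule unital_pappus[OF assms,
        where l = r3_block_11 and m = r3_block_14 and ?j1.0 = r3_block_6
        and ?j2.0 = r3_block_13 and ?j3.0 = r3_block_8 and ?j4.0 = r3_block_9
        and ?L1.0 = r3_block_12 and ?L2.0 = r3_block_18 and ?L3.0 = r3_iw
        and a = "Some (1, 0, 0)" and b = "Some (0, 2, 2)" and c = "Some (0, 1, 1)"
        and a' = "Some (0, 2, 0)" and b' = "Some (0, 0, 1)" and c' = "Some (1, 1, 0)"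
        and y = "Some (2, 1, 1)" and Q = "\<phi> (Some (1, 2, 2))"])
      (simp_all only: incident_points_ree_unital_3 E(2,4), simp_all add: r3_lines E(1), simp_all add: r3_blocks)
qed

text \<open>One pair of opposite sides lies on \<open>r3_block_12\<close> and
  \<open>r3_block_18\<close>, whose lines meet in the point \<open>Q\<close> of the previous
  configuration, on the line of \<open>r3_iw\<close>. The diagonal point (1,2,2) is a second point
  of that line.\<close>

lemma r3_group_concurrent:
  assumes emb: "is_embedding ree_unital_3 S \<phi> \<psi>" and "projective_plane S" "pappian S"
  shows "\<exists>z\<in>points S. incident S z (\<psi> r3_i) \<and> incident S z (\<psi> r3_w) \<and> incident S z (\<psi> r3_iw)"
proof -
  note E = embeddingD[OF emb incident_points_ree_unital_3]
  obtain Q where Q: "Q \<in> points S" "incident S Q (\<psi> r3_block_12)" "incident S Q (\<psi> r3_block_18)" "incident S Q (\<psi> r3_iw)"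
    using r3_auxiliary_concurrent[OF assms] by blast
  have "\<not> incident S (\<phi> (Some (1, 2, 2))) (\<psi> r3_block_12)"
    by (subst E(1)[OF r3_block_12_line]) (simp add: r3_block_12_def)
  then have neq: "Q \<noteq> \<phi> (Some (1, 2, 2))" using Q(2) by metis
  show ?thesis
    by (rule unital_pappus[OF assms,
        where l = r3_block_19 and m = r3_block_14 and ?j1.0 = r3_block_12
        and ?j2.0 = r3_block_18 and ?j3.0 = r3_block_13 and ?j4.0 = r3_block_6
        and ?L1.0 = r3_i and ?L2.0 = r3_w and ?L3.0 = r3_iw
        and a = "Some (0, 2, 2)" and b = "None" and c = "Some (0, 1, 2)"
        and a' = "Some (0, 0, 1)" and b' = "Some (1, 1, 0)" and c' = "Some (0, 2, 0)"
        and y = "Some (1, 2, 2)" and Q = "Q"])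
      (simp_all only: incident_points_ree_unital_3 neq, simp_all add: r3_lines Q, simp_all add: r3_blocks)
qed

section \<open>Projective planes over fields\<close>

lemma dim_UNIV_3: "vec.dim (UNIV :: ('f::field ^ 3) set) = 3"
  using vec_dim_card[where 'a = 'f and 'n = 3] by simp

lemma PG2_line_span:
  fixes a b :: "'f::field ^ 3"
  assumes "vec.subspace W" "vec.dim W = 2" "a \<in> W" "b \<in> W" "a \<noteq> 0" "b \<notin> vec.span {a}"
  shows "W = vec.span {a, b}"
proof
  have ind: "vec.independent {b, a}"
    using assms(5,6) by (intro vec.independent_insertI vec.independent_empty) simp_all
  have ab: "b \<noteq> a" using assms(6) by (auto simp: vec.span_base)
  have "W \<subseteq> vec.span {b, a}"
    using assms ind ab by (intro vec.card_ge_dim_independent) simp_all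
  then show "W \<subseteq> vec.span {a, b}" by (simp add: insert_commute)
  show "vec.span {a, b} \<subseteq> W"
    using assms by (intro vec.span_minimal) simp_all
qed

lemma dim_span_pair:
  fixes a b :: "'f::field ^ 3"
  assumes "a \<noteq> 0" "b \<notin> vec.span {a}"
  shows "vec.dim (vec.span {a, b}) = 2"
proof -
  have "vec.independent {b, a}"
    using assms by (intro vec.independent_insertI vec.independent_empty) simp_all
  then have "vec.dim {b, a} = card {b, a}" by (rule vec.dim_eq_card_independent)
  moreover have "b \<noteq> a" using assms(2) by (auto simp: vec.span_base)
  ultimately show ?thesis by (simp only: vec.dim_span insert_commute[of a b]) simp
qed

lemma PG2_pointE:
  assumes "V \<in> points (PG2 :: (('f::field ^ 3) set, ('f ^ 3) set) incidence_structure)"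
  obtains v where "v \<noteq> 0" "V = vec.span {v}"
proof -
  have V: "vec.subspace V" "vec.dim V = 1" using assms by (simp_all add: PG2_def)
  obtain B where B: "B \<subseteq> V" "vec.independent B" "V \<subseteq> vec.span B" "card B = 1"
    using vec.basis_exists[of V] V(2) by metis
  then obtain v where v: "B = {v}" by (auto simp: card_1_singleton_iff)
  have "v \<noteq> 0" using B(2) by (auto simp: v vec.dependent_zero)
  moreover have "V = vec.span {v}"
    using B v V(1) by (intro antisym vec.span_minimal) simp_all
  ultimately show ?thesis by (rule that)
qed

lemma span_singleton_PG2_point:
  fixes v :: "'f::field ^ 3"
  shows "v \<noteq> 0 \<Longrightarrow> vec.span {v} \<in> points PG2"
  by (simp add: PG2_def vec.dim_span_eq_card_independent)

lemma span_singleton_subset_iff: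
  fixes v :: "'f::field ^ 3"
  shows "vec.subspace W \<Longrightarrow> vec.span {v} \<subseteq> W \<longleftrightarrow> v \<in> W"
  by (meson empty_subsetI insert_subset vec.span_base singletonI subset_iff vec.span_minimal)

lemma span_singleton_eq:
  fixes v w :: "'f::field ^ 3"
  assumes "v \<noteq> 0" "v \<in> vec.span {w}"
  shows "vec.span {v} = vec.span {w}"
proof -
  obtain k where k: "v = k *s w" using assms(2) by (auto simp: vec.span_singleton)
  then have "k \<noteq> 0" using assms(1) by auto
  then have "w = inverse k *s v" by (simp add: k)
  then have "w \<in> vec.span {v}" by (metis vec.span_base vec.span_scale singletonI)
  then show ?thesis using assms(2) by (intro antisym vec.span_minimal) simp_all
qed

lemma PG2_meet_dim:
  fixes W W' :: "('f::field ^ 3) set"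
  assumes "vec.subspace W" "vec.dim W = 2" "vec.subspace W'" "vec.dim W' = 2" "W \<noteq> W'"
  shows "vec.dim (W \<inter> W') = 1"
proof -
  have "vec.dim {x + y |x y. x \<in> W \<and> y \<in> W'} + vec.dim (W \<inter> W') = 4"
    using vec.dim_sums_Int[OF assms(1,3)] assms by simp
  moreover have "vec.dim {x + y |x y. x \<in> W \<and> y \<in> W'} \<le> 3"
    unfolding dim_UNIV_3[symmetric, where 'f = 'f] by (rule vec.dim_subset[OF subset_UNIV])
  moreover have "vec.dim (W \<inter> W') \<noteq> 2"
  proof
    assume d: "vec.dim (W \<inter> W') = 2"
    have "vec.subspace (W \<inter> W')" using assms by (intro vec.subspace_inter)
    then have "W \<inter> W' = W" "W \<inter> W' = W'"
      using assms d by (intro vec.subspace_dim_equal; simp)+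
    then show False using assms(5) by simp
  qed
  moreover have "vec.dim (W \<inter> W') \<le> 2"
    using vec.dim_subset[of "W \<inter> W'" W] assms(2) by simp
  ultimately show ?thesis by linarith
qed

lemma span_pair_iff:
  fixes u v :: "'f::field ^ 3"
  shows "w \<in> vec.span {u, v} \<longleftrightarrow> (\<exists>p q. w = p *s u + q *s v)"
proof
  assume "w \<in> vec.span {u, v}"
  then obtain p where "w - p *s u \<in> vec.span {v}" by (auto simp: vec.span_breakdown_eq)
  then obtain q where "w - p *s u = q *s v" by (auto simp: vec.span_singleton)
  then show "\<exists>p q. w = p *s u + q *s v" by (metis add.commute diff_add_cancel)
next
  assume "\<exists>p q. w = p *s u + q *s v"
  then obtain p q where "w = p *s u + q *s v" by (elim exE)
  then show "w \<in> vec.span {u, v}"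
    by (simp only:) (intro vec.span_add vec.span_scale vec.span_base; simp)
qed

lemma three_of_four:
  assumes "card {a, b, c, d} = 4" "A \<subseteq> {a, b, c, d}" "card A = 3"
  shows "A = {a, b, c} \<or> A = {a, b, d} \<or> A = {a, c, d} \<or> A = {b, c, d}"
proof -
  have "distinct [a, b, c, d]"
    by (rule card_distinct) (simp only: list.set assms(1), simp)
  then have diff: "{a, b, c, d} - {a} = {b, c, d}" "{a, b, c, d} - {b} = {a, c, d}"
    "{a, b, c, d} - {c} = {a, b, d}" "{a, b, c, d} - {d} = {a, b, c}"
    by auto
  have "finite A" using assms(2) by (rule finite_subset) simp
  then have "card ({a, b, c, d} - A) = 4 - 3"
    using assms by (simp only: card_Diff_subset)
  also have "\<dots> = (1 :: nat)" by simp
  finally obtain x where x: "{a, b, c, d} - A = {x}" by (rule card_1_singletonE)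
  then have A: "A = {a, b, c, d} - {x}" and "x \<in> {a, b, c, d}" using assms(2) by blast+
  then consider "x = a" | "x = b" | "x = c" | "x = d" by blast
  then show ?thesis
    by cases (simp_all only: A diff simp_thms)
qed

lemma PG2_spanning_not_collinear:
  fixes u v w :: "'f::field ^ 3"
  assumes "\<And>x. \<exists>p q r. x = p *s u + q *s v + r *s w"
  shows "\<not> collinear_in (PG2 :: (('f ^ 3) set, ('f ^ 3) set) incidence_structure)
    {vec.span {u}, vec.span {v}, vec.span {w}}"
proof
  assume "collinear_in (PG2 :: (('f ^ 3) set, ('f ^ 3) set) incidence_structure)
    {vec.span {u}, vec.span {v}, vec.span {w}}"
  then obtain W where W: "vec.subspace W" "vec.dim W = 2" "u \<in> W" "v \<in> W" "w \<in> W"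
    unfolding collinear_in_def by (auto simp: PG2_def span_singleton_subset_iff)
  have "x \<in> W" for x
    using assms[of x] W by (auto intro!: vec.subspace_add vec.subspace_scale)
  then have "W = UNIV" by auto
  then show False using W(2) dim_UNIV_3[where 'f = 'f] by simp
qed

lemma PG2_spanning_distinct:
  fixes u v w :: "'f::field ^ 3"
  assumes span: "\<And>x. \<exists>p q r. x = p *s u + q *s v + r *s w"
  shows "vec.span {u} \<noteq> vec.span {v}" "vec.span {u} \<noteq> vec.span {w}" "vec.span {v} \<noteq> vec.span {w}"
proof -
  have small: "\<not> (u \<in> vec.span {s, t} \<and> v \<in> vec.span {s, t} \<and> w \<in> vec.span {s, t})" for s t
  proof
    assume *: "u \<in> vec.span {s, t} \<and> v \<in> vec.span {s, t} \<and> w \<in> vec.span {s, t}"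
    have "x \<in> vec.span {s, t}" for x
      using span[of x] * by (auto intro!: vec.span_add vec.span_scale)
    then have "UNIV = vec.span {s, t}" by auto
    then have "vec.dim (UNIV :: ('f ^ 3) set) \<le> card {s, t}"
      by (intro vec.dim_le_card) auto
    also have "\<dots> \<le> 2" by (simp add: card_insert_if)
    finally show False by (simp only: dim_UNIV_3)
  qed
  have base: "x \<in> vec.span {x}" "x \<in> vec.span {x, y}" "y \<in> vec.span {x, y}" for x y :: "'f ^ 3"
    by (simp_all add: vec.span_base)
  have mono: "vec.span {x} \<subseteq> vec.span {x, y}" for x y :: "'f ^ 3"
    by (rule vec.span_mono) simp
  show "vec.span {u} \<noteq> vec.span {v}" using small[of u w] base mono[of u w] by blast
  show "vec.span {u} \<noteq> vec.span {w}" using small[of u v] base mono[of u v] by blast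
  show "vec.span {v} \<noteq> vec.span {w}" using small[of v u] base mono[of v u] by blast
qed

lemma projective_plane_PG2:
  "projective_plane (PG2 :: (('f::field ^ 3) set, ('f ^ 3) set) incidence_structure)"
  unfolding projective_plane_def
proof (intro conjI ballI impI)
  fix V V' :: "('f ^ 3) set"
  assume V: "V \<in> points PG2" and V': "V' \<in> points PG2" and ne: "V \<noteq> V'"
  obtain v where v: "v \<noteq> 0" "V = vec.span {v}" using V by (rule PG2_pointE)
  obtain v' where v': "v' \<noteq> 0" "V' = vec.span {v'}" using V' by (rule PG2_pointE)
  have notin: "v' \<notin> vec.span {v}" using ne span_singleton_eq[OF v'(1)] v v' by metis
  show "\<exists>!l. l \<in> lines PG2 \<and> incident PG2 V l \<and> incident PG2 V' l"
  proof (rule ex1I[of _ "vec.span {v, v'}"])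
    show "vec.span {v, v'} \<in> lines PG2 \<and> incident PG2 V (vec.span {v, v'}) \<and> incident PG2 V' (vec.span {v, v'})"
      using v(1) notin
      by (simp add: PG2_def dim_span_pair v(2) v'(2) vec.span_mono del: vec.dim_span)
  next
    fix l assume "l \<in> lines PG2 \<and> incident PG2 V l \<and> incident PG2 V' l"
    then show "l = vec.span {v, v'}"
      using v notin v'(2) by (intro PG2_line_span) (auto simp: PG2_def span_singleton_subset_iff)
  qed
next
  fix W W' :: "('f ^ 3) set"
  assume W: "W \<in> lines PG2" "W' \<in> lines PG2" "W \<noteq> W'"
  then have s: "vec.subspace W" "vec.dim W = 2" "vec.subspace W'" "vec.dim W' = 2"
    by (simp_all add: PG2_def)
  then have d: "vec.dim (W \<inter> W') = 1" using W(3) by (rule PG2_meet_dim)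
  have sub: "vec.subspace (W \<inter> W')" using s by (intro vec.subspace_inter)
  show "\<exists>!p. p \<in> points PG2 \<and> incident PG2 p W \<and> incident PG2 p W'"
  proof (rule ex1I[of _ "W \<inter> W'"])
    show "W \<inter> W' \<in> points PG2 \<and> incident PG2 (W \<inter> W') W \<and> incident PG2 (W \<inter> W') W'"
      using d sub by (simp add: PG2_def)
  next
    fix p assume "p \<in> points PG2 \<and> incident PG2 p W \<and> incident PG2 p W'"
    then show "p = W \<inter> W'"
      using d sub by (intro vec.subspace_dim_equal) (auto simp: PG2_def)
  qed
next
  let ?e1 = "vector [1, 0, 0] :: 'f ^ 3" and ?e2 = "vector [0, 1, 0] :: 'f ^ 3"
    and ?e3 = "vector [0, 0, 1] :: 'f ^ 3" and ?s = "vector [1, 1, 1] :: 'f ^ 3"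
  let ?Q = "{vec.span {?e1}, vec.span {?e2}, vec.span {?e3}, vec.span {?s}}"
  note frame = vec_eq_iff forall_3
  have g1: "\<exists>p q r. x = p *s ?e1 + q *s ?e2 + r *s ?e3" for x
    by (rule exI[of _ "x $ 1"], rule exI[of _ "x $ 2"], rule exI[of _ "x $ 3"]) (simp add: frame)
  have g2: "\<exists>p q r. x = p *s ?e1 + q *s ?e2 + r *s ?s" for x
    by (rule exI[of _ "x $ 1 - x $ 3"], rule exI[of _ "x $ 2 - x $ 3"], rule exI[of _ "x $ 3"]) (simp add: frame)
  have g3: "\<exists>p q r. x = p *s ?e1 + q *s ?e3 + r *s ?s" for x
    by (rule exI[of _ "x $ 1 - x $ 2"], rule exI[of _ "x $ 3 - x $ 2"], rule exI[of _ "x $ 2"]) (simp add: frame)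
  have g4: "\<exists>p q r. x = p *s ?e2 + q *s ?e3 + r *s ?s" for x
    by (rule exI[of _ "x $ 2 - x $ 1"], rule exI[of _ "x $ 3 - x $ 1"], rule exI[of _ "x $ 1"]) (simp add: frame)
  note d = PG2_spanning_distinct[OF g1] PG2_spanning_distinct[OF g2] PG2_spanning_distinct[OF g3]
  have "distinct [vec.span {?e1}, vec.span {?e2}, vec.span {?e3}, vec.span {?s}]"
    using d by (simp only: distinct.simps list.set insert_iff empty_iff simp_thms)
  from distinct_card[OF this] have card: "card ?Q = 4"
    by (simp only: list.set) simp
  have nz: "?e1 \<noteq> 0" "?e2 \<noteq> 0" "?e3 \<noteq> 0" "?s \<noteq> 0"
    by (simp_all add: frame)
  show "\<exists>Q\<subseteq>points PG2. card Q = 4 \<and>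
    (\<forall>A. A \<subseteq> Q \<and> card A = 3 \<longrightarrow> \<not> collinear_in (PG2 :: (('f ^ 3) set, ('f ^ 3) set) incidence_structure) A)"
  proof (intro exI[of _ ?Q] conjI allI impI)
    show "?Q \<subseteq> points PG2"
      using nz by (simp only: insert_subset empty_subsetI span_singleton_PG2_point simp_thms)
    show "card ?Q = 4" by (rule card)
    fix A assume A: "A \<subseteq> ?Q \<and> card A = 3"
    then have "A = {vec.span {?e1}, vec.span {?e2}, vec.span {?e3}}
      \<or> A = {vec.span {?e1}, vec.span {?e2}, vec.span {?s}}
      \<or> A = {vec.span {?e1}, vec.span {?e3}, vec.span {?s}}
      \<or> A = {vec.span {?e2}, vec.span {?e3}, vec.span {?s}}"
      by (intro three_of_four[OF card]) simp_all
    then show "\<not> collinear_in (PG2 :: (('f ^ 3) set, ('f ^ 3) set) incidence_structure) A"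
      using PG2_spanning_not_collinear[OF g1] PG2_spanning_not_collinear[OF g2]
        PG2_spanning_not_collinear[OF g3] PG2_spanning_not_collinear[OF g4]
      by (elim disjE) (simp_all only: simp_thms)
  qed
qed

text \<open>Rescaling the vectors of the first two points by the coefficients of the third makes the
  third point the span of their sum. This normalization keeps the coordinates in Pappus' theorem
  short.\<close>

lemma PG2_triple:
  fixes W :: "('f::field ^ 3) set"
  assumes W: "W \<in> lines PG2" and V: "V1 \<in> points PG2" "V2 \<in> points PG2" "V3 \<in> points PG2"
    and sub: "V1 \<subseteq> W" "V2 \<subseteq> W" "V3 \<subseteq> W" and dist: "distinct [V1, V2, V3]"
  obtains a b where "V1 = vec.span {a}" "V2 = vec.span {b}" "V3 = vec.span {a + b}"
    "a \<noteq> 0" "b \<noteq> 0" "W = vec.span {a, b}"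
proof -
  have sW: "vec.subspace W" "vec.dim W = 2" using W by (simp_all add: PG2_def)
  obtain a where a: "a \<noteq> 0" "V1 = vec.span {a}" using V(1) by (rule PG2_pointE)
  obtain b where b: "b \<noteq> 0" "V2 = vec.span {b}" using V(2) by (rule PG2_pointE)
  obtain c where c: "c \<noteq> 0" "V3 = vec.span {c}" using V(3) by (rule PG2_pointE)
  have mem: "a \<in> W" "b \<in> W" "c \<in> W"
    using sub sW(1) by (simp_all add: a(2) b(2) c(2) span_singleton_subset_iff)
  have "b \<notin> vec.span {a}" using dist span_singleton_eq[OF b(1), of a] a b by auto
  then have Wab: "W = vec.span {a, b}" using sW mem a(1) by (intro PG2_line_span)
  then obtain p q where pq: "c = p *s a + q *s b"
    using mem(3) by (auto simp: span_pair_iff)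
  have "p \<noteq> 0"
  proof
    assume "p = 0"
    then have "c \<in> vec.span {b}" using pq by (simp add: vec.span_scale vec.span_base)
    then show False using dist span_singleton_eq[OF c(1)] b c by auto
  qed
  moreover have "q \<noteq> 0"
  proof
    assume "q = 0"
    then have "c \<in> vec.span {a}" using pq by (simp add: vec.span_scale vec.span_base)
    then show False using dist span_singleton_eq[OF c(1)] a c by auto
  qed
  ultimately have nz: "p *s a \<noteq> 0" "q *s b \<noteq> 0" using a(1) b(1) by simp_all
  have spans: "vec.span {p *s a} = vec.span {a}" "vec.span {q *s b} = vec.span {b}"
    by (rule span_singleton_eq[OF nz(1)], intro vec.span_scale vec.span_base, simp)
      (rule span_singleton_eq[OF nz(2)], intro vec.span_scale vec.span_base, simp)
  have "q *s b \<notin> vec.span {p *s a}"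
    using \<open>b \<notin> vec.span {a}\<close> \<open>q \<noteq> 0\<close> spans by (metis vec.span_base singletonI span_singleton_eq nz(2))
  then have "W = vec.span {p *s a, q *s b}"
    using sW mem nz by (intro PG2_line_span) (simp_all add: vec.subspace_scale)
  then show ?thesis
    using that[of "p *s a" "q *s b"] nz by (simp only: spans a(2) b(2) c(2) pq simp_thms)
qed

lemma PG2_collinearD:
  assumes "collinear_in (PG2 :: (('f::field ^ 3) set, ('f ^ 3) set) incidence_structure)
    {vec.span {u}, vec.span {v}, vec.span {w}}" and "u \<noteq> 0" "v \<notin> vec.span {u}"
  obtains p q where "w = p *s u + q *s v"
proof -
  obtain W where W: "vec.subspace W" "vec.dim W = 2" "u \<in> W" "v \<in> W" "w \<in> W"
    using assms(1) unfolding collinear_in_def by (auto simp: PG2_def span_singleton_subset_iff)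
  then have "w \<in> vec.span {u, v}" using PG2_line_span[of W u v] assms by simp
  then show ?thesis using that by (auto simp: span_pair_iff)
qed

lemma PG2_basis:
  fixes a b a' :: "'f::field ^ 3"
  assumes "a \<noteq> 0" "b \<notin> vec.span {a}" "a' \<notin> vec.span {a, b}"
  shows "\<exists>p q r. v = p *s a + q *s b + r *s a'"
    and "p *s a + q *s b + r *s a' = 0 \<Longrightarrow> p = 0 \<and> q = 0 \<and> r = 0"
proof -
  have a': "r = 0" if "p *s a + q *s b + r *s a' = 0" for p q r
  proof (rule ccontr)
    assume "r \<noteq> 0"
    have "a' = (- p / r) *s a + (- q / r) *s b"
    proof (simp only: vec_eq_iff, intro allI)
      fix i
      have "(p *s a + q *s b + r *s a') $ i = 0" using that by simp
      then have "p * a $ i + q * b $ i + r * a' $ i = 0" by simp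
      then have "r * a' $ i = - p * a $ i - q * b $ i" by algebra
      then show "a' $ i = ((- p / r) *s a + (- q / r) *s b) $ i"
        using \<open>r \<noteq> 0\<close> by (simp add: field_simps)
    qed
    then show False using assms(3) span_pair_iff by blast
  qed
  have b: "q = 0" if "p *s a + q *s b = 0" for p q
  proof (rule ccontr)
    assume "q \<noteq> 0"
    have "b = (- p / q) *s a"
    proof (simp only: vec_eq_iff, intro allI)
      fix i
      have "(p *s a + q *s b) $ i = 0" using that by simp
      then have "p * a $ i + q * b $ i = 0" by simp
      then have "q * b $ i = - p * a $ i" by (simp add: add_eq_0_iff2 algebra_simps)
      then show "b $ i = ((- p / q) *s a) $ i"
        using \<open>q \<noteq> 0\<close> by (simp add: field_simps)
    qed
    then have "b \<in> vec.span {a}" unfolding vec.span_singleton by (rule range_eqI)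
    with assms(2) show False by blast
  qed
  show "p = 0 \<and> q = 0 \<and> r = 0" if eq: "p *s a + q *s b + r *s a' = 0" for p q r
  proof -
    have r: "r = 0" using eq by (rule a')
    then have "p *s a + q *s b = 0" using eq by simp
    then have q: "q = 0" by (rule b)
    then have "p *s a = 0" using eq r by simp
    then show ?thesis using q r assms(1) by simp
  qed
  have "vec.independent {a', b, a}"
    using assms by (intro vec.independent_insertI vec.independent_empty) (simp_all add: insert_commute)
  moreover have "a \<noteq> b" "a \<noteq> a'" "b \<noteq> a'" using assms(2,3) by (auto simp: vec.span_base)
  then have "card {a', b, a} = 3" by simp
  then have "vec.dim (UNIV :: ('f ^ 3) set) \<le> card {a', b, a}" by (simp only: dim_UNIV_3)
  ultimately have "UNIV \<subseteq> vec.span {a', b, a}"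
    by (intro vec.card_ge_dim_independent[OF subset_UNIV])
  then have "v \<in> vec.span {a', b, a}" by blast
  then obtain r where "v - r *s a' \<in> vec.span {b, a}" unfolding vec.span_breakdown_eq by blast
  then obtain q p where "v - r *s a' = q *s b + p *s a" unfolding span_pair_iff by blast
  then have "v = p *s a + q *s b + r *s a'" by (simp add: diff_eq_eq add.commute)
  then show "\<exists>p q r. v = p *s a + q *s b + r *s a'" by blast
qed

text \<open>With \<open>C\<close> and \<open>C'\<close> spanned by \<open>a + b\<close> and
  \<open>a' + b'\<close>, everything is computed in the basis \<open>a\<close>, \<open>b\<close>,
  \<open>a'\<close>, where \<open>b' = l *s a + m *s b + n *s a'\<close>. The claim becomes that the
  vector of \<open>Z\<close> is a combination of those of \<open>X\<close> and
  \<open>Y\<close>.\<close>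

lemma pappian_PG2:
  "pappian (PG2 :: (('f::field ^ 3) set, ('f ^ 3) set) incidence_structure)"
  unfolding pappian_def
proof (intro ballI impI, elim conjE)
  fix W1 W2 A B C A' B' C' X Y Z :: "('f ^ 3) set"
  let ?P = "PG2 :: (('f ^ 3) set, ('f ^ 3) set) incidence_structure"
  assume W: "W1 \<in> lines ?P" "W2 \<in> lines ?P" "W1 \<noteq> W2"
    and pts: "A \<in> points ?P" "B \<in> points ?P" "C \<in> points ?P" "A' \<in> points ?P" "B' \<in> points ?P"
      "C' \<in> points ?P" "X \<in> points ?P" "Y \<in> points ?P" "Z \<in> points ?P"
    and dist: "distinct [A, B, C]" "distinct [A', B', C']"
    and on1: "\<forall>p\<in>{A, B, C}. incident ?P p W1 \<and> \<not> incident ?P p W2"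
    and on2: "\<forall>p\<in>{A', B', C'}. incident ?P p W2 \<and> \<not> incident ?P p W1"
    and col: "collinear_in ?P {A, B', X}" "collinear_in ?P {A', B, X}" "collinear_in ?P {A, C', Y}"
      "collinear_in ?P {A', C, Y}" "collinear_in ?P {B, C', Z}" "collinear_in ?P {B', C, Z}"
  have sub1: "A \<subseteq> W1" "B \<subseteq> W1" "C \<subseteq> W1" "\<not> A \<subseteq> W2" "\<not> B \<subseteq> W2"
    and sub2: "A' \<subseteq> W2" "B' \<subseteq> W2" "C' \<subseteq> W2" "\<not> A' \<subseteq> W1" "\<not> B' \<subseteq> W1" "\<not> C' \<subseteq> W1"
    using on1 on2 by (simp_all add: PG2_def)
  have sW: "vec.subspace W1" "vec.subspace W2" using W by (simp_all add: PG2_def)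
  obtain a b where ab: "A = vec.span {a}" "B = vec.span {b}" "C = vec.span {a + b}" "a \<noteq> 0" "b \<noteq> 0"
    "W1 = vec.span {a, b}"
    by (rule PG2_triple[OF W(1) pts(1-3) sub1(1-3) dist(1)])
  obtain a' b' where ab': "A' = vec.span {a'}" "B' = vec.span {b'}" "C' = vec.span {a' + b'}" "a' \<noteq> 0"
    "b' \<noteq> 0" "W2 = vec.span {a', b'}"
    by (rule PG2_triple[OF W(2) pts(4-6) sub2(1-3) dist(2)])
  obtain x where x: "x \<noteq> 0" "X = vec.span {x}" using pts(7) by (rule PG2_pointE)
  obtain y where y: "y \<noteq> 0" "Y = vec.span {y}" using pts(8) by (rule PG2_pointE)
  obtain z where z: "z \<noteq> 0" "Z = vec.span {z}" using pts(9) by (rule PG2_pointE)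
  have in1: "a \<in> W1" "b \<in> W1" "a + b \<in> W1" "a \<notin> W2" "b \<notin> W2"
    and in2: "a' \<in> W2" "b' \<in> W2" "a' \<notin> W1" "b' \<notin> W1" "a' + b' \<notin> W1"
    using sub1 sub2 by (simp_all only: ab(1-3) ab'(1-3) span_singleton_subset_iff sW not_False_eq_True)
  have off: "w \<notin> vec.span {v}" if "v \<in> W1" "w \<notin> W1" for v w
    using that span_singleton_subset_iff[OF sW(1), of v] by blast
  have off': "v \<notin> vec.span {w}" if "v \<noteq> 0" "v \<in> W1" "w \<notin> W1" for v w
    using off[OF that(2,3)] span_singleton_eq[OF that(1), of w] vec.span_base[of w "{w}"] by blast
  have "b \<notin> vec.span {a}"
    using dist(1) span_singleton_eq[OF ab(5), of a] by (auto simp: ab)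
  note basis = PG2_basis[OF ab(4) this in2(3)[unfolded ab(6)]]
  obtain l m n where b': "b' = l *s a + m *s b + n *s a'" using basis(1) by blast
  have W2I: "p *s a' + q *s b' \<in> W2" for p q
    using in2 sW(2) by (intro vec.subspace_add vec.subspace_scale)
  have m0: "m \<noteq> 0"
  proof
    assume m: "m = 0"
    have "l \<noteq> 0"
    proof
      assume "l = 0"
      then have "b' \<in> vec.span {a'}" using b' m by (simp add: vec.span_scale vec.span_base)
      then show False using dist(2) span_singleton_eq[OF ab'(5), of a'] by (auto simp: ab')
    qed
    then have "a = (- n / l) *s a' + (1 / l) *s b'"
      unfolding b' m by (simp add: vec_eq_iff field_simps)
    then show False using W2I in1(4) by metis
  qed
  have n0: "n \<noteq> 0"
  proof
    assume "n = 0"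
    then have "b' \<in> W1" unfolding b' using in1 sW(1) by (simp add: vec.subspace_add vec.subspace_scale)
    then show False using in2 by simp
  qed
  have eqD: "p = p' \<and> q = q' \<and> r = r'"
    if "p *s a + q *s b + r *s a' = p' *s a + q' *s b + r' *s a'" for p q r p' q' r'
  proof -
    have "(p - p') *s a + (q - q') *s b + (r - r') *s a' =
      (p *s a + q *s b + r *s a') - (p' *s a + q' *s b + r' *s a')"
      by (simp add: vec_eq_iff algebra_simps)
    then have "(p - p') *s a + (q - q') *s b + (r - r') *s a' = 0" unfolding that by simp
    from basis(2)[OF this] show ?thesis by simp
  qed
  obtain p1 q1 where x1: "x = p1 *s a + q1 *s b'"
    by (rule PG2_collinearD[OF col(1)[unfolded ab ab' x] ab(4) off[OF in1(1) in2(4)]])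
  obtain r1 s1 where x2: "x = r1 *s a' + s1 *s b"
    by (rule PG2_collinearD[OF col(2)[unfolded ab ab' x] ab'(4) off'[OF ab(5) in1(2) in2(3)]])
  obtain p2 q2 where y1: "y = p2 *s a + q2 *s (a' + b')"
    by (rule PG2_collinearD[OF col(3)[unfolded ab ab' y] ab(4) off[OF in1(1) in2(5)]])
  have ab0: "a + b \<noteq> 0"
  proof
    assume "a + b = 0"
    then have "1 *s a + 1 *s b + 0 *s a' = 0" by simp
    from basis(2)[OF this] show False by simp
  qed
  obtain r2 s2 where y2: "y = r2 *s a' + s2 *s (a + b)"
    by (rule PG2_collinearD[OF col(4)[unfolded ab ab' y] ab'(4) off'[OF ab0 in1(3) in2(3)]])
  obtain p3 q3 where z1: "z = p3 *s b + q3 *s (a' + b')"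
    by (rule PG2_collinearD[OF col(5)[unfolded ab ab' z] ab(5) off[OF in1(2) in2(5)]])
  obtain r3 s3 where z2: "z = r3 *s b' + s3 *s (a + b)"
    by (rule PG2_collinearD[OF col(6)[unfolded ab ab' z] ab'(5) off'[OF ab0 in1(3) in2(4)]])
  have "(p1 + q1 * l) *s a + (q1 * m) *s b + (q1 * n) *s a' = 0 *s a + s1 *s b + r1 *s a'"
    using x1 unfolding x2 b' by (simp add: vec_eq_iff algebra_simps)
  from eqD[OF this] have e1: "p1 + q1 * l = 0" "q1 * m = s1" "q1 * n = r1" by auto
  have "(p2 + q2 * l) *s a + (q2 * m) *s b + (q2 * (1 + n)) *s a' = s2 *s a + s2 *s b + r2 *s a'"
    using y1 unfolding y2 b' by (simp add: vec_eq_iff algebra_simps)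
  from eqD[OF this] have e2: "p2 + q2 * l = s2" "q2 * m = s2" "q2 * (1 + n) = r2" by auto
  have "(q3 * l) *s a + (p3 + q3 * m) *s b + (q3 * (1 + n)) *s a' = (r3 * l + s3) *s a + (r3 * m + s3) *s b + (r3 * n) *s a'"
    using z1 unfolding z2 b' by (simp add: vec_eq_iff algebra_simps)
  from eqD[OF this] have e3: "q3 * l = r3 * l + s3" "p3 + q3 * m = r3 * m + s3" "q3 * (1 + n) = r3 * n" by auto
  \<comment> \<open>Up to scalars, the meet of \<open>AB'\<close> with \<open>A'B\<close> and the
    meet of \<open>AC'\<close> with \<open>A'C\<close>.\<close>
  define x0 y0 where "x0 = m *s b + n *s a'" and "y0 = m *s (a + b) + (1 + n) *s a'"
  have x: "x = q1 *s x0" unfolding x2 x0_def e1(2,3)[symmetric] by (simp add: vec_eq_iff algebra_simps)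
  have y: "y = q2 *s y0" unfolding y2 y0_def e2(2,3)[symmetric] by (simp add: vec_eq_iff algebra_simps)
  have x00: "x0 \<noteq> 0" using \<open>x \<noteq> 0\<close> x by auto
  have y0: "y0 \<notin> vec.span {x0}"
  proof
    assume "y0 \<in> vec.span {x0}"
    then obtain k where "y0 = k *s x0" by (auto simp: vec.span_singleton)
    then have "m *s a + m *s b + (1 + n) *s a' = 0 *s a + (k * m) *s b + (k * n) *s a'"
      unfolding x0_def y0_def by (simp add: vec_eq_iff algebra_simps)
    from eqD[OF this] m0 show False by simp
  qed
  \<comment> \<open>The coefficient of \<open>y0\<close> in \<open>z\<close> is forced by that of
    \<open>a\<close>, and then \<open>k\<close> by that of \<open>b\<close>. That the coefficient of
    \<open>a'\<close> also agrees is the content of Pappus' theorem and uses commutativity of the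
    field.\<close>
  define k where "k = (r3 * m + s3 - q3 * l) / m"
  have km: "k * m = r3 * m + s3 - q3 * l" using m0 by (simp add: k_def)
  have "m * (k * n) = m * (r3 * n - q3 * l / m * (1 + n))"
  proof -
    have "m * (k * n) = (k * m) * n" by simp
    also have "\<dots> = m * (r3 * n) + (s3 - q3 * l) * n" unfolding km by (simp add: algebra_simps)
    also have "s3 - q3 * l = - (r3 * l)" unfolding e3(1) by simp
    also have "m * (r3 * n) + - (r3 * l) * n = m * (r3 * n) - l * (r3 * n)" by (simp add: algebra_simps)
    also have "\<dots> = m * (r3 * n) - l * (q3 * (1 + n))" unfolding e3(3) ..
    finally have "m * (k * n) = m * (r3 * n) - l * (q3 * (1 + n))" .
    moreover have "m * (r3 * n - q3 * l / m * (1 + n)) = m * (r3 * n) - l * (q3 * (1 + n))"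
      using m0 by (simp add: right_diff_distrib mult_ac)
    ultimately show ?thesis by metis
  qed
  then have kn: "k * n = r3 * n - q3 * l / m * (1 + n)" using m0 by simp
  have "z = (q3 * l) *s a + (r3 * m + s3) *s b + (r3 * n) *s a'"
    unfolding e3(1) unfolding z2 b' by (simp add: vec_eq_iff algebra_simps)
  also have "\<dots> = (q3 * l / m * m) *s a + (k * m + q3 * l / m * m) *s b + (k * n + q3 * l / m * (1 + n)) *s a'"
    using m0 by (simp add: km kn)
  also have "\<dots> = k *s x0 + (q3 * l / m) *s y0"
    unfolding x0_def y0_def by (simp add: vec_eq_iff algebra_simps add_divide_distrib)
  finally have z: "z \<in> vec.span {x0, y0}" unfolding span_pair_iff by blast
  have "x \<in> vec.span {x0, y0}" "y \<in> vec.span {x0, y0}"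
    unfolding x y by (intro vec.span_scale vec.span_base; simp)+
  then have "X \<subseteq> vec.span {x0, y0}" "Y \<subseteq> vec.span {x0, y0}" "Z \<subseteq> vec.span {x0, y0}"
    using z by (simp_all only: \<open>X = vec.span {x}\<close> \<open>Y = vec.span {y}\<close> \<open>Z = vec.span {z}\<close>
        span_singleton_subset_iff vec.subspace_span)
  moreover have "vec.span {x0, y0} \<in> lines ?P"
    using dim_span_pair[OF x00 y0] by (simp only: PG2_def incidence_structure.simps mem_Collect_eq vec.subspace_span simp_thms)
  ultimately show "collinear_in ?P {X, Y, Z}"
    unfolding collinear_in_def using pts(7-9) by (auto simp: PG2_def)
qed

section \<open>The stabilizer of the point of concurrency\<close>

text \<open>A hypothetical embedding of R(q) into a plane satisfying the assumption on R(3); the aim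
  is to derive \<open>False\<close> in this locale.\<close>

locale ree_embedding = ree_field n K for n :: nat and K :: "'k::{field, finite} itself" +
  fixes P :: "('p, 'l) incidence_structure" and \<phi> :: "'k ree_point \<Rightarrow> 'p"
    and \<psi> :: "'k ree_point set \<Rightarrow> 'l"
  assumes plane: "projective_plane P"
    and emb: "is_embedding (ree_unital n) P \<phi> \<psi>"
    and sub_pappian: "\<And>\<alpha> \<beta>. is_embedding ree_unital_3 P \<alpha> \<beta> \<Longrightarrow>
      \<exists>S. subplane S P \<and> pappian S \<and>
        \<alpha> ` points ree_unital_3 \<subseteq> points S \<and> \<beta> ` lines ree_unital_3 \<subseteq> lines S"
begin

section \<open>Embeddings of R(3) obtained by composing with the Ree group\<close>

abbreviation unital_lines :: "'k ree_point set set" where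
  "unital_lines \<equiv> lines (ree_unital n)"

lemmas emb_simps = embeddingD[OF emb incident_ree_unital points_ree_unital]

text \<open>Uniqueness of the joining block is read off from the embedding: both blocks have the
  same image line, and \<open>\<psi>\<close> is injective.\<close>

lemma unital_line_unique:
  assumes "B \<in> unital_lines" "B' \<in> unital_lines" "p \<noteq> q" "p \<in> B" "q \<in> B" "p \<in> B'" "q \<in> B'"
  shows "B = B'"
proof -
  have "\<psi> B = \<psi> B'"
    using assms by (intro projective_plane_line_unique[OF plane emb_simps(2)[of p] emb_simps(2)[of q]]) (simp_all add: emb_simps)
  then show ?thesis using assms by (simp add: emb_simps(5))
qed

definition lift :: "Enum.finite_3 ree_point set \<Rightarrow> 'k ree_point set" where
  "lift b = (SOME B. B \<in> unital_lines \<and> (\<forall>p. point_embed p \<in> B \<longleftrightarrow> p \<in> b))"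

lemma lift:
  assumes "b \<in> lines ree_unital_3"
  shows "lift b \<in> unital_lines" "point_embed p \<in> lift b \<longleftrightarrow> p \<in> b"
proof -
  have "\<exists>B. B \<in> unital_lines \<and> (\<forall>p. point_embed p \<in> B \<longleftrightarrow> p \<in> b)"
    using line_lift[OF assms] by metis
  from someI_ex[OF this] show "lift b \<in> unital_lines" "point_embed p \<in> lift b \<longleftrightarrow> p \<in> b"
    unfolding lift_def by blast+
qed

lemma lift_eqI:
  assumes "b \<in> lines ree_unital_3" "B \<in> unital_lines" "p \<in> b" "q \<in> b" "p \<noteq> q"
    "point_embed p \<in> B" "point_embed q \<in> B"
  shows "lift b = B"
  using assms by (intro unital_line_unique[of _ _ "point_embed p" "point_embed q"]) (simp_all add: lift)

definition image_line :: "('k ree_point \<Rightarrow> 'k ree_point) \<Rightarrow> Enum.finite_3 ree_point set \<Rightarrow> 'l" where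
  "image_line g b = \<psi> (g ` lift b)"

lemma image_lift: "g \<in> G \<Longrightarrow> b \<in> lines ree_unital_3 \<Longrightarrow> g ` lift b \<in> unital_lines"
  by (simp add: line_image lift)

lemma image_line_line: "g \<in> G \<Longrightarrow> b \<in> lines ree_unital_3 \<Longrightarrow> image_line g b \<in> lines P"
  unfolding image_line_def by (intro emb_simps(3) image_lift)

lemma image_line_incident:
  "g \<in> G \<Longrightarrow> b \<in> lines ree_unital_3 \<Longrightarrow> incident P (\<phi> p) (image_line g b) \<longleftrightarrow> p \<in> g ` lift b"
  unfolding image_line_def by (intro emb_simps(1) image_lift)

lemma image_line_eq_iff:
  assumes "g \<in> G" "b \<in> lines ree_unital_3" "b' \<in> lines ree_unital_3"
  shows "image_line g b = image_line g b' \<longleftrightarrow> b = b'"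
proof
  assume "image_line g b = image_line g b'"
  then have "g ` lift b = g ` lift b'"
    unfolding image_line_def using assms by (simp add: emb_simps(5) image_lift)
  then have "lift b = lift b'"
    using G_bij[OF assms(1)] by (simp add: bij_is_inj inj_image_eq_iff)
  then show "b = b'" using lift(2)[OF assms(2)] lift(2)[OF assms(3)] by blast
qed simp

text \<open>For \<open>h\<close> preserving R(3), with action \<open>h3\<close> there, two points
  suffice to recognize the image of a block. This reduces statements on lines to the evaluation of
  \<open>h3\<close> at two points.\<close>

lemma image_line_shift:
  assumes g: "g \<in> G" "h \<in> G" and h: "\<And>p. h (point_embed p) = point_embed (h3 p)"
    and b: "b \<in> lines ree_unital_3" "b' \<in> lines ree_unital_3"
    and pq: "p \<noteq> q" "p \<in> b" "q \<in> b" "h3 p \<in> b'" "h3 q \<in> b'"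
  shows "image_line (g \<circ> h) b = image_line g b'"
proof -
  have "h ` lift b = lift b'"
  proof (rule unital_line_unique)
    show "h ` lift b \<in> unital_lines" "lift b' \<in> unital_lines"
      using assms by (simp_all add: image_lift lift)
    show "point_embed (h3 p) \<in> h ` lift b" "point_embed (h3 q) \<in> h ` lift b"
      unfolding h[symmetric] using b pq by (simp_all add: lift)
    show "point_embed (h3 p) \<in> lift b'" "point_embed (h3 q) \<in> lift b'"
      using b pq by (simp_all add: lift)
    show "point_embed (h3 p) \<noteq> point_embed (h3 q)"
      unfolding h[symmetric] using pq(1) bij_is_inj[OF G_bij[OF g(2)]] by (simp add: inj_eq)
  qed
  then show ?thesis unfolding image_line_def by (simp only: image_comp[symmetric])
qed

text \<open>The copy of R(3) moved by \<open>g\<close> is again embedded in the plane, so it lies in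
  a pappian subplane, which may depend on \<open>g\<close>.\<close>

lemma sub_embedding:
  assumes g: "g \<in> G"
  obtains S where "subplane S P" "pappian S"
    "is_embedding ree_unital_3 S (\<lambda>p. \<phi> (g (point_embed p))) (image_line g)"
proof -
  have inj: "g p = g q \<longleftrightarrow> p = q" for p q
    using bij_is_inj[OF G_bij[OF g]] by (simp add: inj_eq)
  have inc: "incident P (\<phi> (g (point_embed p))) (image_line g b) \<longleftrightarrow> p \<in> b" if "b \<in> lines ree_unital_3" for p b
    using that g bij_is_inj[OF G_bij[OF g]] by (simp add: image_line_incident inj_image_mem_iff lift)
  have "is_embedding ree_unital_3 P (\<lambda>p. \<phi> (g (point_embed p))) (image_line g)"
    unfolding is_embedding_def incident_points_ree_unital_3
    using g by (auto intro!: inj_onI simp: emb_simps(2,4) inj image_line_line image_line_eq_iff inc)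
  from sub_pappian[OF this] obtain S where S: "subplane S P" "pappian S"
    "(\<lambda>p. \<phi> (g (point_embed p))) ` points ree_unital_3 \<subseteq> points S"
    "image_line g ` lines ree_unital_3 \<subseteq> lines S" by blast
  have "is_embedding ree_unital_3 S (\<lambda>p. \<phi> (g (point_embed p))) (image_line g)"
    unfolding is_embedding_def
  proof (intro conjI ballI)
    show "inj_on (\<lambda>p. \<phi> (g (point_embed p))) (points ree_unital_3)" "inj_on (image_line g) (lines ree_unital_3)"
      using g by (auto intro!: inj_onI simp: emb_simps(4) inj image_line_eq_iff)
  next
    fix p b assume pb: "p \<in> points ree_unital_3" "b \<in> lines ree_unital_3"
    with S have "incident S (\<phi> (g (point_embed p))) (image_line g b) \<longleftrightarrow>
        incident P (\<phi> (g (point_embed p))) (image_line g b)"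
      unfolding subplane_def by blast
    then show "incident ree_unital_3 p b \<longleftrightarrow> incident S (\<phi> (g (point_embed p))) (image_line g b)"
      using inc[OF pb(2)] by (simp add: incident_points_ree_unital_3)
  qed (use S in auto)
  with S show ?thesis using that by blast
qed

lemma concurrent:
  assumes g: "g \<in> G"
  shows "\<exists>z\<in>points P. incident P z (image_line g r3_i) \<and> incident P z (image_line g r3_w) \<and> incident P z (image_line g r3_is)"
    and "\<exists>z\<in>points P. incident P z (image_line g r3_i) \<and> incident P z (image_line g r3_w) \<and> incident P z (image_line g r3_iw)"
proof -
  obtain S where S: "subplane S P" "pappian S"
    "is_embedding ree_unital_3 S (\<lambda>p. \<phi> (g (point_embed p))) (image_line g)"
    by (rule sub_embedding[OF g])
  have pl: "projective_plane S" using S(1) by (simp add: subplane_def)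
  have lS: "image_line g b \<in> lines S" if "b \<in> lines ree_unital_3" for b
    using that S(3) unfolding is_embedding_def by blast
  have transfer: "z \<in> points P \<and> (incident S z (image_line g b) \<longleftrightarrow> incident P z (image_line g b))"
    if "z \<in> points S" "b \<in> lines ree_unital_3" for z b
    using that S(1) lS unfolding subplane_def by blast
  show "\<exists>z\<in>points P. incident P z (image_line g r3_i) \<and> incident P z (image_line g r3_w) \<and> incident P z (image_line g r3_is)"
    using r3_special_concurrent[OF S(3) pl S(2)] transfer r3_i_line r3_w_line r3_is_line by metis
  show "\<exists>z\<in>points P. incident P z (image_line g r3_i) \<and> incident P z (image_line g r3_w) \<and> incident P z (image_line g r3_iw)"
    using r3_group_concurrent[OF S(3) pl S(2)] transfer r3_i_line r3_w_line r3_iw_line by metis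
qed

section \<open>The meeting point and the group preserving it\<close>

lemma r3_distinct: "r3_i \<noteq> r3_w" "r3_i \<noteq> r3_is"
proof -
  have "None \<in> r3_i" "None \<notin> r3_w" "None \<notin> r3_is"
    by (simp_all add: r3_blocks)
  then show "r3_i \<noteq> r3_w" "r3_i \<noteq> r3_is" by metis+
qed

definition meet_point :: "('k ree_point \<Rightarrow> 'k ree_point) \<Rightarrow> 'p" where
  "meet_point g = (THE z. z \<in> points P \<and> incident P z (image_line g r3_i) \<and> incident P z (image_line g r3_w))"

lemma meet_point_eqI:
  assumes "g \<in> G" "z \<in> points P" "incident P z (image_line g r3_i)" "incident P z (image_line g r3_w)"
  shows "meet_point g = z"
  unfolding meet_point_def
proof (rule the_equality)
  fix y assume "y \<in> points P \<and> incident P y (image_line g r3_i) \<and> incident P y (image_line g r3_w)"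
  then show "y = z"
    using assms r3_distinct
    by (intro projective_plane_point_unique[OF plane, of "image_line g r3_i" "image_line g r3_w"])
      (simp_all add: image_line_line image_line_eq_iff r3_lines)
qed (use assms in simp)

lemma meet_point:
  assumes g: "g \<in> G"
  shows "meet_point g \<in> points P" "incident P (meet_point g) (image_line g r3_i)" "incident P (meet_point g) (image_line g r3_w)"
    "incident P (meet_point g) (image_line g r3_is)" "incident P (meet_point g) (image_line g r3_iw)"
  using concurrent[OF g] meet_point_eqI[OF g] by metis+

text \<open>Elements of \<open>G\<close> need not be induced by collineations of \<open>P\<close>,
  so no stabilizer in the usual sense is available. Requiring invariance for all \<open>g\<close>
  makes \<open>H\<close> closed under composition.\<close>

definition H :: "('k ree_point \<Rightarrow> 'k ree_point) set" where
  "H = {h \<in> G. \<forall>g\<in>G. meet_point (g \<circ> h) = meet_point g}"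

lemma H_G: "h \<in> H \<Longrightarrow> h \<in> G" and H_meet_point: "h \<in> H \<Longrightarrow> g \<in> G \<Longrightarrow> meet_point (g \<circ> h) = meet_point g"
  by (simp_all add: H_def)

lemma H_I:
  assumes "h \<in> G"
    and "\<And>g. g \<in> G \<Longrightarrow> incident P (meet_point g) (image_line (g \<circ> h) r3_i)"
    and "\<And>g. g \<in> G \<Longrightarrow> incident P (meet_point g) (image_line (g \<circ> h) r3_w)"
  shows "h \<in> H"
  unfolding H_def using assms by (simp add: meet_point_eqI G_comp meet_point(1))

lemma H_comp: "g \<in> H \<Longrightarrow> h \<in> H \<Longrightarrow> g \<circ> h \<in> H"
  unfolding H_def by (simp add: G_comp flip: comp_assoc)

lemma H_inverse:
  assumes "h \<in> H" "k \<in> G" "k \<circ> h = id"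
  shows "k \<in> H"
  unfolding H_def
proof (intro CollectI conjI ballI assms(2))
  fix g assume "g \<in> G"
  then have "meet_point (g \<circ> k \<circ> h) = meet_point (g \<circ> k)"
    using assms by (intro H_meet_point G_comp)
  then show "meet_point (g \<circ> k) = meet_point g" by (simp add: comp_assoc assms(3))
qed

lemma omega_H: "ree_omega n \<in> H"
proof (rule H_I[OF G_omega])
  fix g assume g: "g \<in> G"
  have "image_line (g \<circ> ree_omega n) r3_i = image_line g r3_i"
    by (rule image_line_shift[OF g G_omega omega_point_embed r3_i_line r3_i_line, of None "Some (0, 0, 0)"])
      (simp_all add: r3_i_def r3_eval)
  then show "incident P (meet_point g) (image_line (g \<circ> ree_omega n) r3_i)" by (simp add: meet_point g)
  have "image_line (g \<circ> ree_omega n) r3_w = image_line g r3_w"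
    by (rule image_line_shift[OF g G_omega omega_point_embed r3_w_line r3_w_line,
          of "Some (0, 1, 1)" "Some (0, 1, 2)"])
      (simp_all add: r3_w_def r3_eval)
  then show "incident P (meet_point g) (image_line (g \<circ> ree_omega n) r3_w)" by (simp add: meet_point g)
qed

text \<open>The translation fixes the block of i and carries that of i \<omega> to
  \<open>r3_is\<close>. So the meeting points before and after the translation both lie on the lines
  of \<open>r3_i\<close> and \<open>r3_is\<close>, and they agree. Both concurrency results enter
  here.\<close>

lemma translation_H: "ree_translation n (0, 1, 0) \<in> H"
proof (rule H_I[OF G_translation])
  let ?T = "ree_translation n (0, 1, 0)" and ?T3 = "ree_translation 0 (0, 1, 0)"
  have T3: "?T (point_embed p) = point_embed (?T3 p)" for p
    using translation_point_embed[of 0 1 0 p] by simp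
  fix g assume g: "g \<in> G"
  have i: "image_line (g \<circ> ?T) r3_i = image_line g r3_i"
    by (rule image_line_shift[OF g G_translation T3 r3_i_line r3_i_line, of None "Some (0, 0, 0)"])
      (simp_all add: r3_i_def r3_eval)
  then show "incident P (meet_point g) (image_line (g \<circ> ?T) r3_i)" by (simp add: meet_point g)
  have iw: "image_line (g \<circ> ?T) r3_iw = image_line g r3_is"
    by (rule image_line_shift[OF g G_translation T3 r3_iw_line r3_is_line,
          of "Some (1, 2, 2)" "Some (2, 2, 1)"])
      (simp_all add: r3_blocks r3_eval)
  have gT: "g \<circ> ?T \<in> G" by (rule G_comp[OF g G_translation])
  have "meet_point (g \<circ> ?T) = meet_point g"
    using meet_point(1,2,5)[OF gT] meet_point(1,2,4)[OF g] g r3_distinct unfolding i iw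
    by (intro projective_plane_point_unique[OF plane, of "image_line g r3_i" "image_line g r3_is"])
      (simp_all add: image_line_line image_line_eq_iff r3_lines)
  with meet_point(3)[OF gT] show "incident P (meet_point g) (image_line (g \<circ> ?T) r3_w)" by simp
qed

text \<open>Conjugation by \<open>cyc\<close> maps \<open>i\<close> to \<open>i \<omega>\<close> and \<open>\<omega>\<close> to \<open>i\<close>; here \<open>i\<close> is called \<open>sigma\<close>.\<close>

definition cyc3 :: "Enum.finite_3 ree_point \<Rightarrow> Enum.finite_3 ree_point" where
  "cyc3 = ree_translation 0 (1, 0, 0) \<circ> ree_translation 0 (0, 1, 0) \<circ> ree_omega 0 \<circ>
     ree_translation 0 (0, 0, 1) \<circ> ree_translation 0 (0, 1, 0) \<circ> ree_translation 0 (0, 1, 0)"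

definition cyc :: "'k ree_point \<Rightarrow> 'k ree_point" where
  "cyc = ree_translation n (1, 0, 0) \<circ> ree_translation n (0, 1, 0) \<circ> ree_omega n \<circ>
     ree_translation n (0, 0, 1) \<circ> ree_translation n (0, 1, 0) \<circ> ree_translation n (0, 1, 0)"

lemma cyc_G: "cyc \<in> G"
  unfolding cyc_def by (intro G_comp G_translation G_omega)

lemma cyc_point_embed: "cyc (point_embed p) = point_embed (cyc3 p)"
  using translation_point_embed[of 1 0 0] translation_point_embed[of 0 1 0]
    translation_point_embed[of 0 0 1]
  by (simp add: cyc_def cyc3_def omega_point_embed)

text \<open>The blocks of i and \<omega> are moved to those of i \<omega> and i, whose lines both
  contain the old meeting point.\<close>

lemma cyc_H: "cyc \<in> H"
proof (rule H_I[OF cyc_G])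
  fix g assume g: "g \<in> G"
  have "image_line (g \<circ> cyc) r3_i = image_line g r3_iw"
    by (rule image_line_shift[OF g cyc_G cyc_point_embed r3_i_line r3_iw_line, of None "Some (0, 0, 0)"])
      (simp_all add: r3_blocks cyc3_def r3_eval)
  then show "incident P (meet_point g) (image_line (g \<circ> cyc) r3_i)" by (simp add: meet_point g)
  have "image_line (g \<circ> cyc) r3_w = image_line g r3_i"
    by (rule image_line_shift[OF g cyc_G cyc_point_embed r3_w_line r3_i_line,
          of "Some (0, 1, 1)" "Some (0, 1, 2)"])
      (simp_all add: r3_blocks cyc3_def r3_eval)
  then show "incident P (meet_point g) (image_line (g \<circ> cyc) r3_w)" by (simp add: meet_point g)
qed

lemma omega_line: "{p. ree_omega n p = p} \<in> unital_lines"
proof -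
  have "ree_omega n \<noteq> (id :: 'k ree_point \<Rightarrow> _)"
    by (auto simp: fun_eq_iff ree_omega_def intro: exI[of _ None])
  then show ?thesis
    unfolding lines_ree_unital using G_omega omega_omega by blast
qed

lemma lift_w: "lift r3_w = {p. ree_omega n p = p}"
  by (rule lift_eqI[OF r3_w_line omega_line, of "Some (0, 1, 1)" "Some (0, 1, 2)"])
    (simp_all only: r3_w_def mem_Collect_eq omega_point_embed, simp_all add: r3_eval)

fun sign_lin :: "'k vec7 \<Rightarrow> 'k vec7" where
  "sign_lin (f, x, y, z, u, v, w) = (f, - x, y, - z, u, - v, w)"

fun sigma :: "'a::field ree_point \<Rightarrow> 'a ree_point" where
  "sigma None = None"
| "sigma (Some (x, y, z)) = Some (- x, y, - z)"

lemma sign_lin_vec: "sign_lin (ree_vec n p) = ree_vec n (sigma p)"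
proof (cases p rule: sigma.cases)
  case (2 x y z)
  then show ?thesis
    by (simp add: ree_w_eq) (simp add: ree_u_def ree_v_def tw_uminus algebra_simps)
qed simp

lemma represents_sigma: "represents n sign_lin sigma"
proof (rule representsI)
  show "linear7 sign_lin" unfolding linear7_def by auto
  show "\<exists>c. c \<noteq> 0 \<and> sign_lin (ree_vec n p) = scale7 c (ree_vec n (sigma p))" for p
    by (intro exI[of _ 1]) (simp add: sign_lin_vec)
qed

text \<open>An explicit word in the generators represents i: the product of its matrices is -1 times
  \<open>sign_lin\<close>, which is projectively the same map.\<close>

lemma sigma_G: "sigma \<in> G"
proof -
  let ?A = "ree_translation n (1, 0, 0) :: 'k ree_point \<Rightarrow> _"
    and ?B = "ree_translation n (0, 1, 0) :: 'k ree_point \<Rightarrow> _"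
    and ?w = "ree_omega n :: 'k ree_point \<Rightarrow> _"
  let ?LA = "translation_lin n (1, 0, 0) :: 'k vec7 \<Rightarrow> _"
    and ?LB = "translation_lin n (0, 1, 0) :: 'k vec7 \<Rightarrow> _"
  let ?g = "?A \<circ> (?A \<circ> (?w \<circ> (?B \<circ> (?A \<circ> (?w \<circ> (?A \<circ> (?A \<circ> ?w)))))))"
    and ?L = "?LA \<circ> (?LA \<circ> (omega_lin \<circ> (?LB \<circ> (?LA \<circ> (omega_lin \<circ> (?LA \<circ> (?LA \<circ> omega_lin)))))))"
  have "represents n ?L ?g"
    by (intro represents_comp represents_translation represents_omega)
  moreover have "?L q = scale7 (-1) (sign_lin q)" for q
    using three by (cases q) (simp add: algebra_simps ch3)
  ultimately have "?g p = sigma p" for p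
    by (intro represents_eqI[of ?L n p "-1"]) (simp_all add: sign_lin_vec del: comp_apply)
  then have "sigma = ?g" by (intro ext) metis
  also have "?g \<in> G" by (intro G_comp G_translation G_omega)
  finally show ?thesis .
qed

lemma sigma_line: "{p. sigma p = p} \<in> unital_lines"
proof -
  have "sigma (sigma p) = p" for p :: "'k ree_point"
    by (cases p rule: sigma.cases) auto
  then have "sigma \<circ> sigma = (id :: 'k ree_point \<Rightarrow> _)" by auto
  moreover have "sigma (Some (1, 0, 0)) \<noteq> Some (1 :: 'k, 0, 0)"
    using one_neq_minus_one by auto
  then have "sigma \<noteq> (id :: 'k ree_point \<Rightarrow> _)" by (metis id_apply)
  ultimately show ?thesis unfolding lines_ree_unital using sigma_G by blast
qed

lemma lift_i: "lift r3_i = {p. sigma p = p}"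
  by (rule lift_eqI[OF r3_i_line sigma_line, of None "Some (0, 0, 0)"])
    (simp_all add: r3_i_def)

lemma sigma_point_embed: "sigma (point_embed p) = point_embed (sigma p)"
  by (cases p rule: sigma.cases) (simp_all add: f3_simps)

text \<open>Reduces an identity between elements of the Ree group to a finite check on the 28 points
  of R(3).\<close>

lemma G_eqI:
  assumes "g \<in> G" "h \<in> G" "\<And>p. g (point_embed p) = h (point_embed p)"
  shows "g = h"
proof -
  obtain k where k: "k \<in> G" "h \<circ> k = id" "k \<circ> h = id"
    using G_inverse[OF assms(2)] by metis
  obtain L where "represents n L (k \<circ> g)"
    using G_represented[OF G_comp[OF k(1) assms(1)]] by metis
  then have "k \<circ> g = id"
    using fun_cong[OF k(3)] by (intro fixes_f3_points_imp_id) (simp_all add: assms(3))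
  have "g = (h \<circ> k) \<circ> g" by (simp add: k(2))
  also have "\<dots> = h" by (simp only: comp_assoc \<open>k \<circ> g = id\<close> comp_id)
  finally show ?thesis .
qed

lemma cyc_sigma: "cyc \<circ> sigma = sigma \<circ> ree_omega n \<circ> cyc"
proof (rule G_eqI)
  show "cyc \<circ> sigma \<in> G" "sigma \<circ> ree_omega n \<circ> cyc \<in> G"
    by (intro G_comp cyc_G sigma_G G_omega)+
  fix p
  have "cyc3 (sigma p) = sigma (ree_omega 0 (cyc3 p))"
  proof (cases p rule: sigma.cases)
    case (2 x y z)
    then show ?thesis
      by (cases x; cases y; cases z) (simp_all add: cyc3_def r3_eval)
  qed (simp add: cyc3_def r3_eval)
  then show "(cyc \<circ> sigma) (point_embed p) = (sigma \<circ> ree_omega n \<circ> cyc) (point_embed p)"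
    by (simp add: sigma_point_embed cyc_point_embed omega_point_embed)
qed

section \<open>All of SL(2, q) preserves the meeting point\<close>

definition sl2_stab :: "'k \<times> 'k \<times> 'k \<times> 'k \<Rightarrow> bool" where
  "sl2_stab m \<longleftrightarrow> (\<exists>h\<in>H. represents n (sl2_lin m) h)"

lemma sl2_stab_comp:
  assumes "sl2_stab (a, b, c, d)" "sl2_stab (a', b', c', d')"
  shows "sl2_stab (a * a' + b * c', a * b' + b * d', c * a' + d * c', c * b' + d * d')"
proof -
  from assms obtain g h where "g \<in> H" "represents n (sl2_lin (a, b, c, d)) g"
    "h \<in> H" "represents n (sl2_lin (a', b', c', d')) h"
    unfolding sl2_stab_def by metis
  then have "g \<circ> h \<in> H" "represents n (sl2_lin (a, b, c, d) \<circ> sl2_lin (a', b', c', d')) (g \<circ> h)"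
    by (simp_all only: H_comp represents_comp)
  then show ?thesis unfolding sl2_stab_def sl2_lin_comp by metis
qed

lemma sl2_stab_omega: "sl2_stab (0, -1, 1, 0)"
  unfolding sl2_stab_def sl2_lin_omega by (intro bexI[of _ "ree_omega n"] represents_omega omega_H)

lemma sl2_stab_translation_iff: "sl2_stab (1, b, 0, 1) \<longleftrightarrow> ree_translation n (0, b, 0) \<in> H"
  unfolding sl2_stab_def sl2_lin_translation by (metis represents_translation represents_unique)

lemma sl2_stab_uminus: "sl2_stab (- a, - b, - c, - d) \<longleftrightarrow> sl2_stab (a, b, c, d)"
  by (simp add: sl2_stab_def sl2_lin_uminus)

lemma sl2_stab_inverse:
  assumes "sl2_stab (a, b, c, d)" "a * d - b * c = 1"
  shows "sl2_stab (d, - b, - c, a)"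
proof -
  obtain h where h: "h \<in> H" "represents n (sl2_lin (a, b, c, d)) h"
    using assms(1) unfolding sl2_stab_def by (elim bexE)
  have "d * a - - b * - c = 1" using assms(2) by (simp add: mult.commute)
  then obtain k where k: "k \<in> G" "represents n (sl2_lin (d, - b, - c, a)) k"
    by (rule sl2_in_G)
  have e: "d * a + - b * c = 1" "d * b + - b * d = 0" "- c * a + a * c = 0" "- c * b + a * d = 1"
    unfolding assms(2)[symmetric] by (simp_all add: mult.commute)
  have "sl2_lin (d, - b, - c, a) \<circ> sl2_lin (a, b, c, d) = sl2_lin (1, 0, 0, 1)"
    by (simp only: sl2_lin_comp e)
  moreover have "sl2_lin (1, 0, 0, 1) p = p" for p :: "'k vec7"
    by (cases p) simp
  then have "sl2_lin (1, 0, 0, 1) = (id :: 'k vec7 \<Rightarrow> _)" by (intro ext) (simp only: id_apply)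
  ultimately have "represents n id (k \<circ> h)"
    using represents_comp[OF k(2) h(2)] by (simp only:)
  then have "k \<circ> h = id" by (rule represents_unique[OF _ represents_id])
  then have "k \<in> H" by (rule H_inverse[OF h(1) k(1)])
  with k(2) show ?thesis unfolding sl2_stab_def by (intro bexI[of _ k])
qed

text \<open>A rotation commutes with the matrix of \<omega>, and all of SL(2, q) commutes with i.
  Thus it maps each of the two blocks to itself, and their lines stay the same.\<close>

lemma sl2_stab_rotation:
  assumes "x ^ 2 + y ^ 2 = 1"
  shows "sl2_stab (x, - y, y, x)"
proof -
  have "x * x - - y * y = 1" using assms by (simp add: power2_eq_square)
  then obtain r where r: "r \<in> G" "represents n (sl2_lin (x, - y, y, x)) r"
    by (rule sl2_in_G)
  have "sl2_lin (x, - y, y, x) \<circ> omega_lin = omega_lin \<circ> sl2_lin (x, - y, y, x)"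
    unfolding sl2_lin_omega[symmetric] sl2_lin_comp by simp
  then have rw: "r \<circ> ree_omega n = ree_omega n \<circ> r"
    using represents_comp[OF r(2) represents_omega] represents_comp[OF represents_omega r(2)]
    by (metis represents_unique)
  have "sl2_lin (x, - y, y, x) \<circ> sign_lin = sign_lin \<circ> sl2_lin (x, - y, y, x)"
    by (rule ext) auto
  then have rs: "r \<circ> sigma = sigma \<circ> r"
    using represents_comp[OF r(2) represents_sigma] represents_comp[OF represents_sigma r(2)]
    by (metis represents_unique)
  have inv: "r ` {p. f p = p} = {p. f p = p}" if f: "r \<circ> f = f \<circ> r" for f :: "'k ree_point \<Rightarrow> _"
  proof -
    have comm: "r (f p) = f (r p)" for p using fun_cong[OF f, of p] by simp
    have "p \<in> r ` {p. f p = p}" if "f p = p" for p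
    proof -
      obtain q where q: "p = r q" using G_bij[OF r(1)] by (metis bij_pointE)
      then have "r (f q) = r q" using that comm by simp
      then have "f q = q" using bij_is_inj[OF G_bij[OF r(1)]] by (simp add: inj_eq)
      with q show ?thesis by blast
    qed
    moreover have "f (r p) = r p" if "f p = p" for p
      using comm[of p] that by simp
    ultimately show ?thesis by blast
  qed
  have "image_line (g \<circ> r) r3_i = image_line g r3_i" "image_line (g \<circ> r) r3_w = image_line g r3_w" for g
    unfolding image_line_def image_comp[symmetric] lift_i lift_w by (simp_all only: inv[OF rs] inv[OF rw])
  then have "r \<in> H" using r(1) by (intro H_I) (simp_all add: meet_point)
  with r(2) show ?thesis unfolding sl2_stab_def by blast
qed

lemma sl2_stab_translation_1: "sl2_stab (1, 1, 0, 1)"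
  by (simp add: sl2_stab_translation_iff translation_H)

lemma sl2_stab_translation_uminus: "sl2_stab (1, b, 0, 1) \<Longrightarrow> sl2_stab (1, - b, 0, 1)"
  using sl2_stab_inverse[of 1 b 0 1] by simp

lemma sl2_stab_translation_add: "sl2_stab (1, a, 0, 1) \<Longrightarrow> sl2_stab (1, b, 0, 1) \<Longrightarrow> sl2_stab (1, a + b, 0, 1)"
  using sl2_stab_comp[of 1 a 0 1 1 b 0 1] by (simp add: add.commute)

text \<open>The rotation \<open>R\<close> by \<open>(c, s)\<close> satisfies \<open>R T(b) R = T(1) R' T(1)\<close> with another rotation \<open>R'\<close>.\<close>

lemma sl2_stab_translation_rotation:
  assumes cs: "c ^ 2 + s ^ 2 = 1" and b: "b * (c ^ 2 + c * s - s ^ 2) = - (c ^ 2 - c * s - s ^ 2)"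
  shows "sl2_stab (1, b, 0, 1)"
proof -
  \<comment> \<open>The matrix with rows \<open>(x, z)\<close> and \<open>(y, x)\<close> is T(-1) R
    T(b) R T(-1). The condition on \<open>b\<close> says, modulo 3, that \<open>z = - y\<close>,
    which makes it a rotation.\<close>
  define x y where "x = c ^ 2 - s ^ 2 + b * c * s - 2 * c * s - b * s ^ 2" and "y = 2 * c * s + b * s ^ 2"
  define z where "z = b * (c ^ 2 + s ^ 2) - 2 * (c ^ 2 - s ^ 2) - 2 * b * c * s"
  have "z + y = b * (c ^ 2 + c * s - s ^ 2) + (c ^ 2 - c * s - s ^ 2)
      + 3 * (b * s ^ 2 - c ^ 2 + s ^ 2 + c * s - b * c * s)"
    unfolding z_def y_def by (simp add: algebra_simps)
  then have zy: "z = - y" using b three by (simp add: add_eq_0_iff2)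
  have "x * x - z * y = (c ^ 2 + s ^ 2) ^ 2"
    unfolding x_def y_def z_def by algebra
  then have "x ^ 2 + y ^ 2 = 1" using cs zy by (simp add: power2_eq_square)
  then have r: "sl2_stab (x, z, y, x)" unfolding zy by (rule sl2_stab_rotation)
  have R: "sl2_stab (c, s, - s, c)" using sl2_stab_rotation[of c "- s"] cs by simp
  have "sl2_stab (1 * x + 1 * y, 1 * z + 1 * x, 0 * x + 1 * y, 0 * z + 1 * x)"
    by (rule sl2_stab_comp[OF sl2_stab_translation_1 r])
  then have "sl2_stab (x + y, z + x, y, x)" by simp
  from sl2_stab_comp[OF this sl2_stab_translation_1] have "sl2_stab (x + y, x + y + z + x, y, y + x)"
    by (simp add: add.assoc)
  moreover have "(c * (x + y) + s * y) * c + (c * (x + y + z + x) + s * (y + x)) * - s = (c ^ 2 + s ^ 2) ^ 2"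
    "(c * (x + y) + s * y) * s + (c * (x + y + z + x) + s * (y + x)) * c = b * (c ^ 2 + s ^ 2) ^ 2"
    "(- s * (x + y) + c * y) * c + (- s * (x + y + z + x) + c * (y + x)) * - s = 0"
    "(- s * (x + y) + c * y) * s + (- s * (x + y + z + x) + c * (y + x)) * c = (c ^ 2 + s ^ 2) ^ 2"
    unfolding x_def y_def z_def by algebra+
  ultimately have "sl2_stab ((c ^ 2 + s ^ 2) ^ 2, b * (c ^ 2 + s ^ 2) ^ 2, 0, (c ^ 2 + s ^ 2) ^ 2)"
    using sl2_stab_comp[OF sl2_stab_comp[OF R, of "x + y" "x + y + z + x" y "y + x"] R] by simp
  then show ?thesis by (simp add: cs)
qed

end

lemma card_image_two_to_one:
  assumes "finite A" and two: "\<And>x. x \<in> A \<Longrightarrow> \<exists>y\<in>A. y \<noteq> x \<and> f y = f x"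
  shows "2 * card (f ` A) \<le> card A"
proof -
  have "2 \<le> card {x \<in> A. f x = y}" if y: "y \<in> f ` A" for y
  proof -
    obtain x where x: "x \<in> A" "y = f x" using y by (rule imageE)
    obtain x' where "x' \<in> A" "x' \<noteq> x" "f x' = f x" using two[OF x(1)] by (elim bexE conjE)
    then have "{x, x'} \<subseteq> {x \<in> A. f x = y}" "card {x, x'} = 2" using x by auto
    then show ?thesis using card_mono[of "{x \<in> A. f x = y}" "{x, x'}"] assms(1) by simp
  qed
  then have "(\<Sum>y\<in>f ` A. 2) \<le> (\<Sum>y\<in>f ` A. card {x \<in> A. f x = y})"
    by (rule sum_mono)
  also have "\<dots> = (\<Sum>x\<in>A. 1)"
    using sum.image_gen[OF assms(1), of "\<lambda>_. 1 :: nat" f] by simp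
  finally show ?thesis by simp
qed

context ree_field
begin

text \<open>Factoring \<open>d ^ 2 - b ^ 2 = 1\<close> parametrizes these elements by
  \<open>g = d - b\<close>, with \<open>b = g - 1 / g\<close> in characteristic 3. The values
  \<open>g\<close> and \<open>- 1 / g\<close> yield the same \<open>b\<close> and differ because -1
  is not a square, so fewer than half of all elements occur.\<close>

lemma card_square_minus_one: "2 * card {b :: 'k. \<exists>d. b ^ 2 + 1 = d ^ 2} < CARD('k)"
proof -
  let ?f = "\<lambda>g :: 'k. g - 1 / g"
  have "{b :: 'k. \<exists>d. b ^ 2 + 1 = d ^ 2} \<subseteq> ?f ` (- {0})"
  proof
    fix b :: 'k assume "b \<in> {b. \<exists>d. b ^ 2 + 1 = d ^ 2}"
    then obtain d where "b ^ 2 + 1 = d ^ 2" by auto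
    then have gd: "(d - b) * (d + b) = 1" by (simp add: algebra_simps power2_eq_square)
    then have "d - b \<noteq> 0" by auto
    moreover have "1 / (d - b) = d + b" using gd calculation by (simp add: field_simps)
    moreover have "(d - b) - (d + b) = b - 3 * b" by (simp add: algebra_simps)
    then have "b = (d - b) - (d + b)" using three by simp
    ultimately show "b \<in> ?f ` (- {0})" by (intro image_eqI[of _ _ "d - b"]) simp_all
  qed
  then have "2 * card {b :: 'k. \<exists>d. b ^ 2 + 1 = d ^ 2} \<le> 2 * card (?f ` (- {0}))"
    by (simp add: card_mono)
  also have "\<dots> \<le> card (- {0 :: 'k})"
  proof (rule card_image_two_to_one)
    fix x :: 'k assume "x \<in> - {0}"
    then have x: "x \<noteq> 0" by simp
    have "- (1 / x) \<noteq> x"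
    proof
      assume "- (1 / x) = x"
      then have "- 1 = x * x" using x by (simp add: field_simps)
      then show False using square_neq_minus_one[of x] by (simp add: power2_eq_square)
    qed
    with x show "\<exists>y\<in>- {0}. y \<noteq> x \<and> ?f y = ?f x"
      by (intro bexI[of _ "- (1 / x)"]) simp_all
  qed simp
  also have "\<dots> < CARD('k)" by (rule psubset_card_mono) auto
  finally show ?thesis .
qed

end

context ree_embedding
begin

text \<open>The condition of \<open>sl2_stab_translation_rotation\<close> is quadratic in the slope
  t = s / c of the rotation, with discriminant \<open>- (b ^ 2 + 1)\<close> in characteristic 3.
  This is a square because \<open>b ^ 2 + 1\<close> is not. The values 1 and -1 of \<open>b\<close>,
  where the argument degenerates, belong to translations already known.\<close>

lemma sl2_stab_translation_nonsquare:
  assumes b: "\<nexists>d. b ^ 2 + 1 = d ^ 2"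
  shows "sl2_stab (1, b, 0, 1)"
proof -
  consider "b = -1" | "b = 1" | "b \<noteq> -1" "b \<noteq> 1" by blast
  then show ?thesis
  proof cases
    case 1
    then show ?thesis using sl2_stab_translation_uminus[OF sl2_stab_translation_1] by simp
  next
    case 2
    then show ?thesis using sl2_stab_translation_1 by simp
  next
    case 3
    then have b1: "b + 1 \<noteq> 0" by (simp add: add_eq_0_iff2)
    obtain e where "b ^ 2 + 1 = e ^ 2 \<or> b ^ 2 + 1 = - (e ^ 2)"
      by (rule square_or_minus_square)
    with b have e: "e ^ 2 = - (b ^ 2 + 1)" by auto
    \<comment> \<open>A root of \<open>(b + 1) * (t ^ 2 - 1) = (b - 1) * t\<close>; the denominator
      2 of the quadratic formula is -1.\<close>
    define t where "t = - ((b - 1 + e) / (b + 1))"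
    have t1: "(b + 1) * t = - (b - 1 + e)" using b1 by (simp add: t_def)
    have "(b + 1) * ((b + 1) * (t ^ 2 - 1) - (b - 1) * t)
        = ((b + 1) * t) ^ 2 - (b - 1) * ((b + 1) * t) - (b + 1) ^ 2"
      by (simp add: algebra_simps power2_eq_square)
    also have "\<dots> = e ^ 2 + 3 * ((b - 1) * (b - 1 + e)) - (b - 1) ^ 2 - (b + 1) ^ 2"
      unfolding t1 by (simp add: algebra_simps power2_eq_square)
    also have "\<dots> = - 3 * (b ^ 2 + 1)"
      unfolding e three by (simp add: algebra_simps power2_eq_square three)
    finally have "(b + 1) * (t ^ 2 - 1) - (b - 1) * t = 0"
      using b1 three by simp
    then have rel: "(b + 1) * (t ^ 2 - 1) = (b - 1) * t" by simp
    obtain k where k: "1 + t ^ 2 = k ^ 2 \<or> 1 + t ^ 2 = - (k ^ 2)"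
      by (rule square_or_minus_square)
    have k0: "k \<noteq> 0"
      using k sum_squares_eq_0_iff[of 1 t] by auto
    have rotation: "sl2_stab (1, b', 0, 1)"
      if "1 + t' ^ 2 = k' ^ 2" "k' \<noteq> 0" "b' * (1 + t' - t' ^ 2) = - (1 - t' - t' ^ 2)" for b' t' k'
    proof (rule sl2_stab_translation_rotation)
      have "(1 / k') ^ 2 + (t' / k') ^ 2 = (1 + t' ^ 2) / k' ^ 2"
        by (simp add: power_divide add_divide_distrib)
      then show "(1 / k') ^ 2 + (t' / k') ^ 2 = 1" using that by simp
      have "b' * ((1 / k') ^ 2 + 1 / k' * (t' / k') - (t' / k') ^ 2) = b' * (1 + t' - t' ^ 2) / k' ^ 2"
        by (simp add: power2_eq_square add_divide_distrib diff_divide_distrib algebra_simps)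
      also have "\<dots> = - ((1 / k') ^ 2 - 1 / k' * (t' / k') - (t' / k') ^ 2)"
        unfolding that(3)
        by (simp add: power2_eq_square add_divide_distrib diff_divide_distrib algebra_simps)
      finally show "b' * ((1 / k') ^ 2 + 1 / k' * (t' / k') - (t' / k') ^ 2)
          = - ((1 / k') ^ 2 - 1 / k' * (t' / k') - (t' / k') ^ 2)" .
    qed
    from k show ?thesis
    proof
      assume k: "1 + t ^ 2 = k ^ 2"
      have "b * (1 + t - t ^ 2) + (1 - t - t ^ 2) = - ((b + 1) * (t ^ 2 - 1) - (b - 1) * t)"
        by (simp add: algebra_simps)
      then show ?thesis
        using k k0 rel by (intro rotation[of t k]) (simp_all add: add_eq_0_iff2)
    next
      assume k: "1 + t ^ 2 = - (k ^ 2)"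
      have t0: "1 + t \<noteq> 0"
      proof
        assume "1 + t = 0"
        then have "t = -1" by (metis add.commute add_eq_0_iff2)
        with rel have "b - 1 = 0" by simp
        with 3 show False by simp
      qed
      \<comment> \<open>No rotation has slope \<open>t\<close> when \<open>1 + t ^ 2\<close> is not
        a square. Replacing \<open>t\<close> by \<open>t'\<close> multiplies
        \<open>1 + t ^ 2\<close> by 2 = -1 up to squares, and turns the condition for
        \<open>b\<close> into that for \<open>- b\<close>.\<close>
      define t' where "t' = (1 - t) / (1 + t)"
      have t': "(1 + t) * t' = 1 - t" using t0 by (simp add: t'_def)
      have "sl2_stab (1, - b, 0, 1)"
      proof (rule rotation)
        have "(1 + t) ^ 2 * (1 + t' ^ 2) = (1 + t) ^ 2 + ((1 + t) * t') ^ 2"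
          by (simp add: algebra_simps power2_eq_square)
        also have "\<dots> = 3 * (1 + t ^ 2) - (1 + t ^ 2)"
          unfolding t' by (simp add: algebra_simps power2_eq_square)
        also have "\<dots> = k ^ 2" unfolding k three by simp
        finally show "1 + t' ^ 2 = (k / (1 + t)) ^ 2"
          using t0 by (simp add: power_divide eq_divide_eq mult.commute)
        show "k / (1 + t) \<noteq> 0" using k0 t0 by simp
        have "(1 + t) ^ 2 * (- b * (1 + t' - t' ^ 2) + (1 - t' - t' ^ 2))
            = - b * ((1 + t) ^ 2 + (1 + t) * ((1 + t) * t') - ((1 + t) * t') ^ 2)
              + ((1 + t) ^ 2 - (1 + t) * ((1 + t) * t') - ((1 + t) * t') ^ 2)"
          by (simp add: algebra_simps power2_eq_square)
        also have "\<dots> = (b + 1) * (t ^ 2 - 1) - (b - 1) * t + 3 * (t - b * t)"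
          unfolding t' by (simp add: algebra_simps power2_eq_square)
        also have "\<dots> = 0" unfolding rel three by simp
        finally have "- b * (1 + t' - t' ^ 2) + (1 - t' - t' ^ 2) = 0" using t0 by simp
        then show "- b * (1 + t' - t' ^ 2) = - (1 - t' - t' ^ 2)" by (simp add: add_eq_0_iff2)
      qed
      then show ?thesis using sl2_stab_translation_uminus by fastforce
    qed
  qed
qed

text \<open>More than half of the field satisfies the nonsquare condition, so every element is a sum
  of two such elements.\<close>

lemma sl2_stab_translation: "sl2_stab (1, b, 0, 1)"
proof -
  let ?N = "{b. \<exists>d :: 'k. b ^ 2 + 1 = d ^ 2}"
  have "?N \<union> (\<lambda>a. b - a) ` ?N \<noteq> UNIV"
  proof
    assume eq: "?N \<union> (\<lambda>a. b - a) ` ?N = UNIV"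
    have "card (?N \<union> (\<lambda>a. b - a) ` ?N) \<le> card ?N + card ((\<lambda>a. b - a) ` ?N)"
      by (rule card_Un_le)
    also have "\<dots> \<le> 2 * card ?N" using card_image_le[of ?N "\<lambda>a. b - a"] by simp
    finally show False using card_square_minus_one unfolding eq by simp
  qed
  then obtain a where "a \<notin> ?N" "a \<notin> (\<lambda>a. b - a) ` ?N" by blast
  moreover have "b - a \<notin> ?N"
  proof
    assume "b - a \<in> ?N"
    then have "b - (b - a) \<in> (\<lambda>a. b - a) ` ?N" by (rule imageI)
    with \<open>a \<notin> (\<lambda>a. b - a) ` ?N\<close> show False by simp
  qed
  ultimately have "sl2_stab (1, a + (b - a), 0, 1)"
    by (intro sl2_stab_translation_add sl2_stab_translation_nonsquare) simp_all
  then show ?thesis by simp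
qed

text \<open>A product of three matrices T(s) \<omega>, with s running through t, 1 / t, t, is the
  diagonal matrix up to sign.\<close>

lemma sl2_stab_diagonal:
  assumes t: "t \<noteq> 0"
  shows "sl2_stab (t, 0, 0, 1 / t)"
proof -
  have *: "sl2_stab (s, -1, 1, 0)" for s
    using sl2_stab_comp[OF sl2_stab_translation sl2_stab_omega, of s] by simp
  have "sl2_stab (t * (1 / t) - 1, - t, 1 / t, - 1)"
    using sl2_stab_comp[OF * *, of t "1 / t"] by simp
  then have "sl2_stab (0, - t, 1 / t, - 1)" using t by simp
  from sl2_stab_comp[OF this *, of t] have "sl2_stab (- t, - 0, - 0, - (1 / t))" using t by simp
  then show ?thesis unfolding sl2_stab_uminus .
qed

section \<open>Two blocks of the orbit through a common point\<close>

lemma representsD: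
  "represents n L g \<Longrightarrow> \<exists>c. c \<noteq> 0 \<and> L (ree_vec n p) = scale7 c (ree_vec n (g p))"
  by (simp only: represents_def)

text \<open>At a fixed point the norm \<open>w\<close> is an eigenvalue of \<open>omega_lin\<close>,
  hence 1 or -1; the claim says that 1 does not occur. It removes one unknown when coordinates are
  compared in the final computation.\<close>

lemma fixed_by_omega:
  fixes x y z :: 'k
  assumes fixed: "ree_omega n (Some (x, y, z)) = Some (x, y, z)"
  shows "ree_v n x y z = x"
proof -
  define u v w where "u = ree_u n x y z" and "v = ree_v n x y z" and "w = ree_w n x y z"
  have nz: "(x, y, z) \<noteq> (0, 0, 0)"
    using fixed by (auto simp: ree_omega_def)
  then have w0: "w \<noteq> 0" by (auto simp: w_def ree_w_eq_0_iff)
  have xyz: "x = - v / w" "y = - u / w" "z = - z / w"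
    using fixed nz unfolding u_def v_def w_def by (auto simp: ree_omega_def split: if_splits)
  then have v: "v = - (w * x)" and u: "u = - (w * y)" and z: "(w + 1) * z = 0"
    using w0 by (simp_all add: field_simps)
  show ?thesis
  proof (cases "z = 0")
    case False
    then have "w = -1" using z by (simp add: add_eq_0_iff2)
    then show ?thesis using v by (simp add: v_def)
  next
    case True
    have "w = x * v + y * u"
      using ree_w_eq[of x y z] by (simp only: True u_def v_def w_def) simp
    then have "w = x * (- (w * x)) + y * (- (w * y))" using u v by metis
    moreover have "w * (x ^ 2 + y ^ 2 + 1) = w - (x * (- (w * x)) + y * (- (w * y)))"
      by (simp add: algebra_simps power2_eq_square)
    ultimately have "w * (x ^ 2 + y ^ 2 + 1) = 0" by (metis diff_self)
    then have circle: "x ^ 2 + y ^ 2 = -1" using w0 by (simp add: add_eq_0_iff2)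
    have "ree_w n (- v / w) (- u / w) (- z / w) = 1 / w"
      unfolding u_def v_def w_def by (rule ree_omega_coordinates(3)[OF w0[unfolded w_def]])
    then have "w = 1 / w"
      by (simp only: xyz[symmetric] w_def[symmetric])
    then have "w * w = 1" using w0 by (simp add: field_simps)
    then have "w = 1 \<or> w = -1" by (rule square_eq_1_iff[THEN iffD1])
    moreover have "w \<noteq> 1"
    proof
      assume "w = 1"
      define X Y where "X = tw x" and "Y = tw y"
      have u': "Y = X * x ^ 3 - x ^ 2 * y - y" and v': "X * Y + x * y ^ 2 - X ^ 2 * x ^ 3 = - x"
        using u v unfolding \<open>w = 1\<close> u_def v_def ree_u_def ree_v_def X_def Y_def True
        by (simp_all add: algebra_simps)
      have "X * y ^ 3 - x ^ 3 = X * Y + x * y ^ 2 - X ^ 2 * x ^ 3 + x - x * (x ^ 2 + y ^ 2 + 1)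
          + X * y * (x ^ 2 + y ^ 2 + 1)"
        unfolding u' by (simp add: algebra_simps power2_eq_square power3_eq_cube)
      then have cube: "X * y ^ 3 = x ^ 3" unfolding v' circle by simp
      have "tw (X * y ^ 3) = tw (x ^ 3)" unfolding cube ..
      then have "(x * Y) ^ 3 = X ^ 3" by (simp add: tw_simps X_def Y_def power_mult_distrib)
      then have "(X + - (x * Y)) ^ 3 = 0"
        unfolding cube_add_char3[OF three] by (simp add: power3_eq_cube)
      then have X: "X = x * Y" by simp
      have "x \<noteq> 0"
      proof
        assume "x = 0"
        then have "y ^ 2 = -1" using circle by simp
        then show False using square_neq_minus_one by blast
      qed
      have "x * (Y * y ^ 3 - x ^ 2) = 0"
        using cube unfolding X by (simp add: algebra_simps power2_eq_square power3_eq_cube)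
      then have Yy: "Y * y ^ 3 = x ^ 2" using \<open>x \<noteq> 0\<close> by simp
      have "Y - X * x ^ 3 + x ^ 2 * y + y = - ((X * x ^ 3 - x ^ 2 * y - y) - Y)"
        by (simp add: algebra_simps)
      then have u0: "Y - (x * Y) * x ^ 3 + x ^ 2 * y + y = 0"
        using u' unfolding X by (metis diff_self minus_zero)
      have "Y - Y * x ^ 4 - y ^ 3 = (Y - (x * Y) * x ^ 3 + x ^ 2 * y + y) - y * (x ^ 2 + y ^ 2 + 1)"
        by (simp add: algebra_simps power2_eq_square power3_eq_cube power4_eq_xxxx)
      also have "\<dots> = 0" unfolding u0 circle by simp
      finally have "(Y - Y * x ^ 4 - y ^ 3) * y ^ 3 = 0" by simp
      moreover have "(Y - Y * x ^ 4 - y ^ 3) * y ^ 3 = Y * y ^ 3 - (Y * y ^ 3) * x ^ 4 - (y ^ 2) ^ 3"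
        by (simp add: algebra_simps power2_eq_square power3_eq_cube power4_eq_xxxx)
      moreover have "x ^ 2 * x ^ 4 = (x ^ 2) ^ 3"
        by (simp add: power2_eq_square power3_eq_cube power4_eq_xxxx mult_ac)
      ultimately have "x ^ 2 - (x ^ 2) ^ 3 - (y ^ 2) ^ 3 = 0" unfolding Yy by simp
      then have "x ^ 2 = (x ^ 2) ^ 3 + (y ^ 2) ^ 3" by (metis diff_diff_eq right_minus_eq)
      then have "x ^ 2 = (x ^ 2 + y ^ 2) ^ 3"
        by (simp only: cube_add_char3[OF three])
      then have "x ^ 2 = -1" unfolding circle by (simp add: power3_eq_cube)
      then show False using square_neq_minus_one by blast
    qed
    ultimately have "w = -1" by simp
    then show ?thesis using v by (simp add: v_def)
  qed
qed

text \<open>Consequently the line of the block through \<open>(0, b, z)\<close> and \<open>(0, b, -z)\<close> contains the meeting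
  point: the stabilizer \<open>H\<close> maps a block with this property to it.\<close>

lemma vertical_block:
  assumes z: "z \<noteq> (0 :: 'k)"
  obtains h t where "h \<in> H" "t \<noteq> 0" "t ^ 2 = tw z / z"
    "represents n (sl2_lin (t, b / t - t, 0, 1 / t)) h"
    "Some (0, b, z) \<in> h ` {p. ree_omega n p = p}" "Some (0, b, - z) \<in> h ` {p. ree_omega n p = p}"
proof -
  obtain s where s: "z = s ^ 2 \<or> z = - (s ^ 2)" by (rule square_or_minus_square)
  then have s0: "s \<noteq> 0" using z by auto
  \<comment> \<open>The diagonal matrix with entries t and 1 / t moves \<open>(0, 0, 1)\<close> to
    \<open>(0, 0, t * tw t)\<close>, so \<open>t * tw t\<close> has to be \<open>z\<close> up to
    sign. Then \<open>h\<close> is this matrix preceded by T(-1), which brings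
    \<open>(0, 1, 1)\<close> and \<open>(0, 1, -1)\<close> to height 0, and followed by
    T(b).\<close>
  define t where "t = tw s / s"
  have t0: "t \<noteq> 0" using s0 by (simp add: t_def)
  have t2: "t ^ 2 = tw z / z"
    using s by (auto simp: t_def power_divide tw_uminus tw_power)
  have "t * tw t = s ^ 2"
    using s0 by (simp add: t_def tw_simps power2_eq_square power3_eq_cube)
  with s have zt: "z = t * tw t \<or> z = - (t * tw t)" by simp
  have "sl2_stab (t, b / t, 0, 1 / t)"
    using sl2_stab_comp[OF sl2_stab_translation[of b] sl2_stab_diagonal[OF t0]] by simp
  from sl2_stab_comp[OF this sl2_stab_translation[of "-1"]] have "sl2_stab (t, b / t - t, 0, 1 / t)"
    by simp
  then obtain h where h: "h \<in> H" "represents n (sl2_lin (t, b / t - t, 0, 1 / t)) h"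
    unfolding sl2_stab_def by (elim bexE)
  have image: "h (Some (0, 1, e)) = Some (0, b, e * (t * tw t))" if "e \<in> {1, -1}" for e
  proof (rule represents_eqI[OF _ h(2)])
    have e: "e * e = 1" "tw e = e" using that by (auto simp: tw_uminus)
    have e3: "e * (e * w) = w" for w using e by (simp flip: mult.assoc)
    have "tw (t * tw t) = tw t * t ^ 3" by (simp add: tw_simps)
    then show "sl2_lin (t, b / t - t, 0, 1 / t) (ree_vec n (Some (0, 1, e)))
        = scale7 (1 / (t * tw t)) (ree_vec n (Some (0, b, e * (t * tw t))))"
      using t0 e three
      by (simp add: ree_u_def ree_v_def ree_w_def tw_mult tw_divide tw_diff)
        (simp add: field_simps power2_eq_square power3_eq_cube e e3 ch3)
  qed
  have fixed: "Some (0, 1, e) \<in> {p. ree_omega n p = p}" if "e \<in> {1, -1}" for e :: 'k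
    using that three by (auto simp: ree_omega_def ree_u_def ree_v_def ree_w_def tw_uminus power2_eq_square ch3)
  have block: "Some (0, b, e * (t * tw t)) \<in> h ` {p. ree_omega n p = p}" if "e \<in> {1, -1}" for e
    using imageI[OF fixed[OF that], of h] unfolding image[OF that] .
  have "Some (0, b, t * tw t) \<in> h ` {p. ree_omega n p = p}"
    "Some (0, b, - (t * tw t)) \<in> h ` {p. ree_omega n p = p}"
    using block[of 1] block[of "-1"] by (simp_all only: insert_iff simp_thms mult_1_left mult_minus1)
  with zt have "Some (0, b, z) \<in> h ` {p. ree_omega n p = p}"
    "Some (0, b, - z) \<in> h ` {p. ree_omega n p = p}"
    by (elim disjE; simp only: minus_minus)+
  with h(1) t0 t2 h(2) show ?thesis by (rule that)
qed

text \<open>Undoing the two outer translations of \<open>cyc\<close> turns \<open>(0, b, z)\<close>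
  into \<open>(-1, b, z + b + 1)\<close>. Then \<omega> produces first coordinate 0 exactly if
  \<open>v\<close> vanishes there, which is \<open>rel\<close> in characteristic 3, and the inner
  translations keep this coordinate. The preimage is thus a point to which
  \<open>vertical_block\<close> applies.\<close>

lemma cyc_preimage:
  fixes b z :: 'k
  assumes rel: "tw z - b * z = b + tw b"
  obtains y1 z1 where "cyc (Some (0, y1, z1)) = Some (0, b, z)"
proof -
  have ww: "ree_omega n (ree_omega n p) = p" for p :: "'k ree_point"
    using fun_cong[OF omega_omega, of p] by simp
  have v: "ree_v n (-1) b (z + b + 1) = 0"
  proof -
    have "ree_v n (-1) b (z + b + 1) = - (tw z - b * z - b - tw b) - 3 * tw b"
      by (simp add: ree_v_def tw_uminus tw_add algebra_simps power2_eq_square power3_eq_cube)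
    also have "\<dots> = 0" using rel three by simp
    finally show ?thesis .
  qed
  define y2 z2 where "y2 = - ree_u n (-1) b (z + b + 1) / ree_w n (-1) b (z + b + 1)"
    and "z2 = - (z + b + 1) / ree_w n (-1) b (z + b + 1)"
  have w: "ree_omega n (Some (-1, b, z + b + 1)) = Some (0, y2, z2)"
    by (simp only: ree_omega_def option.case prod.case v y2_def z2_def) simp
  have "ree_omega n (Some (0, y2, z2)) = Some (-1, b, z + b + 1)"
    unfolding w[symmetric] by (rule ww)
  then have "cyc (Some (0, y2 - 1 - 1, z2 - 1)) = Some (0, b, z)"
    by (simp add: cyc_def ree_translation_def ree_mult_def)
  then show ?thesis by (rule that)
qed

text \<open>The blocks \<open>?B\<close> and \<open>?B'\<close> are images of the block of \<omega>
  under \<open>H\<close>, so their lines contain \<open>meet_point id\<close>; both pass through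
  \<open>?q\<close>. If they differ, the meeting point is the image of \<open>?q\<close>, which is
  impossible because \<open>?q\<close> is not on the block of i. If they agree, \<open>?B\<close>
  also contains the image of \<open>?q\<close> under i \<omega>, and comparing coordinates makes
  \<open>1 - b ^ 2\<close> a square.\<close>

lemma not_embedded:
  fixes b z :: 'k
  assumes b0: "b \<noteq> 0" and rel: "tw z - b * z = b + tw b" and nonsquare: "\<nexists>d. 1 - b ^ 2 = d ^ 2"
  shows False
proof -
  let ?F = "{p. ree_omega n p = p} :: 'k ree_point set"
  let ?q = "Some (0, b, z)"
  have bB: "b + tw b \<noteq> 0"
    using b0 tw_eq_minus_self[of b] by (auto simp: add_eq_0_iff)
  have z0: "z \<noteq> 0" using rel bB by auto
  define v w where "v = b * z - tw z" and "w = b * tw b + z ^ 2"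
  have v: "v = - (b + tw b)" using rel unfolding v_def by (metis minus_diff_eq)
  have vw: "ree_u n 0 b z = tw b" "ree_v n 0 b z = v" "ree_w n 0 b z = w"
    by (simp_all add: ree_u_def ree_v_def ree_w_def v_def w_def algebra_simps)
  have w0: "w \<noteq> 0"
    using ree_w_eq_0_iff[of 0 b z] z0 by (simp add: vw)
  let ?r = "Some (v / w, - tw b / w, z / w)"
  have r: "sigma (ree_omega n ?q) = ?r"
    using z0 by (simp add: ree_omega_def vw)
  obtain y1 z1 where q1: "cyc (Some (0, y1, z1)) = ?q"
    by (rule cyc_preimage[OF rel])
  \<comment> \<open>The two points with opposite third coordinates are exchanged by i, and
    \<open>cyc\<close> carries i to i \<omega>.\<close>
  have cyc_q1: "cyc (Some (0, y1, - z1)) = ?r"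
    using fun_cong[OF cyc_sigma, of "Some (0, y1, z1)"] q1 r by simp
  have z1: "z1 \<noteq> 0"
  proof
    assume "z1 = 0"
    then have "?r = ?q" using cyc_q1 q1 by simp
    then have "v = 0" using w0 by simp
    then show False using v bB by (metis neg_equal_0_iff_equal)
  qed
  obtain h t where h: "h \<in> H" "t \<noteq> 0" "t ^ 2 = tw z / z"
    "represents n (sl2_lin (t, b / t - t, 0, 1 / t)) h" "?q \<in> h ` ?F"
    by (rule vertical_block[OF z0])
  obtain h1 where h1: "h1 \<in> H" "Some (0, y1, z1) \<in> h1 ` ?F" "Some (0, y1, - z1) \<in> h1 ` ?F"
    by (rule vertical_block[OF z1])
  have on: "incident P (meet_point id) (\<psi> (g ` ?F))" and line: "g ` ?F \<in> unital_lines" if "g \<in> H" for g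
  proof -
    have "meet_point g = meet_point id" using H_meet_point[OF that G_id] by simp
    then show "incident P (meet_point id) (\<psi> (g ` ?F))"
      using meet_point(3)[OF H_G[OF that]] by (simp add: image_line_def lift_w)
    show "g ` ?F \<in> unital_lines" by (rule line_image[OF H_G[OF that] omega_line])
  qed
  let ?B = "h ` ?F" and ?B' = "(cyc \<circ> h1) ` ?F"
  have ch1: "cyc \<circ> h1 \<in> H" by (rule H_comp[OF cyc_H h1(1)])
  have q_B': "?q \<in> ?B'" "?r \<in> ?B'"
    using imageI[OF h1(2), of cyc] imageI[OF h1(3), of cyc]
    by (simp_all only: q1 cyc_q1 image_comp[symmetric])
  have "?B = ?B'"
  proof (rule ccontr)
    assume "?B \<noteq> ?B'"
    then have "meet_point id = \<phi> ?q"
      using on line h(1,5) ch1 q_B'(1)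
      by (intro projective_plane_point_unique[OF plane emb_simps(3)[OF line[OF h(1)]] emb_simps(3)[OF line[OF ch1]]
            _ meet_point(1)[OF G_id] on[OF h(1)] on[OF ch1] emb_simps(2)])
        (simp_all only: emb_simps(1,5) simp_thms not_False_eq_True)
    moreover have "incident P (meet_point id) (\<psi> {p. sigma p = p})"
      using meet_point(2)[OF G_id] by (simp add: image_line_def lift_i)
    ultimately have "?q \<in> {p. sigma p = p}"
      by (simp only: emb_simps(1)[OF sigma_line])
    then have "- z = z" by simp
    then have "z + z = 0" by (metis add.left_inverse)
    then have "z * (1 - (-1)) = 0" by (simp add: algebra_simps)
    then show False using z0 one_neq_minus_one by simp
  qed
  with q_B' have "?r \<in> h ` ?F" by (simp only:)
  then obtain s where "?r = h s" "s \<in> ?F" by (rule imageE)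
  then have s: "ree_omega n s = s" "h s = ?r" by simp_all
  obtain x' y' z' where s': "s = Some (x', y', z')"
    using s(1) by (cases s) (auto simp: ree_omega_def)
  have v': "ree_v n x' y' z' = x'" using s(1) unfolding s' by (rule fixed_by_omega)
  obtain d where d: "d \<noteq> 0" "sign_lin (omega_lin (ree_vec n ?q)) = scale7 d (ree_vec n ?r)"
    using representsD[OF represents_comp[OF represents_sigma represents_omega], of ?q]
    unfolding comp_apply r by (elim exE conjE)
  obtain e where e: "e \<noteq> 0" "sl2_lin (t, b / t - t, 0, 1 / t) (ree_vec n s) = scale7 e (ree_vec n ?r)"
    using representsD[OF h(4), of s] unfolding s(2) by (elim exE conjE)
  define k where "k = e / d"
  have k: "k \<noteq> 0" using d e by (simp add: k_def)
  have "sl2_lin (t, b / t - t, 0, 1 / t) (ree_vec n s) = scale7 k (sign_lin (omega_lin (ree_vec n ?q)))"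
    unfolding d(2) scale7_scale7 e(2) using d(1) by (simp add: k_def)
  \<comment> \<open>Only the coordinates \<open>x\<close>, \<open>z\<close> and \<open>v\<close> are
    compared, since \<open>sl2_lin\<close> maps them among themselves. The right side of the third
    equation is the first coordinate of \<open>?q\<close>, which is 0.\<close>
  then have e1: "(1 / t) ^ 2 * x' = k * v" and e2: "(b / t - t) * (1 / t) * x' + z' = k * z"
    and e3: "- ((b / t - t) ^ 2) * x' + t * (b / t - t) * z' + t ^ 2 * x' = 0"
    using h(2) v' by (simp_all add: s' vw)
  have x': "x' = k * v * t ^ 2"
    using e1 h(2) by (simp add: field_simps power2_eq_square)
  define r where "r = b / t - t"
  have tr: "t * r = b - t ^ 2"
    using h(2) by (simp add: r_def algebra_simps power2_eq_square)
  have rx: "r * (1 / t) * x' = (t * r) * (k * v)"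
    unfolding x' using h(2) by (simp add: power2_eq_square)
  have "z' = k * z - r * (1 / t) * x'"
    using e2 unfolding r_def[symmetric] by (metis add_diff_cancel_left')
  then have z': "z' = k * z - (b - t ^ 2) * (k * v)"
    unfolding rx tr .
  have "- (r ^ 2) * x' + (t * r) * z' + t ^ 2 * x' = - ((t * r) ^ 2) * (k * v) + (t * r) * z' + t ^ 4 * (k * v)"
    unfolding x' by (simp add: algebra_simps power2_eq_square power4_eq_xxxx)
  then have eq: "- ((b - t ^ 2) ^ 2) * (k * v) + (b - t ^ 2) * z' + t ^ 4 * (k * v) = 0"
    using e3 unfolding r_def[symmetric] tr by metis
  \<comment> \<open>Here \<open>m = tw z / z\<close>. Multiplying the equation by
    \<open>z ^ 2\<close> below expresses it through \<open>v\<close>, \<open>z\<close> and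
    \<open>tw z\<close> alone.\<close>
  define m where "m = t ^ 2"
  have bm: "z * (b - m) = v" and zm: "z * m = tw z"
    using z0 by (simp_all add: m_def h(3) v_def algebra_simps)
  have "k * (- ((b - m) ^ 2 * v) * 2 + (b - m) * z + m ^ 2 * v) = 0"
    using eq unfolding z' m_def by algebra
  then have eq0: "- ((b - m) ^ 2 * v) * 2 + (b - m) * z + m ^ 2 * v = 0"
    using k by simp
  have "z ^ 2 * (- ((b - m) ^ 2 * v) * 2 + (b - m) * z + m ^ 2 * v) =
    - ((z * (b - m)) ^ 2 * v) * 2 + z * (b - m) * z ^ 2 + (z * m) ^ 2 * v"
    by algebra
  then have "- (v ^ 2 * v) * 2 + v * z ^ 2 + tw z ^ 2 * v = 0"
    unfolding eq0 bm zm by simp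
  then have "v * (v ^ 2 + z ^ 2 + tw z ^ 2 - 3 * v ^ 2) = 0" by algebra
  moreover have v0: "v \<noteq> 0" using v bB by (metis neg_equal_0_iff_equal)
  ultimately have "v ^ 2 + z ^ 2 + tw z ^ 2 = 0" using three by simp
  moreover have "tw z = b * z - v" by (simp add: v_def)
  ultimately have sum: "v ^ 2 + z ^ 2 + (b * z - v) ^ 2 = 0" by simp
  \<comment> \<open>Completing the square in the quadratic equation for \<open>z\<close>.\<close>
  have "((b ^ 2 + 1) * z - b * v) ^ 2 =
      (b ^ 2 + 1) * (v ^ 2 + z ^ 2 + (b * z - v) ^ 2) - 3 * v ^ 2 + (1 - b ^ 2) * v ^ 2"
    by algebra
  then have "((b ^ 2 + 1) * z - b * v) ^ 2 = (1 - b ^ 2) * v ^ 2"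
    unfolding sum three by simp
  then have "1 - b ^ 2 = (((b ^ 2 + 1) * z - b * v) / v) ^ 2"
    using v0 by (simp add: power_divide)
  then show False using nonsquare by blast
qed

text \<open>It remains to find a nonzero \<open>b\<close> such that neither \<open>b\<close> nor
  \<open>1 - b ^ 2\<close> is a square. The first condition makes the additive map
  \<open>\<lambda>z. tw z - b * z\<close> bijective and so yields \<open>z\<close>; the second
  contradicts \<open>not_embedded\<close>.\<close>

lemma no_ree_embedding:
  assumes n: "n > 0"
  shows False
proof -
  have sq: "(- (s ^ 2) :: 'k) \<noteq> r ^ 2" if "s \<noteq> 0" for r s
  proof
    assume "- (s ^ 2) = r ^ 2"
    then have "r ^ 2 = - (s ^ 2)" by (rule sym)
    with that have "(r / s) ^ 2 = -1"
      by (simp only: power_divide) (simp add: divide_eq_minus_1_iff)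
    then show False using square_neq_minus_one by blast
  qed
  have "card {0, 1, -1 :: 'k} \<le> 3" by (simp add: card_insert_if)
  also have "(3 :: nat) < CARD('k)"
    unfolding card using n power_strict_increasing[of 1 "2 * n + 1" "3 :: nat"] by simp
  finally have "{0, 1, -1 :: 'k} \<noteq> UNIV" by (metis less_irrefl)
  then obtain e :: 'k where e: "e \<noteq> 0" "e \<noteq> 1" "e \<noteq> -1" by blast
  \<comment> \<open>A nonsquare outside the prime field. Passing from \<open>b1\<close> to
    \<open>1 / b1\<close> multiplies \<open>1 - b1 ^ 2\<close> by -1 up to squares, so one of the
    two works once \<open>1 - b1 ^ 2\<close> is nonzero.\<close>
  define b1 where "b1 = - (e ^ 2)"
  have b1: "b1 \<noteq> 0" using e by (simp add: b1_def)
  have ne: "1 - b1 ^ 2 \<noteq> 0"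
  proof
    assume "1 - b1 ^ 2 = 0"
    then have "(1 - e) * (1 + e) * (1 + e ^ 2) = 0"
      unfolding b1_def by algebra
    moreover have "1 + e ^ 2 \<noteq> 0"
      using sum_squares_eq_0_iff[of 1 e] by simp
    moreover have "1 + e \<noteq> 0" using e(3) by (metis add.commute add_eq_0_iff2)
    ultimately show False using e(2) by simp
  qed
  obtain b :: 'k where b: "b \<noteq> 0" "\<And>s. b \<noteq> s ^ 2" "\<nexists>d. 1 - b ^ 2 = d ^ 2"
  proof (cases "\<exists>d. 1 - b1 ^ 2 = d ^ 2")
    case False
    then show ?thesis using that[of b1] b1 sq[OF e(1)] by (auto simp: b1_def)
  next
    case True
    then obtain d where d: "1 - b1 ^ 2 = d ^ 2" by blast
    with ne have "d \<noteq> 0" by auto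
    have "1 / b1 = - ((1 / e) ^ 2)" by (simp add: b1_def power_divide)
    then have "1 / b1 \<noteq> s ^ 2" for s using sq[of "1 / e" s] e(1) by simp
    moreover have "1 - (1 / b1) ^ 2 = - ((d / b1) ^ 2)"
      unfolding power_divide d[symmetric] using b1 by (simp add: field_simps)
    then have "\<nexists>r. 1 - (1 / b1) ^ 2 = r ^ 2"
      using sq[of "d / b1"] \<open>d \<noteq> 0\<close> b1 by simp
    ultimately show ?thesis using that[of "1 / b1"] b1 by simp
  qed
  have "inj (\<lambda>z. tw z - b * z)"
  proof (rule injI)
    fix x y assume "tw x - b * x = tw y - b * y"
    then have eq: "tw (x - y) = b * (x - y)" by (simp add: tw_diff algebra_simps)
    obtain s where s: "tw (x - y) = (x - y) * s ^ 2" by (rule tw_eq_self_times_square)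
    from eq s have "(x - y) * (b - s ^ 2) = 0" by (simp add: algebra_simps)
    then show "x = y" using b(2)[of s] by simp
  qed
  then have "surj (\<lambda>z. tw z - b * z)" by (rule finite_UNIV_inj_surj[OF finite])
  then obtain z where z: "b + tw b = tw z - b * z"
    using surjD[of _ "b + tw b"] by blast
  show False by (rule not_embedded[OF b(1) sym[OF z] b(3)])
qed

end

theorem theorem1p2:
  fixes n :: nat
  assumes "n > 0"
    and "CARD('k::{field, finite}) = 3 ^ (2 * n + 1)"
  shows
    "(\<forall>P :: ('p, 'l) incidence_structure.
        projective_plane P \<and>
        (\<forall>\<phi> \<psi>. is_embedding ree_unital_3 P \<phi> \<psi> \<longrightarrow>
           (\<exists>S. subplane S P \<and> pappian S \<and>
                \<phi> ` points ree_unital_3 \<subseteq> points S \<and> \<psi> ` lines ree_unital_3 \<subseteq> lines S))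
        \<longrightarrow> \<not> embeddable (ree_unital n :: ('k ree_point, 'k ree_point set) incidence_structure) P)
     \<and> \<not> embeddable (ree_unital n :: ('k ree_point, 'k ree_point set) incidence_structure)
           (PG2 :: (('f::field ^ 3) set, ('f ^ 3) set) incidence_structure)"
proof (intro conjI allI impI notI)
  fix P :: "('p, 'l) incidence_structure"
  assume P: "projective_plane P \<and>
    (\<forall>\<phi> \<psi>. is_embedding ree_unital_3 P \<phi> \<psi> \<longrightarrow>
       (\<exists>S. subplane S P \<and> pappian S \<and>
            \<phi> ` points ree_unital_3 \<subseteq> points S \<and> \<psi> ` lines ree_unital_3 \<subseteq> lines S))"
    and "embeddable (ree_unital n :: ('k ree_point, 'k ree_point set) incidence_structure) P"
  then obtain \<phi> \<psi> where
    "is_embedding (ree_unital n :: ('k ree_point, 'k ree_point set) incidence_structure) P \<phi> \<psi>"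
    unfolding embeddable_def by blast
  with P assms(2) interpret ree_embedding n "TYPE('k)" P \<phi> \<psi>
    by unfold_locales simp_all
  show False using assms(1) by (rule no_ree_embedding)
next
  let ?P = "PG2 :: (('f ^ 3) set, ('f ^ 3) set) incidence_structure"
  assume "embeddable (ree_unital n :: ('k ree_point, 'k ree_point set) incidence_structure) ?P"
  then obtain \<phi> \<psi> where
    "is_embedding (ree_unital n :: ('k ree_point, 'k ree_point set) incidence_structure) ?P \<phi> \<psi>"
    unfolding embeddable_def by blast
  \<comment> \<open>The plane over a field is pappian, so it serves as its own subplane.\<close>
  moreover have "\<exists>S. subplane S ?P \<and> pappian S \<and>
      \<alpha> ` points ree_unital_3 \<subseteq> points S \<and> \<beta> ` lines ree_unital_3 \<subseteq> lines S"
    if "is_embedding ree_unital_3 ?P \<alpha> \<beta>" for \<alpha> \<beta>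
    using that projective_plane_PG2 pappian_PG2
    by (intro exI[of _ ?P]) (simp add: subplane_def is_embedding_def)
  ultimately interpret ree_embedding n "TYPE('k)" ?P \<phi> \<psi>
    using assms(2) projective_plane_PG2 by unfold_locales
  show False using assms(1) by (rule no_ree_embedding)
qed

end
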